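(* Let $\mathbb K$ be a field and $R=\mathbb K[x_1,\dots,x_n]$. (1) Every vertex splittable monomial ideal $I\subseteq R$ admits a minimal pruned resolution. (2) Every linear quotients monomial ideal $I\subseteq R$ admits a minimal pruned resolution. (3) Let $p>0$ be a prime integer, let $0\le r_1<\cdots<r_k$ be integers, and let $J_1,\dots,J_k\subseteq R$ be Borel ideals such that, for $i=1,\dots,k-1$, every minimal monomial generator of $J_i$ has degree $<p^{\,r_{i+1}-r_i}$. Then the ideal $I=J_1^{[p^{r_1}]}\cdots J_k^{[p^{r_k}]}$ admits a minimal pruned resolution.
   Context: $G(I)$ denotes the set of minimal monomial generators of a monomial ideal $I$. Vertex splittable ideals are obtained inductively: (a) $(0)$, $R$ and $(m)$ with $m$ a monomial are vertex splittable; (b) if there exist a variable $x_i$ and vertex splittable ideals $J\subseteq R$, $K\subseteq \mathbb K[x_1,\dots,\widehat{x_i},\dots,x_n]$ ($K$ also regarded as an ideal of $R$ by extension) with $I=x_iJ+K$, $K\subseteq J$ and $G(I)$ the disjoint union of $G(x_iJ)$ and $G(K)$, then $I$ is vertex splittable. Linear quotients: the generators $G(I)=\{m_1,\dots,m_q\}$ can be ordered so that the colon ideal $((m_1,\dots,m_{i-1}):m_i)$ is a prime monomial ideal (generated by variables) for every $2\le i\le q$. Borel ideals ($0$-Borel): for all $i<j$, all $m\in G(J)$ and all $0\le a\le b$, where $b$ is the largest integer such that $x_j^b$ divides $m$, one has $(x_i/x_j)^a m\in J$. For $J=(m_1,\dots,m_q)$, $J^{[p^r]}=(m_1^{p^r},\dots,m_q^{p^r})$.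 Pruned resolutions. For a monomial ideal $I$ with minimal generators in a fixed order $m_1,\dots,m_q$ and $\sigma\subseteq\{1,\dots,q\}$ put $m_\sigma=\mathrm{lcm}(m_i: i\in\sigma)$, $m_\emptyset=1$. The Taylor resolution of $R/I$ is supported on the full simplex $X_{\mathrm{Taylor}}$ on $q$ vertices; the face $\sigma$ has homological degree $|\sigma|$ and multidegree the exponent of $m_\sigma$. Pruning algorithm: for $j=1,\dots,q$ successively (step $j$), for every $\sigma\not\ni j$ with $m_\sigma=m_{\sigma\cup\{j\}}$ and such that neither $\sigma$ nor $\sigma\cup\{j\}$ belongs to a previously selected edge, select (prune) the edge $\{\sigma,\sigma\cup\{j\}\}$. The selected edges form a homogeneous acyclic matching on $X_{\mathrm{Taylor}}$, and discrete Morse theory (Batzies–Welker) yields a $\mathbb Z^n$-graded CW-complex, with cells corresponding to the faces in no selected edge (critical faces), supporting a free resolution of $R/I$: the pruned resolution for the given order. Its module in homological degree $i$ is the direct sum of $R(-\deg m_\sigma)$ over critical $\sigma$ with $|\sigma|=i$; so it is minimal iff, for all $i,\alpha$, the number of critical $\sigma$ with $|\sigma|=i$ and multidegree $\alpha$ is $\beta_{i,\alpha}(R/I)$. Betti splitting version. $I=J+K$, with $G(I)$ the disjoint union of $G(J)$ and $G(K)$, is a Betti splitting if $\beta_{i,\alpha}(I)=\beta_{i,\alpha}(J)+\beta_{i,\alpha}(K)+\beta_{i-1,\alpha}(J\cap K)$ for all $i$ and $\alpha\in\mathbb Z^n$. Then one may prune separately the faces with vertices in $G(J)$, the faces with vertices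 in $G(K)$, and the remaining faces (which account for $J\cap K$), and iterate this using Betti splittings of $J$, $K$, $J\cap K$; this is always a partial pruning of $X_{\mathrm{Taylor}}$, and the numbers of generators (pruned Betti numbers) satisfy $\overline\beta_{i,\alpha}(I)=\overline\beta_{i,\alpha}(J)+\overline\beta_{i,\alpha}(K)+\overline\beta_{i-1,\alpha}(J\cap K)$. $I$ admits a minimal pruned resolution if, for some order of the generators, the cellular resolution given by the pruning algorithm or by its iterated Betti splitting version is minimal. Explicitly (recursively, in finitely many steps): either for some order of $G(I)$ the pruned resolution of $R/I$ is minimal, or there is a Betti splitting $I=J+K$ such that $J$, $K$ and $J\cap K$ all admit minimal pruned resolutions. *)

theory Defs
  imports
    "HOL-Library.Poly_Mapping"
    "HOL-Computational_Algebra.Primes"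
    "Jordan_Normal_Form.Matrix"
begin

section \<open>Monomials and monomial ideals\<close>

text \<open>The variables are the elements of a finite linearly ordered type; a monomial is represented
  by its exponent vector. The order that the library puts on finitely supported functions is
  lexicographic, so divisibility of monomials has its own definition.\<close>

type_synonym 'v expo = "'v \<Rightarrow>\<^sub>0 nat"
type_synonym ('v, 'k) mpoly = "('v \<Rightarrow>\<^sub>0 nat) \<Rightarrow>\<^sub>0 'k"

abbreviation expo_at :: "'v expo \<Rightarrow> 'v \<Rightarrow> nat" where
  "expo_at \<equiv> Poly_Mapping.lookup"

abbreviation pow :: "'v \<Rightarrow> nat \<Rightarrow> 'v expo" where
  "pow \<equiv> Poly_Mapping.single"

definition total_deg :: "('v::finite) expo \<Rightarrow> nat" where
  "total_deg s = (\<Sum>v\<in>UNIV. expo_at s v)"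

definition divides :: "'v expo \<Rightarrow> 'v expo \<Rightarrow> bool" where
  "divides s t \<longleftrightarrow> (\<exists>u. t = s + u)"

definition lcm_expo :: "('v::finite) expo set \<Rightarrow> 'v expo" where
  "lcm_expo S = Abs_poly_mapping (\<lambda>v. Max (insert 0 ((\<lambda>s. expo_at s v) ` S)))"

definition monom :: "'v expo \<Rightarrow> ('v, 'k::comm_ring_1) mpoly" where
  "monom s = Poly_Mapping.single s 1"

definition var :: "'v \<Rightarrow> ('v, 'k::comm_ring_1) mpoly" where
  "var v = monom (pow v 1)"

definition ideal_gen :: "'r::comm_ring_1 set \<Rightarrow> 'r set" where
  "ideal_gen B = Modules.module.span (*) B"

definition ideal_sum :: "'r::comm_ring_1 set \<Rightarrow> 'r set \<Rightarrow> 'r set" where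
  "ideal_sum J K = {a + b | a b. a \<in> J \<and> b \<in> K}"

definition ideal_prod :: "nat set \<Rightarrow> (nat \<Rightarrow> 'r::comm_ring_1 set) \<Rightarrow> 'r set" where
  "ideal_prod A J = ideal_gen {\<Prod>i\<in>A. f i | f. \<forall>i\<in>A. f i \<in> J i}"

definition colon :: "'r::comm_ring_1 set \<Rightarrow> 'r \<Rightarrow> 'r set" where
  "colon J m = {f. f * m \<in> J}"

definition monomial_ideal :: "('v, 'k::field) mpoly set \<Rightarrow> bool" where
  "monomial_ideal I \<longleftrightarrow> (\<exists>S. I = ideal_gen (monom ` S))"

definition mingens :: "('v, 'k::field) mpoly set \<Rightarrow> 'v expo set" where
  "mingens I = {s. monom s \<in> I \<and> (\<forall>t. monom t \<in> I \<longrightarrow> divides t s \<longrightarrow> t = s)}"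

section \<open>The classes of monomial ideals\<close>

text \<open>An ideal of the polynomial ring in the variables \<^term>\<open>V\<close> is represented by its extension
  to the polynomial ring in all variables, so \<^term>\<open>vertex_splittable V I\<close> says that \<^term>\<open>I\<close>
  is the extension of a vertex splittable ideal of the ring in the variables \<^term>\<open>V\<close>.\<close>

inductive vertex_splittable :: "'v set \<Rightarrow> ('v, 'k::field) mpoly set \<Rightarrow> bool" where
  zero: "vertex_splittable V {0}"
| whole: "vertex_splittable V UNIV"
| principal: "Poly_Mapping.keys m \<subseteq> V \<Longrightarrow> vertex_splittable V (ideal_gen {monom m})"
| split: "\<lbrakk> i \<in> V; vertex_splittable V J; vertex_splittable (V - {i}) K;
    I = ideal_sum ((*) (var i) ` J) K; K \<subseteq> J;
    mingens I = mingens ((*) (var i) ` J) \<union> mingens K;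
    mingens ((*) (var i) ` J) \<inter> mingens K = {} \<rbrakk>
  \<Longrightarrow> vertex_splittable V I"

definition linear_quotients :: "('v, 'k::field) mpoly set \<Rightarrow> bool" where
  "linear_quotients I \<longleftrightarrow> monomial_ideal I \<and>
    (\<exists>ms. distinct ms \<and> set ms = mingens I \<and>
      (\<forall>i. 1 \<le> i \<and> i < length ms \<longrightarrow>
        (\<exists>V. colon (ideal_gen (monom ` set (take i ms)) :: ('v, 'k) mpoly set) (monom (ms ! i)) =
          ideal_gen (var ` V))))"

definition borel_ideal :: "('v::linorder, 'k::field) mpoly set \<Rightarrow> bool" where
  "borel_ideal J \<longleftrightarrow> monomial_ideal J \<and>
    (\<forall>i j. i < j \<longrightarrow> (\<forall>m\<in>mingens J. \<forall>a\<le>expo_at m j. monom (m - pow j a + pow i a) \<in> J))"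

definition frob_power :: "nat \<Rightarrow> ('v, 'k::field) mpoly set \<Rightarrow> ('v, 'k) mpoly set" where
  "frob_power q J = ideal_gen ((\<lambda>s. monom s ^ q) ` mingens J)"

section \<open>Minimal multigraded free resolutions and Betti numbers\<close>

text \<open>Resolutions of the multigraded module \<open>A / B\<close>, for monomial ideals \<open>B \<subseteq> A\<close>: the choice
  \<open>B = {0}\<close> gives the ideal \<open>A\<close>, and \<open>A = UNIV\<close> gives the quotient ring by \<open>B\<close>. The free module
  in homological degree \<open>i\<close> has rank \<open>rk i\<close> and its \<open>j\<close>-th basis element has multidegree \<open>dg i j\<close>.
  The matrix \<open>D i\<close> is the differential from homological degree \<open>i + 1\<close> to \<open>i\<close>, and \<open>e\<close> lists
  representatives of the images of the basis elements in degree 0 under the augmentation. Natural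
  exponents suffice for the multidegrees: in a minimal resolution of such a module no
  multidegree has a negative entry.\<close>

definition free_resolution ::
  "('v, 'k::field) mpoly set \<Rightarrow> ('v, 'k) mpoly set \<Rightarrow> (nat \<Rightarrow> nat) \<Rightarrow> (nat \<Rightarrow> nat \<Rightarrow> 'v expo)
    \<Rightarrow> ('v, 'k) mpoly vec \<Rightarrow> (nat \<Rightarrow> ('v, 'k) mpoly mat) \<Rightarrow> bool" where
  "free_resolution A B rk dg e D \<longleftrightarrow>
    e \<in> carrier_vec (rk 0) \<and>
    (\<forall>i. D i \<in> carrier_mat (rk i) (rk (Suc i))) \<and>
    (\<forall>j<rk 0. \<forall>t\<in>Poly_Mapping.keys (e $ j). t = dg 0 j) \<and>
    (\<forall>i. \<forall>r<rk i. \<forall>c<rk (Suc i). \<forall>t\<in>Poly_Mapping.keys (D i $$ (r, c)).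
      dg i r + t = dg (Suc i) c) \<and>
    {e \<bullet> v + b | v b. v \<in> carrier_vec (rk 0) \<and> b \<in> B} = A \<and>
    {v \<in> carrier_vec (rk 0). e \<bullet> v \<in> B} = (*\<^sub>v) (D 0) ` carrier_vec (rk 1) \<and>
    (\<forall>i. {v \<in> carrier_vec (rk (Suc i)). D i *\<^sub>v v = 0\<^sub>v (rk i)} =
      (*\<^sub>v) (D (Suc i)) ` carrier_vec (rk (Suc (Suc i))))"

definition minimal_free_resolution ::
  "('v, 'k::field) mpoly set \<Rightarrow> ('v, 'k) mpoly set \<Rightarrow> (nat \<Rightarrow> nat) \<Rightarrow> (nat \<Rightarrow> nat \<Rightarrow> 'v expo)
    \<Rightarrow> ('v, 'k) mpoly vec \<Rightarrow> (nat \<Rightarrow> ('v, 'k) mpoly mat) \<Rightarrow> bool" where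
  "minimal_free_resolution A B rk dg e D \<longleftrightarrow>
    free_resolution A B rk dg e D \<and>
    (\<forall>i. \<forall>r<rk i. \<forall>c<rk (Suc i). \<not> D i $$ (r, c) dvd 1)"

definition betti ::
  "('v, 'k::field) mpoly set \<Rightarrow> ('v, 'k) mpoly set \<Rightarrow> nat \<Rightarrow> 'v expo \<Rightarrow> nat" where
  "betti A B i \<alpha> = (THE b. \<exists>rk dg e D.
    minimal_free_resolution A B rk dg e D \<and> b = card {j. j < rk i \<and> dg i j = \<alpha>})"

abbreviation betti_ideal :: "('v, 'k::field) mpoly set \<Rightarrow> nat \<Rightarrow> 'v expo \<Rightarrow> nat" where
  "betti_ideal I \<equiv> betti I {0}"

abbreviation betti_quotient :: "('v, 'k::field) mpoly set \<Rightarrow> nat \<Rightarrow> 'v expo \<Rightarrow> nat" where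
  "betti_quotient I \<equiv> betti UNIV I"

section \<open>Pruned resolutions\<close>

text \<open>The faces of the Taylor simplex on the generators \<open>ms\<close> are the subsets of
  \<open>{..<length ms}\<close>, the empty face included.\<close>

definition face_lcm :: "('v::finite) expo list \<Rightarrow> nat set \<Rightarrow> 'v expo" where
  "face_lcm ms \<sigma> = lcm_expo ((!) ms ` \<sigma>)"

text \<open>\<open>pruned_edges ms j\<close> consists of the edges selected in the first \<open>j\<close> steps. The candidates
  of a single step are pairwise disjoint, so they can be selected simultaneously.\<close>

primrec pruned_edges :: "('v::finite) expo list \<Rightarrow> nat \<Rightarrow> nat set set set" where
  "pruned_edges ms 0 = {}"
| "pruned_edges ms (Suc j) = pruned_edges ms j \<union>
    {{\<sigma>, insert j \<sigma>} | \<sigma>. \<sigma> \<subseteq> {..<length ms} \<and> j \<notin> \<sigma> \<and>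
      face_lcm ms \<sigma> = face_lcm ms (insert j \<sigma>) \<and>
      \<sigma> \<notin> \<Union>(pruned_edges ms j) \<and> insert j \<sigma> \<notin> \<Union>(pruned_edges ms j)}"

definition critical_faces :: "('v::finite) expo list \<Rightarrow> nat set set" where
  "critical_faces ms = Pow {..<length ms} - \<Union>(pruned_edges ms (length ms))"

definition pruned_rank :: "('v::finite) expo list \<Rightarrow> nat \<Rightarrow> 'v expo \<Rightarrow> nat" where
  "pruned_rank ms i \<alpha> = card {\<sigma> \<in> critical_faces ms. card \<sigma> = i \<and> face_lcm ms \<sigma> = \<alpha>}"

definition minimal_pruned :: "('v::finite, 'k::field) mpoly set \<Rightarrow> 'v expo list \<Rightarrow> bool" where
  "minimal_pruned I ms \<longleftrightarrow> distinct ms \<and> set ms = mingens I \<and>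
    (\<forall>i \<alpha>. pruned_rank ms i \<alpha> = betti_quotient I i \<alpha>)"

definition betti_splitting ::
  "('v, 'k::field) mpoly set \<Rightarrow> ('v, 'k) mpoly set \<Rightarrow> ('v, 'k) mpoly set \<Rightarrow> bool" where
  "betti_splitting I J K \<longleftrightarrow>
    monomial_ideal J \<and> monomial_ideal K \<and> I = ideal_sum J K \<and>
    mingens I = mingens J \<union> mingens K \<and> mingens J \<inter> mingens K = {} \<and>
    (\<forall>i \<alpha>. betti_ideal I i \<alpha> = betti_ideal J i \<alpha> + betti_ideal K i \<alpha> +
      (if i = 0 then 0 else betti_ideal (J \<inter> K) (i - 1) \<alpha>))"

inductive admits_minimal_pruned :: "('v::finite, 'k::field) mpoly set \<Rightarrow> bool" where
  pruned: "monomial_ideal I \<Longrightarrow> minimal_pruned I ms \<Longrightarrow> admits_minimal_pruned I"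
| splitting: "betti_splitting I J K \<Longrightarrow> admits_minimal_pruned J \<Longrightarrow> admits_minimal_pruned K \<Longrightarrow>
    admits_minimal_pruned (J \<inter> K) \<Longrightarrow> admits_minimal_pruned I"

end

theory Submission
  imports Defs
begin

text \<open>All three families are obtained from principal ideals by iterated Betti splittings. If
  \<open>I = J + K\<close>, the mapping cone of the comparison map from the minimal resolution of \<open>J \<inter> K\<close> to
  those of \<open>J\<close> and \<open>K\<close> resolves \<open>I\<close>; it is minimal, so that the Betti numbers add up, as soon as
  the comparison map has no unit entry. For an ideal with linear quotients, \<open>K\<close> is generated by
  a last generator \<open>m\<close> of maximal degree, and \<open>J \<inter> K\<close> is \<open>m\<close> times an ideal generated by variables.
  A vertex splittable ideal has linear quotients. For \<open>M\<^bsup>[q]\<^esup> L\<close> with \<open>M\<close> Borel, one splits off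
  the multiples of the smallest variable; the degree bound makes it possible to choose the
  comparison map so that it lowers an exponent, which excludes units.\<close>

text \<open>Betti numbers are defined by matrices over the polynomial ring, but a homogeneous entry
  is a scalar times a monomial forced by the multidegrees. The argument therefore runs on scalar
  matrices with labelled basis elements, and exactness becomes linear algebra in each multidegree.
  Keeping the resolved module as position 0 of the complex treats ideals and quotient rings alike.
  Since prunings may be iterated through splittings, the pruning algorithm itself is run only on
  lists with at most one generator. Units are excluded in two ways: for linear quotients the total
  degrees differ, whereas for Borel products equal multidegrees are not ruled out and an exponent
  has to be lowered. This second kind of product is carried along; splitting it yields the second
  kind in fewer variables and the first kind with \<open>L\<close> saturated, so the induction
  closes.\<close>

lemma divides_iff: "divides s t \<longleftrightarrow> (\<forall>v. expo_at s v \<le> expo_at t v)"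
proof
  assume "divides s t" then show "\<forall>v. expo_at s v \<le> expo_at t v"
    by (auto simp: divides_def lookup_add)
next
  assume h: "\<forall>v. expo_at s v \<le> expo_at t v"
  have "t = s + (t - s)"
    using h by (intro poly_mapping_eqI) (simp add: lookup_add lookup_minus)
  then show "divides s t" unfolding divides_def by blast
qed

lemma divides_refl [simp]: "divides s s"
  by (simp add: divides_iff)

lemma divides_trans [trans]: "divides s t \<Longrightarrow> divides t u \<Longrightarrow> divides s u"
  by (meson divides_iff order_trans)

lemma divides_antisym: "divides s t \<Longrightarrow> divides t s \<Longrightarrow> s = t"
  by (intro poly_mapping_eqI) (simp add: divides_iff order_antisym)

lemma zero_divides [simp]: "divides 0 s"
  by (simp add: divides_iff)

lemma divides_zero [simp]: "divides s 0 \<longleftrightarrow> s = 0"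
  using divides_antisym zero_divides by blast

lemma divides_add [simp]: "divides s (s + t)" "divides t (s + t)"
  by (simp_all add: divides_iff lookup_add)

lemma add_minus_divides: "divides s t \<Longrightarrow> s + (t - s) = t"
  by (intro poly_mapping_eqI) (simp add: divides_iff lookup_add lookup_minus)

lemma minus_eqI_divides: "divides s t \<Longrightarrow> divides s u \<Longrightarrow> t - s = u - s \<Longrightarrow> t = u"
  by (metis add_minus_divides)

section \<open>Graded complexes of vector spaces\<close>

text \<open>Presence of a basis element in multidegree \<gamma>. Positions are shifted by one:
  position 0 is the resolved module itself, with a single basis element and nonzero exactly in the
  multidegrees of \<open>P\<close>; position \<open>Suc i\<close> is the free module in homological
  degree \<open>i\<close>.\<close>

definition pres :: "'v expo set \<Rightarrow> (nat \<Rightarrow> nat \<Rightarrow> 'v expo) \<Rightarrow> nat \<Rightarrow> nat \<Rightarrow> 'v expo \<Rightarrow> bool" where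
  "pres P dg i c \<gamma> \<longleftrightarrow> (if i = 0 then \<gamma> \<in> P else divides (dg i c) \<gamma>)"

definition chain :: "'v expo set \<Rightarrow> (nat \<Rightarrow> nat set) \<Rightarrow> (nat \<Rightarrow> nat \<Rightarrow> 'v expo) \<Rightarrow> nat \<Rightarrow> 'v expo
    \<Rightarrow> (nat \<Rightarrow> 'k::field) \<Rightarrow> bool" where
  "chain P X dg i \<gamma> v \<longleftrightarrow> (\<forall>c. v c \<noteq> 0 \<longrightarrow> c \<in> X i \<and> pres P dg i c \<gamma>)"

text \<open>The scalars do not depend on the multidegree: the monomials are determined by the
  labels, so one matrix describes the differential everywhere.\<close>

definition bd :: "(nat \<Rightarrow> nat set) \<Rightarrow> (nat \<Rightarrow> nat \<Rightarrow> nat \<Rightarrow> 'k::field) \<Rightarrow> nat \<Rightarrow> (nat \<Rightarrow> 'k) \<Rightarrow> nat \<Rightarrow> 'k" where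
  "bd X d i v r = (\<Sum>c\<in>X (Suc i). d i r c * v c)"

text \<open>At position 0 every chain is a cycle, so exactness there says that the augmentation is
  onto. Only rows present at \<gamma> are tested, because the module at position 0 may vanish in a
  multidegree where the scalar sum does not.\<close>

definition cyc :: "'v expo set \<Rightarrow> (nat \<Rightarrow> nat set) \<Rightarrow> (nat \<Rightarrow> nat \<Rightarrow> 'v expo) \<Rightarrow>
    (nat \<Rightarrow> nat \<Rightarrow> nat \<Rightarrow> 'k::field) \<Rightarrow> nat \<Rightarrow> 'v expo \<Rightarrow> (nat \<Rightarrow> 'k) \<Rightarrow> bool" where
  "cyc P X dg d i \<gamma> v \<longleftrightarrow> chain P X dg i \<gamma> v \<and>
    (\<forall>j. i = Suc j \<longrightarrow> (\<forall>r. pres P dg j r \<gamma> \<longrightarrow> bd X d j v r = 0))"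

text \<open>A minimal multigraded free resolution, augmented by its module, in scalar form.
  \<open>P\<close> stands for a difference of two up-closed sets (the monomials of A outside B),
  hence convexity. In \<open>dd\<close> with \<open>i = 0\<close>, a column labelled outside
  \<open>P\<close> is exempt: its image is zero in the quotient although the scalar sum need not be.
  \<open>minimal\<close> concerns the maps between free modules, not the augmentation.\<close>

locale gcx =
  fixes P :: "'v expo set" and X :: "nat \<Rightarrow> nat set" and dg :: "nat \<Rightarrow> nat \<Rightarrow> 'v expo"
    and d :: "nat \<Rightarrow> nat \<Rightarrow> nat \<Rightarrow> 'k::field"
  assumes fin: "finite (X i)"
    and X0: "X 0 = {0}"
    and convex: "\<lbrakk>\<alpha> \<in> P; \<beta> \<in> P; divides \<alpha> \<gamma>; divides \<gamma> \<beta>\<rbrakk> \<Longrightarrow> \<gamma> \<in> P"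
    and d_nz: "d i r c \<noteq> 0 \<Longrightarrow> r \<in> X i \<and> c \<in> X (Suc i) \<and> pres P dg i r (dg (Suc i) c)"
    and dd: "c \<in> X (Suc (Suc i)) \<Longrightarrow> (i = 0 \<Longrightarrow> dg (Suc (Suc i)) c \<in> P) \<Longrightarrow>
      (\<Sum>s\<in>X (Suc i). d i r s * d (Suc i) s c) = 0"
    and exact: "cyc P X dg d i \<gamma> v \<Longrightarrow>
      \<exists>w. chain P X dg (Suc i) \<gamma> w \<and> (\<forall>r. pres P dg i r \<gamma> \<longrightarrow> bd X d i w r = v r)"
    and minimal: "d (Suc i) r c \<noteq> 0 \<Longrightarrow> dg (Suc i) r \<noteq> dg (Suc (Suc i)) c"
begin

abbreviation "pre \<equiv> pres P dg"

lemma pres_convex: "\<lbrakk>pre i r a; pre i r c; divides a b; divides b c\<rbrakk> \<Longrightarrow> pre i r b"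
  by (auto simp: pres_def split: if_splits intro: convex divides_trans)

text \<open>A column contributing to row \<open>r\<close> has a label below \<gamma> at which
  \<open>r\<close> is present; as \<open>r\<close> is present at \<gamma>' too, convexity would make
  it present at \<gamma>.\<close>

lemma bd_chain_eq_0:
  assumes "chain P X dg (Suc i) \<gamma> w" "\<not> pre i r \<gamma>" "pre i r \<gamma>'" "divides \<gamma> \<gamma>'"
  shows "bd X d i w r = 0"
  unfolding bd_def
proof (rule sum.neutral, safe)
  fix c assume "c \<in> X (Suc i)"
  show "d i r c * w c = 0"
  proof (rule ccontr)
    assume "\<not> ?thesis"
    then have "d i r c \<noteq> 0" "w c \<noteq> 0" by auto
    then have "pre i r (dg (Suc i) c)" "divides (dg (Suc i) c) \<gamma>"
      using d_nz assms(1) by (auto simp: chain_def pres_def)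
    with assms pres_convex show False by blast
  qed
qed

lemma bd_chain_Suc_eq_0:
  assumes "chain P X dg (Suc (Suc i)) \<gamma> w" "\<not> divides (dg (Suc i) r) \<gamma>"
  shows "bd X d (Suc i) w r = 0"
  unfolding bd_def
proof (rule sum.neutral, safe)
  fix c
  show "d (Suc i) r c * w c = 0"
    using assms d_nz[of "Suc i" r c] by (auto simp: chain_def pres_def dest: divides_trans)
qed

end

text \<open>A lift of the identity at position 0. The ordinary comparison map has the identity as
  \<rho>; another \<rho> prescribes where the image of a basis element must lie. Commutation with
  the augmentation is demanded only for columns labelled in \<open>P\<close>, in accordance with
  \<open>dd\<close>.\<close>

definition chain_map :: "'v expo set \<Rightarrow> (nat \<Rightarrow> nat set) \<Rightarrow> (nat \<Rightarrow> nat \<Rightarrow> 'v expo) \<Rightarrow>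
    (nat \<Rightarrow> nat \<Rightarrow> nat \<Rightarrow> 'k::field) \<Rightarrow> (nat \<Rightarrow> nat set) \<Rightarrow> (nat \<Rightarrow> nat \<Rightarrow> 'v expo) \<Rightarrow>
    (nat \<Rightarrow> nat \<Rightarrow> nat \<Rightarrow> 'k) \<Rightarrow> ('v expo \<Rightarrow> 'v expo) \<Rightarrow> (nat \<Rightarrow> nat \<Rightarrow> nat \<Rightarrow> 'k) \<Rightarrow> bool" where
  "chain_map P X dg d X' dg' d' \<rho> \<phi> \<longleftrightarrow>
    (\<forall>r c. \<phi> 0 r c = (if r = 0 \<and> c = 0 then 1 else 0)) \<and>
    (\<forall>i r c. \<phi> (Suc i) r c \<noteq> 0 \<longrightarrow>
      c \<in> X (Suc i) \<and> r \<in> X' (Suc i) \<and> divides (dg' (Suc i) r) (\<rho> (dg (Suc i) c))) \<and>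
    (\<forall>i r c. c \<in> X (Suc i) \<longrightarrow> (i = 0 \<longrightarrow> dg 1 c \<in> P) \<longrightarrow>
      (\<Sum>s\<in>X' (Suc i). d' i r s * \<phi> (Suc i) s c) = (\<Sum>s\<in>X i. \<phi> i r s * d i s c))"

text \<open>The acyclic carrier argument: the basis element \<open>c\<close> is sent into the part of the second
  complex below \<open>\<rho> (dg i c)\<close>.\<close>

lemma chain_map_exists:
  fixes d d' :: "nat \<Rightarrow> nat \<Rightarrow> nat \<Rightarrow> 'k::field"
  assumes "gcx P X dg d" "gcx P' X' dg' d'"
    and mono: "\<And>a b. divides a b \<Longrightarrow> divides (\<rho> a) (\<rho> b)"
    and PP: "\<And>i c. c \<in> X (Suc i) \<Longrightarrow> dg (Suc i) c \<in> P \<longleftrightarrow> \<rho> (dg (Suc i) c) \<in> P'"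
  shows "\<exists>\<phi>. chain_map P X dg d X' dg' d' \<rho> \<phi>"
proof -
  interpret C: gcx P X dg d by fact
  interpret C': gcx P' X' dg' d' by fact
  \<comment> \<open>\<open>Q i f\<close> says that \<open>f\<close> maps boundaries of basis
    elements to cycles in the transported degree, which is what exactness needs for the next lift;
    \<open>R\<close> is the commuting square between consecutive positions. Dependent choice then
    yields the whole map.\<close>
  define Q where "Q i f \<longleftrightarrow> (i = 0 \<longrightarrow> f = (\<lambda>r c. if r = 0 \<and> c = 0 then 1 else 0)) \<and>
     (\<forall>c\<in>X (Suc i). cyc P' X' dg' d' i (\<rho> (dg (Suc i) c)) (\<lambda>r. \<Sum>s\<in>X i. f r s * d i s c)) \<and>
     (\<forall>r c. i \<noteq> 0 \<longrightarrow> f r c \<noteq> 0 \<longrightarrow> c \<in> X i \<and> r \<in> X' i \<and> divides (dg' i r) (\<rho> (dg i c)))"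
    for i :: nat and f :: "nat \<Rightarrow> nat \<Rightarrow> 'k"
  define R where "R i f g \<longleftrightarrow> (\<forall>r c. c \<in> X (Suc i) \<longrightarrow> pres P' dg' i r (\<rho> (dg (Suc i) c)) \<longrightarrow>
      (\<Sum>s\<in>X' (Suc i). d' i r s * g s c) = (\<Sum>s\<in>X i. f r s * d i s c))"
    for i :: nat and f g :: "nat \<Rightarrow> nat \<Rightarrow> 'k"
  have base: "\<exists>f. Q 0 f"
  proof -
    have "Q 0 (\<lambda>r c. if r = 0 \<and> c = 0 then 1 else 0)"
      unfolding Q_def cyc_def chain_def using C.d_nz[of 0] PP[of _ 0]
      by (auto simp: C.X0 C'.X0 pres_def)
    then show ?thesis by (rule exI[of "Q 0"])
  qed
  have step: "\<exists>g. Q (Suc i) g \<and> R i f g" if f: "Q i f" for i f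
  proof -
    have "\<forall>c\<in>X (Suc i). \<exists>w. chain P' X' dg' (Suc i) (\<rho> (dg (Suc i) c)) w \<and>
        (\<forall>r. pres P' dg' i r (\<rho> (dg (Suc i) c)) \<longrightarrow> bd X' d' i w r = (\<Sum>s\<in>X i. f r s * d i s c))"
    proof
      fix c assume "c \<in> X (Suc i)"
      then have "cyc P' X' dg' d' i (\<rho> (dg (Suc i) c)) (\<lambda>r. \<Sum>s\<in>X i. f r s * d i s c)"
        using f unfolding Q_def by blast
      from C'.exact[OF this]
      show "\<exists>w. chain P' X' dg' (Suc i) (\<rho> (dg (Suc i) c)) w \<and>
        (\<forall>r. pres P' dg' i r (\<rho> (dg (Suc i) c)) \<longrightarrow> bd X' d' i w r = (\<Sum>s\<in>X i. f r s * d i s c))" .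
    qed
    then obtain w where w: "\<And>c. c \<in> X (Suc i) \<Longrightarrow> chain P' X' dg' (Suc i) (\<rho> (dg (Suc i) c)) (w c)"
      "\<And>c r. c \<in> X (Suc i) \<Longrightarrow> pres P' dg' i r (\<rho> (dg (Suc i) c)) \<Longrightarrow>
         bd X' d' i (w c) r = (\<Sum>s\<in>X i. f r s * d i s c)"
      unfolding bchoice_iff by blast
    define g where "g s c = (if c \<in> X (Suc i) then w c s else 0)" for s c
    have R: "R i f g"
      unfolding R_def g_def using w(2) by (simp add: bd_def)
    have fch: "chain P' X' dg' i (\<rho> (dg (Suc i) c)) (\<lambda>r. \<Sum>s\<in>X i. f r s * d i s c)" if "c \<in> X (Suc i)" for c
      using f that unfolding Q_def cyc_def by blast
    have gnz: "c \<in> X (Suc i) \<and> s \<in> X' (Suc i) \<and> divides (dg' (Suc i) s) (\<rho> (dg (Suc i) c))" if "g s c \<noteq> 0" for s c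
      using w(1)[of c] that unfolding g_def chain_def pres_def by (auto split: if_splits)
    \<comment> \<open>The lift was solved only at rows present at
      \<open>\<rho> (dg (Suc i) s)\<close>. A row that becomes present only at the larger degree
      belonging to \<open>c\<close> gives zero on both sides, so the square holds there as
      well.\<close>
    have all: "bd X' d' i (\<lambda>r. g r s) r = (\<Sum>t\<in>X i. f r t * d i t s)"
      if s: "s \<in> X (Suc i)" and le: "divides (dg (Suc i) s) (dg (Suc (Suc i)) c)"
        and pr: "pres P' dg' i r (\<rho> (dg (Suc (Suc i)) c))" for s r c
    proof (cases "pres P' dg' i r (\<rho> (dg (Suc i) s))")
      case True
      then show ?thesis using R s unfolding R_def bd_def by auto
    next
      case False
      have "chain P' X' dg' (Suc i) (\<rho> (dg (Suc i) s)) (\<lambda>r. g r s)"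
        using w(1)[OF s] s unfolding g_def by simp
      from C'.bd_chain_eq_0[OF this False pr mono[OF le]]
      show ?thesis using fch[OF s] False unfolding chain_def by auto
    qed
    have "cyc P' X' dg' d' (Suc i) (\<rho> (dg (Suc (Suc i)) c)) (\<lambda>r. \<Sum>s\<in>X (Suc i). g r s * d (Suc i) s c)"
      if c: "c \<in> X (Suc (Suc i))" for c
      unfolding cyc_def
    proof (intro conjI allI impI)
      show "chain P' X' dg' (Suc i) (\<rho> (dg (Suc (Suc i)) c)) (\<lambda>r. \<Sum>s\<in>X (Suc i). g r s * d (Suc i) s c)"
        unfolding chain_def
      proof (intro allI impI)
        fix r assume "(\<Sum>s\<in>X (Suc i). g r s * d (Suc i) s c) \<noteq> 0"
        then obtain s where "g r s \<noteq> 0" "d (Suc i) s c \<noteq> 0"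
          by (auto elim!: sum.not_neutral_contains_not_neutral)
        then show "r \<in> X' (Suc i) \<and> pres P' dg' (Suc i) r (\<rho> (dg (Suc (Suc i)) c))"
          using gnz[of r s] C.d_nz[of "Suc i" s c] mono by (auto simp: pres_def intro: divides_trans)
      qed
    next
      fix j r assume j: "Suc i = Suc j" and "pres P' dg' j r (\<rho> (dg (Suc (Suc i)) c))"
      then have pr: "pres P' dg' i r (\<rho> (dg (Suc (Suc i)) c))" by simp
      have "bd X' d' i (\<lambda>r. \<Sum>s\<in>X (Suc i). g r s * d (Suc i) s c) r =
          (\<Sum>s\<in>X (Suc i). bd X' d' i (\<lambda>r. g r s) r * d (Suc i) s c)"
        unfolding bd_def sum_distrib_left sum_distrib_right
        by (subst sum.swap) (simp add: mult.assoc)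
      also have "\<dots> = (\<Sum>s\<in>X (Suc i). (\<Sum>t\<in>X i. f r t * d i t s) * d (Suc i) s c)"
      proof (rule sum.cong[OF refl])
        fix s assume "s \<in> X (Suc i)"
        then show "bd X' d' i (\<lambda>r. g r s) r * d (Suc i) s c = (\<Sum>t\<in>X i. f r t * d i t s) * d (Suc i) s c"
          using all[of s c r] pr C.d_nz[of "Suc i" s c] by (cases "d (Suc i) s c = 0") (auto simp: pres_def)
      qed
      also have "\<dots> = (\<Sum>t\<in>X i. f r t * (\<Sum>s\<in>X (Suc i). d i t s * d (Suc i) s c))"
        unfolding sum_distrib_left sum_distrib_right
        by (subst sum.swap) (simp add: mult.assoc)
      also have "\<dots> = 0"
      proof (rule sum.neutral, safe)
        fix t
        have "i = 0 \<Longrightarrow> dg (Suc (Suc i)) c \<in> P" using pr PP[OF c] by (simp add: pres_def)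
        then show "f r t * (\<Sum>s\<in>X (Suc i). d i t s * d (Suc i) s c) = 0"
          using C.dd[OF c] by simp
      qed
      finally show "bd X' d' j (\<lambda>r. \<Sum>s\<in>X (Suc i). g r s * d (Suc i) s c) r = 0" using j by simp
    qed
    then have "Q (Suc i) g"
      unfolding Q_def using gnz by auto
    with R show ?thesis by blast
  qed
  have "\<exists>\<phi>. \<forall>i. Q i (\<phi> i) \<and> R i (\<phi> i) (\<phi> (Suc i))"
    by (rule dependent_nat_choice[of Q R, OF base step])
  then obtain \<phi> where \<phi>: "\<And>i. Q i (\<phi> i)" "\<And>i. R i (\<phi> i) (\<phi> (Suc i))"
    by metis
  have "(\<Sum>s\<in>X' (Suc i). d' i r s * \<phi> (Suc i) s c) = (\<Sum>s\<in>X i. \<phi> i r s * d i s c)"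
    if c: "c \<in> X (Suc i)" and i: "i = 0 \<longrightarrow> dg 1 c \<in> P" for i r c
  proof (cases "pres P' dg' i r (\<rho> (dg (Suc i) c))")
    case True
    then show ?thesis using \<phi>(2)[of i] c unfolding R_def by blast
  next
    case False
    \<comment> \<open>At position 0 the hypothesis relating \<open>P\<close> and \<open>P'\<close>
      makes every row present. A missing row thus occurs only at a free module, where both sides
      vanish.\<close>
    then obtain j where j: "i = Suc j"
      using i PP[of c 0] c by (cases i) (auto simp: pres_def)
    have "chain P' X' dg' (Suc i) (\<rho> (dg (Suc i) c)) (\<lambda>s. \<phi> (Suc i) s c)"
      using \<phi>(1)[of "Suc i"] c unfolding Q_def chain_def pres_def by auto
    then have "bd X' d' i (\<lambda>s. \<phi> (Suc i) s c) r = 0"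
      using C'.bd_chain_Suc_eq_0[of j] False j by (auto simp: pres_def)
    moreover have "(\<Sum>s\<in>X i. \<phi> i r s * d i s c) = 0"
      using \<phi>(1)[of i] c False unfolding Q_def cyc_def chain_def by blast
    ultimately show ?thesis by (simp add: bd_def)
  qed
  moreover have "\<phi> 0 r c = (if r = 0 \<and> c = 0 then 1 else 0)" for r c
    using \<phi>(1)[of 0] unfolding Q_def by simp
  moreover have "c \<in> X (Suc i) \<and> r \<in> X' (Suc i) \<and> divides (dg' (Suc i) r) (\<rho> (dg (Suc i) c))"
    if "\<phi> (Suc i) r c \<noteq> 0" for i r c
    using \<phi>(1)[of "Suc i"] that unfolding Q_def by blast
  ultimately have "chain_map P X dg d X' dg' d' \<rho> \<phi>"
    unfolding chain_map_def by blast
  then show ?thesis by blast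
qed

text \<open>Both maps lift the same augmentation, so the homotopy starts with 0 and is continued by
  exactness of the second complex. It respects labels, because each value is a lift in the
  multidegree of its basis element.\<close>

lemma chain_map_homotopy:
  fixes d d' :: "nat \<Rightarrow> nat \<Rightarrow> nat \<Rightarrow> 'k::field"
  assumes "gcx P X dg d" "gcx P' X' dg' d'"
    and PP: "\<And>i c. c \<in> X (Suc i) \<Longrightarrow> dg (Suc i) c \<in> P \<longleftrightarrow> dg (Suc i) c \<in> P'"
    and \<phi>: "chain_map P X dg d X' dg' d' (\<lambda>\<gamma>. \<gamma>) \<phi>"
    and \<psi>: "chain_map P X dg d X' dg' d' (\<lambda>\<gamma>. \<gamma>) \<psi>"
  shows "\<exists>h. (\<forall>r c. h 0 r c = 0) \<and>
    (\<forall>i r c. h i r c \<noteq> 0 \<longrightarrow> c \<in> X i \<and> r \<in> X' (Suc i) \<and> divides (dg' (Suc i) r) (dg i c)) \<and>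
    (\<forall>i r c. c \<in> X (Suc i) \<longrightarrow> (\<Sum>s\<in>X' (Suc (Suc i)). d' (Suc i) r s * h (Suc i) s c) =
      \<phi> (Suc i) r c - \<psi> (Suc i) r c - (\<Sum>s\<in>X i. h i r s * d i s c))"
proof -
  interpret C: gcx P X dg d by fact
  interpret C': gcx P' X' dg' d' by fact
  \<comment> \<open>The part of \<phi> - \<psi> that the next component of the homotopy has to
    bound.\<close>
  define F where "F i h r c = \<phi> (Suc i) r c - \<psi> (Suc i) r c - (\<Sum>s\<in>X i. h r s * d i s c)"
    for i h r c
  define Q where "Q i h \<longleftrightarrow> (i = 0 \<longrightarrow> h = (\<lambda>r c. 0)) \<and>
     (\<forall>r c. h r c \<noteq> 0 \<longrightarrow> c \<in> X i \<and> r \<in> X' (Suc i) \<and> divides (dg' (Suc i) r) (dg i c)) \<and>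
     (\<forall>c\<in>X (Suc i). cyc P' X' dg' d' (Suc i) (dg (Suc i) c) (\<lambda>r. F i h r c))"
    for i :: nat and h :: "nat \<Rightarrow> nat \<Rightarrow> 'k"
  define R where "R i h g \<longleftrightarrow> (\<forall>r. \<forall>c\<in>X (Suc i).
      (\<Sum>s\<in>X' (Suc (Suc i)). d' (Suc i) r s * g s c) = F i h r c)"
    for i :: nat and h g :: "nat \<Rightarrow> nat \<Rightarrow> 'k"
  have nz: "c \<in> X (Suc i) \<and> r \<in> X' (Suc i) \<and> divides (dg' (Suc i) r) (dg (Suc i) c)"
    if "\<phi> (Suc i) r c \<noteq> 0 \<or> \<psi> (Suc i) r c \<noteq> 0" for i r c
    using that \<phi> \<psi> unfolding chain_map_def by blast
  have comm: "bd X' d' i (\<lambda>s. \<phi> (Suc i) s c) r = (\<Sum>s\<in>X i. \<phi> i r s * d i s c)"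
    "bd X' d' i (\<lambda>s. \<psi> (Suc i) s c) r = (\<Sum>s\<in>X i. \<psi> i r s * d i s c)"
    if "c \<in> X (Suc i)" "i = 0 \<longrightarrow> dg 1 c \<in> P" for i r c
    using that \<phi> \<psi> unfolding chain_map_def bd_def by blast+
  have chF: "chain P' X' dg' (Suc i) (dg (Suc i) c) (\<lambda>r. F i h r c)"
    if "\<And>r c. h r c \<noteq> 0 \<Longrightarrow> c \<in> X i \<and> r \<in> X' (Suc i) \<and> divides (dg' (Suc i) r) (dg i c)"
      "i = 0 \<longrightarrow> h = (\<lambda>r c. 0)" for i h c
    unfolding chain_def
  proof (intro allI impI)
    fix r assume "F i h r c \<noteq> 0"
    then have "\<phi> (Suc i) r c \<noteq> 0 \<or> \<psi> (Suc i) r c \<noteq> 0 \<or> (\<Sum>s\<in>X i. h r s * d i s c) \<noteq> 0"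
      unfolding F_def by auto
    moreover have "r \<in> X' (Suc i) \<and> pres P' dg' (Suc i) r (dg (Suc i) c)"
      if "(\<Sum>s\<in>X i. h r s * d i s c) \<noteq> 0"
    proof -
      obtain s where s: "h r s \<noteq> 0" "d i s c \<noteq> 0"
        using \<open>(\<Sum>s\<in>X i. h r s * d i s c) \<noteq> 0\<close> by (auto elim!: sum.not_neutral_contains_not_neutral)
      then have "i \<noteq> 0" using that(1) \<open>i = 0 \<longrightarrow> h = (\<lambda>r c. 0)\<close> by auto
      then have "divides (dg i s) (dg (Suc i) c)" using C.d_nz[OF s(2)] by (simp add: pres_def)
      then show ?thesis
        using \<open>h r s \<noteq> 0 \<Longrightarrow> s \<in> X i \<and> r \<in> X' (Suc i) \<and> divides (dg' (Suc i) r) (dg i s)\<close> s(1)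
        by (auto simp: pres_def intro: divides_trans)
    qed
    ultimately show "r \<in> X' (Suc i) \<and> pres P' dg' (Suc i) r (dg (Suc i) c)"
      using nz by (auto simp: pres_def)
  qed
  have base: "\<exists>h. Q 0 h"
  proof -
    have "Q 0 (\<lambda>r c. 0)"
      unfolding Q_def
    proof (intro conjI ballI allI impI)
      fix c assume c: "c \<in> X (Suc 0)"
      show "cyc P' X' dg' d' (Suc 0) (dg (Suc 0) c) (\<lambda>r. F 0 (\<lambda>r c. 0) r c)"
        unfolding cyc_def
      proof (intro conjI allI impI)
        show "chain P' X' dg' (Suc 0) (dg (Suc 0) c) (\<lambda>r. F 0 (\<lambda>r c. 0) r c)"
          by (rule chF) auto
        fix j r assume j: "Suc 0 = Suc j" and "pres P' dg' j r (dg (Suc 0) c)"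
        then have "dg 1 c \<in> P" using PP[OF c] by (simp add: pres_def)
        moreover have "\<phi> 0 = \<psi> 0" using \<phi> \<psi> unfolding chain_map_def by (intro ext) simp
        ultimately have "bd X' d' 0 (\<lambda>s. \<phi> 1 s c) r = bd X' d' 0 (\<lambda>s. \<psi> 1 s c) r"
          using comm[OF c] by simp
        then show "bd X' d' j (\<lambda>r. F 0 (\<lambda>r c. 0) r c) r = 0"
          using j by (simp add: F_def bd_def right_diff_distrib sum_subtractf)
      qed
    qed simp_all
    then show ?thesis by (rule exI[of "Q 0"])
  qed
  have step: "\<exists>g. Q (Suc i) g \<and> R i h g" if h: "Q i h" for i h
  proof -
    have cycF: "cyc P' X' dg' d' (Suc i) (dg (Suc i) c) (\<lambda>r. F i h r c)" if "c \<in> X (Suc i)" for c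
      using h that unfolding Q_def by blast
    have "\<forall>c\<in>X (Suc i). \<exists>w. chain P' X' dg' (Suc (Suc i)) (dg (Suc i) c) w \<and>
        (\<forall>r. pres P' dg' (Suc i) r (dg (Suc i) c) \<longrightarrow> bd X' d' (Suc i) w r = F i h r c)"
      using C'.exact[OF cycF] by blast
    then obtain w where w: "\<And>c. c \<in> X (Suc i) \<Longrightarrow> chain P' X' dg' (Suc (Suc i)) (dg (Suc i) c) (w c)"
      "\<And>c r. c \<in> X (Suc i) \<Longrightarrow> pres P' dg' (Suc i) r (dg (Suc i) c) \<Longrightarrow>
         bd X' d' (Suc i) (w c) r = F i h r c"
      unfolding bchoice_iff by blast
    define g where "g s c = (if c \<in> X (Suc i) then w c s else 0)" for s c
    have gnz: "c \<in> X (Suc i) \<and> s \<in> X' (Suc (Suc i)) \<and> divides (dg' (Suc (Suc i)) s) (dg (Suc i) c)"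
      if "g s c \<noteq> 0" for s c
      using w(1)[of c] that unfolding g_def chain_def pres_def by (auto split: if_splits)
    have all: "bd X' d' (Suc i) (\<lambda>s. g s c) r = F i h r c" if c: "c \<in> X (Suc i)" for r c
    proof (cases "divides (dg' (Suc i) r) (dg (Suc i) c)")
      case True
      then show ?thesis using w(2)[OF c, of r] c unfolding g_def by (simp add: pres_def)
    next
      case False
      have "F i h r c = 0"
        using cycF[OF c] False unfolding cyc_def chain_def pres_def by auto
      then show ?thesis
        using C'.bd_chain_Suc_eq_0[OF w(1)[OF c] False] c unfolding g_def by simp
    qed
    have R: "R i h g"
      unfolding R_def using all by (simp add: bd_def)
    have "cyc P' X' dg' d' (Suc (Suc i)) (dg (Suc (Suc i)) c) (\<lambda>r. F (Suc i) g r c)"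
      if c: "c \<in> X (Suc (Suc i))" for c
      unfolding cyc_def
    proof (intro conjI allI impI)
      show "chain P' X' dg' (Suc (Suc i)) (dg (Suc (Suc i)) c) (\<lambda>r. F (Suc i) g r c)"
        by (rule chF) (use gnz in auto)
      fix j r assume j: "Suc (Suc i) = Suc j"
      let ?D = "bd X' d' (Suc i)"
      have "?D (\<lambda>r. F (Suc i) g r c) r = ?D (\<lambda>s. \<phi> (Suc (Suc i)) s c) r - ?D (\<lambda>s. \<psi> (Suc (Suc i)) s c) r
          - ?D (\<lambda>r. \<Sum>s\<in>X (Suc i). g r s * d (Suc i) s c) r"
        unfolding bd_def F_def by (simp add: right_diff_distrib sum_subtractf)
      also have "?D (\<lambda>r. \<Sum>s\<in>X (Suc i). g r s * d (Suc i) s c) r =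
          (\<Sum>s\<in>X (Suc i). ?D (\<lambda>r. g r s) r * d (Suc i) s c)"
        unfolding bd_def sum_distrib_left sum_distrib_right
        by (subst sum.swap) (simp add: mult.assoc)
      also have "\<dots> = (\<Sum>s\<in>X (Suc i). F i h r s * d (Suc i) s c)"
        using all by simp
      also have "\<dots> = (\<Sum>s\<in>X (Suc i). \<phi> (Suc i) r s * d (Suc i) s c)
         - (\<Sum>s\<in>X (Suc i). \<psi> (Suc i) r s * d (Suc i) s c)
         - (\<Sum>s\<in>X (Suc i). (\<Sum>t\<in>X i. h r t * d i t s) * d (Suc i) s c)"
        unfolding F_def by (simp add: left_diff_distrib sum_subtractf)
      also have "(\<Sum>s\<in>X (Suc i). (\<Sum>t\<in>X i. h r t * d i t s) * d (Suc i) s c) =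
          (\<Sum>t\<in>X i. h r t * (\<Sum>s\<in>X (Suc i). d i t s * d (Suc i) s c))"
        unfolding sum_distrib_left sum_distrib_right
        by (subst sum.swap) (simp add: mult.assoc)
      also have "\<dots> = 0"
      proof (rule sum.neutral, safe)
        fix t
        show "h r t * (\<Sum>s\<in>X (Suc i). d i t s * d (Suc i) s c) = 0"
          using C.dd[OF c, of t] h unfolding Q_def by (cases "i = 0") auto
      qed
      finally have "?D (\<lambda>r. F (Suc i) g r c) r = 0" using comm[OF c] by simp
      then show "bd X' d' j (\<lambda>r. F (Suc i) g r c) r = 0" using j by simp
    qed
    then have "Q (Suc i) g"
      unfolding Q_def using gnz by blast
    with R show ?thesis by blast
  qed
  have "\<exists>h. \<forall>i. Q i (h i) \<and> R i (h i) (h (Suc i))"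
    by (rule dependent_nat_choice[of Q R, OF base step])
  then obtain h where h: "\<And>i. Q i (h i)" "\<And>i. R i (h i) (h (Suc i))"
    by metis
  have "\<forall>r c. h 0 r c = 0" using h(1)[of 0] unfolding Q_def by simp
  moreover have "\<forall>i r c. h i r c \<noteq> 0 \<longrightarrow> c \<in> X i \<and> r \<in> X' (Suc i) \<and> divides (dg' (Suc i) r) (dg i c)"
    using h(1) unfolding Q_def by blast
  moreover have "\<forall>i r c. c \<in> X (Suc i) \<longrightarrow> (\<Sum>s\<in>X' (Suc (Suc i)). d' (Suc i) r s * h (Suc i) s c) =
      \<phi> (Suc i) r c - \<psi> (Suc i) r c - (\<Sum>s\<in>X i. h i r s * d i s c)"
    using h(2) unfolding R_def F_def by blast
  ultimately show ?thesis by blast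
qed

text \<open>The maps differ by terms \<open>d' h + h d\<close>. If such a term contributed to an
  entry between equal labels, divisibility along it would force the intermediate label to agree as
  well, and a minimal differential has no nonzero entry between equal labels. So the entries that
  could be units do not depend on the choice of the map.\<close>

lemma chain_map_unique:
  fixes d d' :: "nat \<Rightarrow> nat \<Rightarrow> nat \<Rightarrow> 'k::field"
  assumes "gcx P X dg d" "gcx P' X' dg' d'"
    and PP: "\<And>i c. c \<in> X (Suc i) \<Longrightarrow> dg (Suc i) c \<in> P \<longleftrightarrow> dg (Suc i) c \<in> P'"
    and \<phi>: "chain_map P X dg d X' dg' d' (\<lambda>\<gamma>. \<gamma>) \<phi>"
    and \<psi>: "chain_map P X dg d X' dg' d' (\<lambda>\<gamma>. \<gamma>) \<psi>"
    and eq: "dg' (Suc i) r = dg (Suc i) c"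
  shows "\<phi> (Suc i) r c = \<psi> (Suc i) r c"
proof (cases "c \<in> X (Suc i)")
  case False
  then show ?thesis using \<phi> \<psi> unfolding chain_map_def by metis
next
  case c: True
  interpret C: gcx P X dg d by fact
  interpret C': gcx P' X' dg' d' by fact
  obtain h where h0: "\<And>r c. h 0 r c = 0"
    and hnz: "\<And>i r c. h i r c \<noteq> 0 \<Longrightarrow> c \<in> X i \<and> r \<in> X' (Suc i) \<and> divides (dg' (Suc i) r) (dg i c)"
    and h: "\<And>i r c. c \<in> X (Suc i) \<Longrightarrow> (\<Sum>s\<in>X' (Suc (Suc i)). d' (Suc i) r s * h (Suc i) s c) =
      \<phi> (Suc i) r c - \<psi> (Suc i) r c - (\<Sum>s\<in>X i. h i r s * d i s c)"
    using chain_map_homotopy[OF assms(1,2) PP \<phi> \<psi>] by blast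
  have "(\<Sum>s\<in>X' (Suc (Suc i)). d' (Suc i) r s * h (Suc i) s c) = 0"
  proof (rule sum.neutral, safe, rule ccontr)
    fix s assume "d' (Suc i) r s * h (Suc i) s c \<noteq> 0"
    then have "d' (Suc i) r s \<noteq> 0" "h (Suc i) s c \<noteq> 0" by auto
    then show False
      using C'.d_nz[of "Suc i" r s] hnz[of "Suc i" s c] C'.minimal[of i r s] eq divides_antisym
      by (auto simp: pres_def)
  qed
  moreover have "(\<Sum>s\<in>X i. h i r s * d i s c) = 0"
  proof (rule sum.neutral, safe, rule ccontr)
    fix s assume "h i r s * d i s c \<noteq> 0"
    then have *: "h i r s \<noteq> 0" "d i s c \<noteq> 0" by auto
    then obtain j where j: "i = Suc j" using h0 by (cases i) auto
    then show False
      using C.d_nz[of i s c] hnz[of i r s] C.minimal[of j s c] eq divides_antisym *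
      by (auto simp: pres_def)
  qed
  ultimately show ?thesis using h[OF c, of r] by simp
qed

section \<open>Invariance of the multigraded ranks\<close>

lemma poly_mapping_eq_sum_single:
  "f = (\<Sum>k\<in>Poly_Mapping.keys f. Poly_Mapping.single k (Poly_Mapping.lookup f k))"
proof (rule poly_mapping_eqI)
  fix t
  have "Poly_Mapping.lookup (\<Sum>k\<in>Poly_Mapping.keys f. Poly_Mapping.single k (Poly_Mapping.lookup f k)) t =
      (\<Sum>k\<in>Poly_Mapping.keys f. if k = t then Poly_Mapping.lookup f k else 0)"
    unfolding lookup_sum lookup_single when_def by (rule refl)
  also have "\<dots> = Poly_Mapping.lookup f t"
    by (simp add: sum.delta in_keys_iff)
  finally show "Poly_Mapping.lookup f t = Poly_Mapping.lookup
      (\<Sum>k\<in>Poly_Mapping.keys f. Poly_Mapping.single k (Poly_Mapping.lookup f k)) t" ..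
qed

lemma single_mult:
  fixes f :: "'a::comm_monoid_add \<Rightarrow>\<^sub>0 'k::comm_ring_1"
  shows "Poly_Mapping.single s a * f = (\<Sum>k\<in>Poly_Mapping.keys f. Poly_Mapping.single (s + k) (a * Poly_Mapping.lookup f k))"
proof -
  have "Poly_Mapping.single s a * f =
      Poly_Mapping.single s a * (\<Sum>k\<in>Poly_Mapping.keys f. Poly_Mapping.single k (Poly_Mapping.lookup f k))"
    using poly_mapping_eq_sum_single[of f] by simp
  then show ?thesis by (simp add: sum_distrib_left mult_single)
qed

lemma lookup_single_add_mult:
  fixes f :: "'a::cancel_comm_monoid_add \<Rightarrow>\<^sub>0 'k::comm_ring_1"
  shows "Poly_Mapping.lookup (Poly_Mapping.single s a * f) (s + t) = a * Poly_Mapping.lookup f t"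
proof -
  have "Poly_Mapping.lookup (Poly_Mapping.single s a * f) (s + t) =
      (\<Sum>k\<in>Poly_Mapping.keys f. if k = t then a * Poly_Mapping.lookup f k else 0)"
    unfolding single_mult lookup_sum lookup_single when_def by simp
  also have "\<dots> = a * Poly_Mapping.lookup f t"
    by (simp add: sum.delta in_keys_iff)
  finally show ?thesis .
qed

lemma lookup_single_zero_mult:
  fixes f :: "nat \<Rightarrow>\<^sub>0 'k::comm_ring_1"
  shows "Poly_Mapping.lookup (Poly_Mapping.single 0 a * f) t = a * Poly_Mapping.lookup f t"
  using lookup_single_add_mult[of 0 a f t] by simp

lemma lookup_single_mult_eq_0:
  fixes f :: "('v, 'k::comm_ring_1) mpoly"
  assumes "\<not> divides s t"
  shows "Poly_Mapping.lookup (Poly_Mapping.single s a * f) t = 0"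
  unfolding single_mult lookup_sum lookup_single when_def
  using assms by (intro sum.neutral) auto

lemma lookup_single_mult:
  fixes f :: "('v, 'k::comm_ring_1) mpoly"
  shows "Poly_Mapping.lookup (Poly_Mapping.single s a * f) t =
    (if divides s t then a * Poly_Mapping.lookup f (t - s) else 0)"
  using lookup_single_mult_eq_0[of s t a f] lookup_single_add_mult[of s a f "t - s"]
  by (auto simp: add_minus_divides)

text \<open>The columns of \<open>A\<close> are independent and lie in the span of
  \<open>card T\<close> unit vectors. They are taken as finitely supported functions, on which
  multiplication by constants serves as scalar multiplication.\<close>

lemma card_le_of_left_inverse:
  fixes A B :: "nat \<Rightarrow> nat \<Rightarrow> 'k::field"
  assumes "finite S" "finite T"
    and BA: "\<And>r c. r \<in> S \<Longrightarrow> c \<in> S \<Longrightarrow> (\<Sum>t\<in>T. B r t * A t c) = (if r = c then 1 else 0)"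
  shows "card S \<le> card T"
proof -
  let ?sc = "\<lambda>(a::'k) (v::nat \<Rightarrow>\<^sub>0 'k). Poly_Mapping.single 0 a * v"
  interpret vector_space ?sc
    by unfold_locales (simp_all add: distrib_left distrib_right single_add mult_single
        mult.assoc[symmetric] single_one)
  define v where "v c = (\<Sum>t\<in>T. Poly_Mapping.single t (A t c))" for c
  have lv: "Poly_Mapping.lookup (v c) t = (if t \<in> T then A t c else 0)" for c t
    unfolding v_def using \<open>finite T\<close> by (simp add: lookup_sum lookup_single when_def sum.delta)
  have lin: "u r = 0" if r: "r \<in> S" and z: "(\<Sum>c\<in>S. ?sc (u c) (v c)) = 0" for u r
  proof -
    have z': "(\<Sum>c\<in>S. u c * A t c) = 0" if "t \<in> T" for t
    proof -
      have "Poly_Mapping.lookup (\<Sum>c\<in>S. ?sc (u c) (v c)) t = (\<Sum>c\<in>S. u c * A t c)"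
        using that by (simp add: lookup_sum lookup_single_zero_mult lv)
      then show ?thesis using z by simp
    qed
    have "u r = (\<Sum>c\<in>S. if r = c then u c else 0)"
      using \<open>finite S\<close> r by simp
    also have "\<dots> = (\<Sum>c\<in>S. u c * (\<Sum>t\<in>T. B r t * A t c))"
      using BA[OF r] by (intro sum.cong) auto
    also have "\<dots> = (\<Sum>t\<in>T. B r t * (\<Sum>c\<in>S. u c * A t c))"
      unfolding sum_distrib_left by (subst sum.swap) (simp add: mult_ac)
    also have "\<dots> = 0" using z' by simp
    finally show ?thesis .
  qed
  have inj: "inj_on v S"
  proof
    fix r c assume rc: "r \<in> S" "c \<in> S" "v r = v c"
    then have "A t r = A t c" if "t \<in> T" for t using lv[of r t] lv[of c t] that by simp
    then have "(\<Sum>t\<in>T. B r t * A t r) = (\<Sum>t\<in>T. B r t * A t c)" by simp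
    then show "r = c" using BA[of r r] BA[of r c] rc by (auto split: if_splits)
  qed
  have "independent (v ` S)"
  proof (rule independent_if_scalars_zero)
    show "finite (v ` S)" using \<open>finite S\<close> by simp
    fix f x assume "(\<Sum>x\<in>v ` S. ?sc (f x) x) = 0" "x \<in> v ` S"
    then show "f x = 0" using lin[of _ "\<lambda>c. f (v c)"] by (auto simp: sum.reindex[OF inj])
  qed
  moreover have "v ` S \<subseteq> span ((\<lambda>t. Poly_Mapping.single t 1) ` T)"
  proof safe
    fix c
    have "v c = (\<Sum>t\<in>T. ?sc (A t c) (Poly_Mapping.single t 1))"
      unfolding v_def by (simp add: mult_single)
    also have "\<dots> \<in> span ((\<lambda>t. Poly_Mapping.single t 1) ` T)"
      by (intro span_sum span_scale span_base) auto
    finally show "v c \<in> span ((\<lambda>t. Poly_Mapping.single t 1) ` T)" .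
  qed
  ultimately have "card (v ` S) \<le> card ((\<lambda>t. Poly_Mapping.single t (1::'k)) ` T)"
    using independent_span_bound \<open>finite T\<close> by blast
  also have "\<dots> \<le> card T" by (rule card_image_le) fact
  finally show ?thesis by (simp add: card_image[OF inj])
qed

text \<open>Only the square at the augmentation needs care, as \<psi> commutes there just for
  columns labelled in \<open>P\<close>. An intermediate basis element outside \<open>P\<close>
  contributes nothing: its label would lie between two labels in \<open>P\<close>.\<close>

lemma chain_map_comp:
  assumes "gcx P X dg d" "gcx P X' dg' d'"
    and \<phi>: "chain_map P X dg d X' dg' d' (\<lambda>\<gamma>. \<gamma>) \<phi>"
    and \<psi>: "chain_map P X' dg' d' X dg d (\<lambda>\<gamma>. \<gamma>) \<psi>"
  shows "chain_map P X dg d X dg d (\<lambda>\<gamma>. \<gamma>) (\<lambda>i r c. \<Sum>s\<in>X' i. \<psi> i r s * \<phi> i s c)"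
  unfolding chain_map_def
proof (intro conjI allI impI)
  interpret C: gcx P X dg d by fact
  interpret C': gcx P X' dg' d' by fact
  note \<phi>' = \<phi>[unfolded chain_map_def] and \<psi>' = \<psi>[unfolded chain_map_def]
  have \<phi>c: "(\<Sum>s\<in>X' (Suc i). d' i r s * \<phi> (Suc i) s c) = (\<Sum>s\<in>X i. \<phi> i r s * d i s c)"
    if "c \<in> X (Suc i)" "i = 0 \<longrightarrow> dg 1 c \<in> P" for i r c using \<phi>' that by blast
  have \<psi>c: "(\<Sum>s\<in>X (Suc i). d i r s * \<psi> (Suc i) s c) = (\<Sum>s\<in>X' i. \<psi> i r s * d' i s c)"
    if "c \<in> X' (Suc i)" "i = 0 \<longrightarrow> dg' 1 c \<in> P" for i r c using \<psi>' that by blast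
  have \<phi>nz: "c \<in> X (Suc i)" "r \<in> X' (Suc i)" "divides (dg' (Suc i) r) (dg (Suc i) c)"
    if "\<phi> (Suc i) r c \<noteq> 0" for i r c using \<phi>' that by blast+
  have \<psi>nz: "c \<in> X' (Suc i)" "r \<in> X (Suc i)" "divides (dg (Suc i) r) (dg' (Suc i) c)"
    if "\<psi> (Suc i) r c \<noteq> 0" for i r c using \<psi>' that by blast+
  show "(\<Sum>s\<in>X' 0. \<psi> 0 r s * \<phi> 0 s c) = (if r = 0 \<and> c = 0 then 1 else 0)" for r c
    unfolding C'.X0 by (simp add: conjunct1[OF \<phi>'] conjunct1[OF \<psi>'])
  { fix i r c assume "(\<Sum>s\<in>X' (Suc i). \<psi> (Suc i) r s * \<phi> (Suc i) s c) \<noteq> 0"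
    then obtain s where s: "\<psi> (Suc i) r s \<noteq> 0" "\<phi> (Suc i) s c \<noteq> 0"
      by (auto elim!: sum.not_neutral_contains_not_neutral)
    show "c \<in> X (Suc i)" "r \<in> X (Suc i)" using \<phi>nz(1)[OF s(2)] \<psi>nz(2)[OF s(1)] .
    show "divides (dg (Suc i) r) (dg (Suc i) c)"
      using \<psi>nz(3)[OF s(1)] \<phi>nz(3)[OF s(2)] by (rule divides_trans) }
  fix i r c assume c: "c \<in> X (Suc i)" and i: "i = 0 \<longrightarrow> dg 1 c \<in> P"
  have "(\<Sum>s\<in>X (Suc i). d i r s * (\<Sum>t\<in>X' (Suc i). \<psi> (Suc i) s t * \<phi> (Suc i) t c)) =
    (\<Sum>t\<in>X' (Suc i). (\<Sum>s\<in>X (Suc i). d i r s * \<psi> (Suc i) s t) * \<phi> (Suc i) t c)"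
    unfolding sum_distrib_left sum_distrib_right by (subst sum.swap) (simp add: mult.assoc)
  also have "\<dots> = (\<Sum>t\<in>X' (Suc i). (\<Sum>s\<in>X' i. \<psi> i r s * d' i s t) * \<phi> (Suc i) t c)"
  proof (rule sum.cong[OF refl])
    fix t assume t: "t \<in> X' (Suc i)"
    show "(\<Sum>s\<in>X (Suc i). d i r s * \<psi> (Suc i) s t) * \<phi> (Suc i) t c =
      (\<Sum>s\<in>X' i. \<psi> i r s * d' i s t) * \<phi> (Suc i) t c"
    proof (cases "i = 0 \<longrightarrow> dg' 1 t \<in> P")
      case True
      then show ?thesis using \<psi>c[OF t, of r] by simp
    next
      case False
      have nz: "d 0 r s * \<psi> (Suc 0) s t * \<phi> (Suc 0) t c = 0" for s
      proof (rule ccontr)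
        assume "\<not> ?thesis"
        then have *: "d 0 r s \<noteq> 0" "\<psi> (Suc 0) s t \<noteq> 0" "\<phi> (Suc 0) t c \<noteq> 0" by auto
        have "dg (Suc 0) s \<in> P" using C.d_nz[OF *(1)] by (simp add: pres_def)
        moreover have "divides (dg (Suc 0) s) (dg' (Suc 0) t)" "divides (dg' (Suc 0) t) (dg (Suc 0) c)"
          using \<psi>nz(3)[OF *(2)] \<phi>nz(3)[OF *(3)] .
        ultimately show False using C.convex[of _ "dg (Suc 0) c" "dg' (Suc 0) t"] i False by auto
      qed
      moreover have "d' 0 s t = 0" for s
        using False C'.d_nz[of 0 s t] by (auto simp: pres_def)
      moreover have "(\<Sum>s\<in>X (Suc 0). d 0 r s * \<psi> (Suc 0) s t) * \<phi> (Suc 0) t c = 0"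
        unfolding sum_distrib_right using nz by (rule sum.neutral[OF ballI])
      ultimately show ?thesis using False by simp
    qed
  qed
  also have "\<dots> = (\<Sum>s\<in>X' i. \<psi> i r s * (\<Sum>t\<in>X' (Suc i). d' i s t * \<phi> (Suc i) t c))"
    unfolding sum_distrib_left sum_distrib_right by (subst sum.swap) (simp add: mult.assoc)
  also have "\<dots> = (\<Sum>s\<in>X' i. \<psi> i r s * (\<Sum>t\<in>X i. \<phi> i s t * d i t c))"
    using \<phi>c[OF c i] by simp
  also have "\<dots> = (\<Sum>s\<in>X i. (\<Sum>t\<in>X' i. \<psi> i r t * \<phi> i t s) * d i s c)"
    unfolding sum_distrib_left sum_distrib_right by (subst sum.swap) (simp add: mult.assoc)
  finally show "(\<Sum>s\<in>X (Suc i). d i r s * (\<Sum>t\<in>X' (Suc i). \<psi> (Suc i) s t * \<phi> (Suc i) t c)) =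
       (\<Sum>s\<in>X i. (\<Sum>t\<in>X' i. \<psi> i r t * \<phi> i t s) * d i s c)" .
qed

lemma chain_map_id:
  assumes "gcx P X dg d"
  shows "chain_map P X dg d X dg d (\<lambda>\<gamma>. \<gamma>) (\<lambda>i r c. if r = c \<and> c \<in> X i then 1 else 0)"
proof -
  interpret gcx P X dg d by fact
  have "(\<Sum>s\<in>X (Suc i). d i r s * (if s = c \<and> c \<in> X (Suc i) then 1 else 0)) =
      (\<Sum>s\<in>X i. (if r = s \<and> s \<in> X i then 1 else 0) * d i s c)" if c: "c \<in> X (Suc i)" for i r c
  proof -
    have "(\<Sum>s\<in>X (Suc i). d i r s * (if s = c \<and> c \<in> X (Suc i) then 1 else 0)) =
        (\<Sum>s\<in>X (Suc i). if s = c then d i r s else 0)"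
      using c by (intro sum.cong) auto
    also have "\<dots> = (\<Sum>s\<in>X i. if s = r then d i s c else 0)"
    proof -
      have "(\<Sum>s\<in>X (Suc i). if s = c then d i r s else 0) = d i r c"
        using c fin by simp
      also have "\<dots> = (\<Sum>s\<in>X i. if s = r then d i s c else 0)"
        using fin d_nz[of i r c] by (cases "r \<in> X i") auto
      finally show ?thesis .
    qed
    also have "\<dots> = (\<Sum>s\<in>X i. (if r = s \<and> s \<in> X i then 1 else 0) * d i s c)"
      by (intro sum.cong) auto
    finally show ?thesis .
  qed
  then show ?thesis
    unfolding chain_map_def
    by (intro conjI allI impI) (blast | simp add: X0 split: if_splits)+
qed

text \<open>Comparison maps in both directions compose to a self-map that agrees with the identity
  on entries between equal labels. On the block of multidegree \<alpha>, one map is therefore a left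
  inverse of the other.\<close>

lemma card_generators_le:
  fixes d d' :: "nat \<Rightarrow> nat \<Rightarrow> nat \<Rightarrow> 'k::field"
  assumes "gcx P X dg d" "gcx P X' dg' d'"
  shows "card {c \<in> X (Suc i). dg (Suc i) c = \<alpha>} \<le> card {c \<in> X' (Suc i). dg' (Suc i) c = \<alpha>}"
    (is "card ?S \<le> card ?T")
proof -
  interpret C: gcx P X dg d by fact
  interpret C': gcx P X' dg' d' by fact
  have "\<exists>\<phi>. chain_map P X dg d X' dg' d' (\<lambda>\<gamma>. \<gamma>) \<phi>"
    by (rule chain_map_exists[OF assms]) simp_all
  then obtain \<phi> where \<phi>: "chain_map P X dg d X' dg' d' (\<lambda>\<gamma>. \<gamma>) \<phi>" by blast
  have "\<exists>\<psi>. chain_map P X' dg' d' X dg d (\<lambda>\<gamma>. \<gamma>) \<psi>"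
    by (rule chain_map_exists[OF assms(2,1)]) simp_all
  then obtain \<psi> where \<psi>: "chain_map P X' dg' d' X dg d (\<lambda>\<gamma>. \<gamma>) \<psi>" by blast
  show ?thesis
  proof (rule card_le_of_left_inverse)
    show "finite ?S" "finite ?T" using C.fin C'.fin by simp_all
    fix r c assume rc: "r \<in> ?S" "c \<in> ?S"
    \<comment> \<open>A nonzero summand squeezes the intermediate label between \<alpha> and
      \<alpha>, so the full product of the matrices involves only the block
      \<open>?T\<close>.\<close>
    have "(\<Sum>t\<in>?T. \<psi> (Suc i) r t * \<phi> (Suc i) t c) = (\<Sum>t\<in>X' (Suc i). \<psi> (Suc i) r t * \<phi> (Suc i) t c)"
    proof (rule sum.mono_neutral_left)
      show "\<forall>t\<in>X' (Suc i) - ?T. \<psi> (Suc i) r t * \<phi> (Suc i) t c = 0"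
      proof (rule ballI, rule ccontr)
        fix t assume t: "t \<in> X' (Suc i) - ?T" and "\<psi> (Suc i) r t * \<phi> (Suc i) t c \<noteq> 0"
        then have "\<psi> (Suc i) r t \<noteq> 0" "\<phi> (Suc i) t c \<noteq> 0" by auto
        then have "divides (dg (Suc i) r) (dg' (Suc i) t)" "divides (dg' (Suc i) t) (dg (Suc i) c)"
          using \<phi> \<psi> unfolding chain_map_def by blast+
        then show False using rc t divides_antisym by auto
      qed
    qed (use C'.fin in auto)
    also have "\<dots> = (if r = c \<and> c \<in> X (Suc i) then 1 else 0)"
      by (rule chain_map_unique[OF assms(1,1) _ chain_map_comp[OF assms \<phi> \<psi>] chain_map_id[OF assms(1)],
            where i = i and r = r and c = c]) (use rc in simp_all)
    finally show "(\<Sum>t\<in>?T. \<psi> (Suc i) r t * \<phi> (Suc i) t c) = (if r = c then 1 else 0)"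
      using rc by simp
  qed
qed

lemma card_generators_unique:
  fixes d d' :: "nat \<Rightarrow> nat \<Rightarrow> nat \<Rightarrow> 'k::field"
  assumes "gcx P X dg d" "gcx P X' dg' d'"
  shows "card {c \<in> X (Suc i). dg (Suc i) c = \<alpha>} = card {c \<in> X' (Suc i). dg' (Suc i) c = \<alpha>}"
  using card_generators_le[OF assms] card_generators_le[OF assms(2,1)] by (rule order_antisym)

section \<open>Mapping cones over an intersection of up-closed sets\<close>

definition upset :: "'v expo set \<Rightarrow> bool" where
  "upset S \<longleftrightarrow> (\<forall>s t. s \<in> S \<longrightarrow> divides s t \<longrightarrow> t \<in> S)"

lemma upsetD: "upset S \<Longrightarrow> s \<in> S \<Longrightarrow> divides s t \<Longrightarrow> t \<in> S"
  unfolding upset_def by blast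

text \<open>Three copies of the natural numbers, indexing the summands of a mapping cone.\<close>

definition tJ :: "nat \<Rightarrow> nat" where "tJ q = 3 * q"
definition tK :: "nat \<Rightarrow> nat" where "tK q = 3 * q + 1"
definition tA :: "nat \<Rightarrow> nat" where "tA q = 3 * q + 2"

lemma t_cases:
  obtains (J) q where "c = tJ q" | (K) q where "c = tK q" | (A) q where "c = tA q"
proof -
  have "c mod 3 = 0 \<or> c mod 3 = 1 \<or> c mod 3 = 2" by presburger
  then have "c = tJ (c div 3) \<or> c = tK (c div 3) \<or> c = tA (c div 3)"
    unfolding tJ_def tK_def tA_def by presburger
  then show ?thesis using that by blast
qed

lemma t_simps [simp]:
  "tJ a = tJ b \<longleftrightarrow> a = b" "tK a = tK b \<longleftrightarrow> a = b" "tA a = tA b \<longleftrightarrow> a = b"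
  "tJ a \<noteq> tK b" "tJ a \<noteq> tA b" "tK a \<noteq> tA b" "tK a \<noteq> tJ b" "tA a \<noteq> tJ b" "tA a \<noteq> tK b"
  "tJ a mod 3 = 0" "tK a mod 3 = 1" "tA a mod 3 = 2" "tJ a div 3 = a" "tK a div 3 = a" "tA a div 3 = a"
  unfolding tJ_def tK_def tA_def by presburger+

text \<open>Modelled on the exact sequence of the intersection, the direct sum and the sum of two
  ideals. All labels lie in the modules being resolved, so the commutation rules hold at the
  augmentation without exception. \<open>\<phi>min\<close> and \<open>\<psi>min\<close> are the
  absence of units that keeps the cone minimal.\<close>

locale cone =
  J: gcx SJ XJ gJ dJ + K: gcx SK XK gK dK + A: gcx "SJ \<inter> SK" XA gA dA
  for SJ :: "'v expo set" and XJ gJ and dJ :: "nat \<Rightarrow> nat \<Rightarrow> nat \<Rightarrow> 'k::field"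
    and SK :: "'v expo set" and XK gK and dK :: "nat \<Rightarrow> nat \<Rightarrow> nat \<Rightarrow> 'k"
    and XA gA and dA :: "nat \<Rightarrow> nat \<Rightarrow> nat \<Rightarrow> 'k" +
  fixes \<phi> \<psi> :: "nat \<Rightarrow> nat \<Rightarrow> nat \<Rightarrow> 'k"
  assumes upJ: "upset SJ" and upK: "upset SK"
    and supJ: "c \<in> XJ (Suc i) \<Longrightarrow> gJ (Suc i) c \<in> SJ"
    and supK: "c \<in> XK (Suc i) \<Longrightarrow> gK (Suc i) c \<in> SK"
    and supA: "c \<in> XA (Suc i) \<Longrightarrow> gA (Suc i) c \<in> SJ \<inter> SK"
    and \<phi>: "chain_map (SJ \<inter> SK) XA gA dA XJ gJ dJ (\<lambda>\<gamma>. \<gamma>) \<phi>"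
    and \<psi>: "chain_map (SJ \<inter> SK) XA gA dA XK gK dK (\<lambda>\<gamma>. \<gamma>) \<psi>"
    and \<phi>min: "\<phi> (Suc i) r c \<noteq> 0 \<Longrightarrow> gJ (Suc i) r \<noteq> gA (Suc i) c"
    and \<psi>min: "\<psi> (Suc i) r c \<noteq> 0 \<Longrightarrow> gK (Suc i) r \<noteq> gA (Suc i) c"
begin

lemma \<phi>0: "\<phi> 0 r c = (if r = 0 \<and> c = 0 then 1 else 0)"
  and \<psi>0: "\<psi> 0 r c = (if r = 0 \<and> c = 0 then 1 else 0)"
  using \<phi> \<psi> unfolding chain_map_def by blast+

lemma \<phi>nz: "\<phi> (Suc i) r c \<noteq> 0 \<Longrightarrow>
    c \<in> XA (Suc i) \<and> r \<in> XJ (Suc i) \<and> divides (gJ (Suc i) r) (gA (Suc i) c)"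
  using \<phi> unfolding chain_map_def by blast

lemma \<psi>nz: "\<psi> (Suc i) r c \<noteq> 0 \<Longrightarrow>
    c \<in> XA (Suc i) \<and> r \<in> XK (Suc i) \<and> divides (gK (Suc i) r) (gA (Suc i) c)"
  using \<psi> unfolding chain_map_def by blast

lemma \<phi>c: "c \<in> XA (Suc i) \<Longrightarrow>
    (\<Sum>s\<in>XJ (Suc i). dJ i r s * \<phi> (Suc i) s c) = (\<Sum>s\<in>XA i. \<phi> i r s * dA i s c)"
  using \<phi> supA[of c 0] unfolding chain_map_def One_nat_def by blast

lemma \<psi>c: "c \<in> XA (Suc i) \<Longrightarrow>
    (\<Sum>s\<in>XK (Suc i). dK i r s * \<psi> (Suc i) s c) = (\<Sum>s\<in>XA i. \<psi> i r s * dA i s c)"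
  using \<psi> supA[of c 0] unfolding chain_map_def One_nat_def by blast

text \<open>The summand of the intersection is shifted by one. \<open>XA 0\<close> stands for the
  intersection itself and not for a free module, so nothing is contributed when
  \<open>j = 0\<close>.\<close>

definition X :: "nat \<Rightarrow> nat set" where
  "X i = (case i of 0 \<Rightarrow> {0} | Suc j \<Rightarrow> tJ ` XJ i \<union> tK ` XK i \<union>
    (if j = 0 then {} else tA ` XA j))"

definition g :: "nat \<Rightarrow> nat \<Rightarrow> 'v expo" where
  "g i c = (if c mod 3 = 0 then gJ i (c div 3) else if c mod 3 = 1 then gK i (c div 3)
    else gA (i - 1) (c div 3))"

text \<open>\<open>\<phi>\<close> and \<open>- \<psi>\<close> cancel after augmentation, and the
  sign of \<open>- dA\<close> makes the squares of the differential vanish.\<close>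

definition d :: "nat \<Rightarrow> nat \<Rightarrow> nat \<Rightarrow> 'k" where
  "d i r c = (case i of
      0 \<Rightarrow> if r \<noteq> 0 then 0 else if c mod 3 = 0 then dJ 0 0 (c div 3)
        else if c mod 3 = 1 then dK 0 0 (c div 3) else 0
    | Suc j \<Rightarrow>
        if r mod 3 = 0 then (if c mod 3 = 0 then dJ i (r div 3) (c div 3)
          else if c mod 3 = 2 then \<phi> i (r div 3) (c div 3) else 0)
        else if r mod 3 = 1 then (if c mod 3 = 1 then dK i (r div 3) (c div 3)
          else if c mod 3 = 2 then - \<psi> i (r div 3) (c div 3) else 0)
        else if c mod 3 = 2 \<and> j \<noteq> 0 then - dA j (r div 3) (c div 3) else 0)"

lemma g_simps:
  "g i (tJ q) = gJ i q" "g i (tK q) = gK i q" "g (Suc i) (tA q) = gA i q"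
  unfolding g_def t_simps by simp_all

lemma d0_simps:
  "d 0 r (tJ q) = (if r = 0 then dJ 0 0 q else 0)"
  "d 0 r (tK q) = (if r = 0 then dK 0 0 q else 0)"
  "d 0 r (tA q) = 0"
  unfolding d_def t_simps by simp_all

lemma d_simps:
  "d (Suc i) (tJ r) (tJ q) = dJ (Suc i) r q"
  "d (Suc i) (tJ r) (tK q) = 0"
  "d (Suc i) (tJ r) (tA q) = \<phi> (Suc i) r q"
  "d (Suc i) (tK r) (tJ q) = 0"
  "d (Suc i) (tK r) (tK q) = dK (Suc i) r q"
  "d (Suc i) (tK r) (tA q) = - \<psi> (Suc i) r q"
  "d (Suc i) (tA r) (tJ q) = 0"
  "d (Suc i) (tA r) (tK q) = 0"
  "d (Suc i) (tA r) (tA q) = (if i = 0 then 0 else - dA i r q)"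
  unfolding d_def t_simps by simp_all

lemma mem_X_simps:
  "tJ q \<in> X (Suc i) \<longleftrightarrow> q \<in> XJ (Suc i)"
  "tK q \<in> X (Suc i) \<longleftrightarrow> q \<in> XK (Suc i)"
  "tA q \<in> X (Suc i) \<longleftrightarrow> i \<noteq> 0 \<and> q \<in> XA i"
  unfolding X_def by auto

lemma sum_X: "(\<Sum>c\<in>X (Suc i). f c) = (\<Sum>q\<in>XJ (Suc i). f (tJ q)) + (\<Sum>q\<in>XK (Suc i). f (tK q))
    + (if i = 0 then 0 else (\<Sum>q\<in>XA i. f (tA q)))" for f :: "nat \<Rightarrow> 'b::comm_monoid_add"
proof -
  let ?J = "tJ ` XJ (Suc i)" and ?K = "tK ` XK (Suc i)"
    and ?A = "if i = 0 then {} else tA ` XA i"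
  have "X (Suc i) = (?J \<union> ?K) \<union> ?A" unfolding X_def by simp
  moreover have "sum f ((?J \<union> ?K) \<union> ?A) = sum f (?J \<union> ?K) + sum f ?A"
    using J.fin K.fin A.fin by (intro sum.union_disjoint) auto
  moreover have "sum f (?J \<union> ?K) = sum f ?J + sum f ?K"
    using J.fin K.fin by (intro sum.union_disjoint) auto
  moreover have "sum f ?J = (\<Sum>q\<in>XJ (Suc i). f (tJ q))"
    by (subst sum.reindex) (auto simp: inj_on_def)
  moreover have "sum f ?K = (\<Sum>q\<in>XK (Suc i). f (tK q))"
    by (subst sum.reindex) (auto simp: inj_on_def)
  moreover have "sum f ?A = (if i = 0 then 0 else (\<Sum>q\<in>XA i. f (tA q)))"
    by (cases "i = 0", simp, simp only: if_False, subst sum.reindex) (auto simp: inj_on_def)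
  ultimately show ?thesis by simp
qed

lemma finite_X: "finite (X i)"
  unfolding X_def using J.fin K.fin A.fin by (simp split: nat.split)

lemma X_0: "X 0 = {0}"
  unfolding X_def by simp

lemma bd_0: "bd X d 0 w r = (if r = 0 then
    bd XJ dJ 0 (\<lambda>q. w (tJ q)) 0 + bd XK dK 0 (\<lambda>q. w (tK q)) 0 else 0)"
  unfolding bd_def sum_X d0_simps by simp

lemma bd_J: "bd X d (Suc i) w (tJ r) = bd XJ dJ (Suc i) (\<lambda>q. w (tJ q)) r +
    (\<Sum>q\<in>XA (Suc i). \<phi> (Suc i) r q * w (tA q))"
  unfolding bd_def sum_X d_simps by simp

lemma bd_K: "bd X d (Suc i) w (tK r) = bd XK dK (Suc i) (\<lambda>q. w (tK q)) r -
    (\<Sum>q\<in>XA (Suc i). \<psi> (Suc i) r q * w (tA q))"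
  unfolding bd_def sum_X d_simps by (simp add: sum_negf)

lemma bd_A: "bd X d (Suc i) w (tA r) = (if i = 0 then 0 else - bd XA dA i (\<lambda>q. w (tA q)) r)"
  unfolding bd_def sum_X d_simps by (simp add: sum_negf)

lemma d_nz:
  assumes "d i r c \<noteq> 0"
  shows "r \<in> X i \<and> c \<in> X (Suc i) \<and> pres (SJ \<union> SK) g i r (g (Suc i) c)"
proof (cases i)
  case 0
  then have r: "r = 0" using assms unfolding d_def by (auto split: if_splits)
  show ?thesis
  proof (cases c rule: t_cases)
    case (J q)
    then show ?thesis using assms 0 r J.d_nz[of 0 0 q]
      by (simp add: mem_X_simps X_0 g_simps d0_simps pres_def)
  next
    case (K q)
    then show ?thesis using assms 0 r K.d_nz[of 0 0 q]
      by (simp add: mem_X_simps X_0 g_simps d0_simps pres_def)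
  next
    case (A q)
    then show ?thesis using assms 0 by (simp add: d0_simps)
  qed
next
  case (Suc j)
  have "r \<in> X i \<and> c \<in> X (Suc i) \<and> divides (g i r) (g (Suc i) c)"
  proof (cases c rule: t_cases)
    case c: (J q)
    show ?thesis
    proof (cases r rule: t_cases)
      case (J p)
      then show ?thesis using assms c J.d_nz[of i p q] Suc by (simp add: mem_X_simps g_simps d_simps pres_def)
    qed (use assms c Suc in \<open>simp_all add: d_simps\<close>)
  next
    case c: (K q)
    show ?thesis
    proof (cases r rule: t_cases)
      case (K p)
      then show ?thesis using assms c K.d_nz[of i p q] Suc by (simp add: mem_X_simps g_simps d_simps pres_def)
    qed (use assms c Suc in \<open>simp_all add: d_simps\<close>)
  next
    case c: (A q)
    show ?thesis
    proof (cases r rule: t_cases)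
      case (J p)
      then show ?thesis using assms c \<phi>nz[of j p q] Suc by (simp add: mem_X_simps g_simps d_simps pres_def)
    next
      case (K p)
      then show ?thesis using assms c \<psi>nz[of j p q] Suc by (simp add: mem_X_simps g_simps d_simps pres_def)
    next
      case (A p)
      then have *: "j \<noteq> 0" "dA j p q \<noteq> 0" using assms c Suc by (simp_all add: d_simps split: if_splits)
      then obtain l where "j = Suc l" by (cases j) auto
      then show ?thesis using A c A.d_nz[OF *(2)] Suc by (simp add: mem_X_simps g_simps pres_def)
    qed
  qed
  then show ?thesis using Suc by (simp add: pres_def)
qed

lemma minimal:
  assumes "d (Suc i) r c \<noteq> 0"
  shows "g (Suc i) r \<noteq> g (Suc (Suc i)) c"
proof (cases c rule: t_cases)
  case c: (J q)
  show ?thesis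
  proof (cases r rule: t_cases)
    case (J p)
    then show ?thesis using assms c J.minimal[of i p q] by (simp add: g_simps d_simps)
  qed (use assms c in \<open>simp_all add: d_simps\<close>)
next
  case c: (K q)
  show ?thesis
  proof (cases r rule: t_cases)
    case (K p)
    then show ?thesis using assms c K.minimal[of i p q] by (simp add: g_simps d_simps)
  qed (use assms c in \<open>simp_all add: d_simps\<close>)
next
  case c: (A q)
  show ?thesis
  proof (cases r rule: t_cases)
    case (J p)
    then show ?thesis using assms c \<phi>min[of i p q] by (simp add: g_simps d_simps)
  next
    case (K p)
    then show ?thesis using assms c \<psi>min[of i p q] by (simp add: g_simps d_simps)
  next
    case (A p)
    then have "i \<noteq> 0" "dA i p q \<noteq> 0" using assms c by (simp_all add: d_simps split: if_splits)
    then show ?thesis using A c A.minimal[of "i - 1" p q] by (cases i) (simp_all add: g_simps)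
  qed
qed

lemma dd:
  assumes c: "c \<in> X (Suc (Suc i))"
  shows "(\<Sum>s\<in>X (Suc i). d i r s * d (Suc i) s c) = 0"
proof -
  have "bd X d i (\<lambda>s. d (Suc i) s c) r = 0"
  proof (cases i)
    case 0
    show ?thesis
    proof (cases c rule: t_cases)
      case (J q)
      then have "(\<Sum>s\<in>XJ (Suc 0). dJ 0 0 s * dJ (Suc 0) s q) = 0"
        using J.dd supJ[of q 1] c 0 by (simp add: mem_X_simps)
      then show ?thesis unfolding J 0 bd_0 unfolding bd_def by (simp add: d_simps)
    next
      case (K q)
      then have "(\<Sum>s\<in>XK (Suc 0). dK 0 0 s * dK (Suc 0) s q) = 0"
        using K.dd supK[of q 1] c 0 by (simp add: mem_X_simps)
      then show ?thesis unfolding K 0 bd_0 unfolding bd_def by (simp add: d_simps)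
    next
      case (A q)
      then have "q \<in> XA (Suc 0)" using c 0 by (simp add: mem_X_simps)
      from \<phi>c[OF this, of 0] \<psi>c[OF this, of 0]
      have "(\<Sum>s\<in>XJ (Suc 0). dJ 0 0 s * \<phi> (Suc 0) s q) = (\<Sum>s\<in>XK (Suc 0). dK 0 0 s * \<psi> (Suc 0) s q)"
        by (simp add: \<phi>0 \<psi>0)
      then show ?thesis unfolding A 0 bd_0 unfolding bd_def by (simp add: d_simps sum_negf)
    qed
  next
    case (Suc j)
    show ?thesis
    proof (cases c rule: t_cases)
      case J: (J q)
      then have q: "q \<in> XJ (Suc (Suc i))" using c by (simp add: mem_X_simps)
      show ?thesis unfolding J Suc
        by (cases r rule: t_cases; hypsubst; unfold bd_J bd_K bd_A; unfold bd_def d_simps)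
          (use J.dd[OF q] Suc in simp_all)
    next
      case K: (K q)
      then have q: "q \<in> XK (Suc (Suc i))" using c by (simp add: mem_X_simps)
      show ?thesis unfolding K Suc
        by (cases r rule: t_cases; hypsubst; unfold bd_J bd_K bd_A; unfold bd_def d_simps)
          (use K.dd[OF q] Suc in simp_all)
    next
      case A: (A q)
      then have q: "q \<in> XA (Suc i)" using c by (simp add: mem_X_simps)
      show ?thesis
      proof (cases r rule: t_cases)
        case (J p)
        then show ?thesis unfolding A Suc J bd_J unfolding bd_def d_simps
          using \<phi>c[OF q, of p] Suc by (simp add: sum_negf)
      next
        case (K p)
        then show ?thesis unfolding A Suc K bd_K unfolding bd_def d_simps
          using \<psi>c[OF q, of p] Suc by (simp add: sum_negf)
      next
        case r: (A p)
        show ?thesis unfolding A Suc r bd_A unfolding bd_def d_simps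
          using A.dd[of q j p] q Suc by (simp add: sum_negf)
      qed
    qed
  qed
  then show ?thesis by (simp add: bd_def)
qed

lemma bd_Suc_eq_0:
  assumes "chain (SJ \<union> SK) X g (Suc (Suc i)) \<gamma> w" "\<not> divides (g (Suc i) r) \<gamma>"
  shows "bd X d (Suc i) w r = 0"
  unfolding bd_def
proof (rule sum.neutral, safe)
  fix c
  show "d (Suc i) r c * w c = 0"
    using assms d_nz[of "Suc i" r c] by (auto simp: chain_def pres_def dest: divides_trans)
qed

text \<open>For a cycle with parts \<open>vJ\<close>, \<open>vK\<close>, \<open>vA\<close>, a
  preimage \<open>wA\<close> of \<open>- vA\<close> is taken in the complex of the intersection;
  correcting \<open>vJ\<close> and \<open>vK\<close> by its images leaves cycles in the complexes of
  J and K, which bound separately. In the lowest case there is no \<open>vA\<close>, and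
  \<open>wA\<close> lifts the value shared, up to sign, by the two augmentations.\<close>

lemma exact:
  assumes v: "cyc (SJ \<union> SK) X g d i \<gamma> v"
  shows "\<exists>w. chain (SJ \<union> SK) X g (Suc i) \<gamma> w \<and>
    (\<forall>r. pres (SJ \<union> SK) g i r \<gamma> \<longrightarrow> bd X d i w r = v r)"
proof (cases i)
  case 0
  have v': "c = 0 \<and> \<gamma> \<in> SJ \<union> SK" if "v c \<noteq> 0" for c
    using v that 0 unfolding cyc_def chain_def by (simp add: X_0 pres_def)
  consider "\<gamma> \<in> SJ" | "\<gamma> \<in> SK" | "\<gamma> \<notin> SJ \<union> SK" by blast
  then show ?thesis
  proof cases
    case 1
    then have "cyc SJ XJ gJ dJ 0 \<gamma> v"
      using v' by (auto simp: cyc_def chain_def J.X0 pres_def)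
    from J.exact[OF this] obtain w where w: "chain SJ XJ gJ (Suc 0) \<gamma> w"
      "\<And>r. bd XJ dJ 0 w r = v r" using 1 by (auto simp: pres_def)
    let ?w = "\<lambda>c. if c mod 3 = 0 then w (c div 3) else 0"
    have "chain (SJ \<union> SK) X g (Suc 0) \<gamma> ?w"
      unfolding chain_def
    proof (intro allI impI)
      fix c assume "?w c \<noteq> 0"
      then show "c \<in> X (Suc 0) \<and> pres (SJ \<union> SK) g (Suc 0) c \<gamma>"
        using w(1) by (cases c rule: t_cases) (simp_all add: chain_def mem_X_simps pres_def g_simps)
    qed
    moreover have "bd X d 0 ?w r = v r" for r
      using w(2)[of 0] v'[of r] unfolding bd_0 by (auto simp: bd_def)
    ultimately show ?thesis using 0 by blast
  next
    case 2
    then have "cyc SK XK gK dK 0 \<gamma> v"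
      using v' by (auto simp: cyc_def chain_def K.X0 pres_def)
    from K.exact[OF this] obtain w where w: "chain SK XK gK (Suc 0) \<gamma> w"
      "\<And>r. bd XK dK 0 w r = v r" using 2 by (auto simp: pres_def)
    let ?w = "\<lambda>c. if c mod 3 = 1 then w (c div 3) else 0"
    have "chain (SJ \<union> SK) X g (Suc 0) \<gamma> ?w"
      unfolding chain_def
    proof (intro allI impI)
      fix c assume "?w c \<noteq> 0"
      then show "c \<in> X (Suc 0) \<and> pres (SJ \<union> SK) g (Suc 0) c \<gamma>"
        using w(1) by (cases c rule: t_cases) (simp_all add: chain_def mem_X_simps pres_def g_simps)
    qed
    moreover have "bd X d 0 ?w r = v r" for r
      using w(2)[of 0] v'[of r] unfolding bd_0 by (auto simp: bd_def)
    ultimately show ?thesis using 0 by blast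
  next
    case 3
    then have "chain (SJ \<union> SK) X g (Suc 0) \<gamma> (\<lambda>c. 0)" by (simp add: chain_def)
    then show ?thesis using 3 0 by (auto simp: pres_def)
  qed
next
  case i: (Suc j)
  define vJ vK vA where "vJ q = v (tJ q)" and "vK q = v (tK q)" and "vA q = v (tA q)" for q
  have ch: "chain (SJ \<union> SK) X g (Suc j) \<gamma> v"
    and bdv: "\<And>r. pres (SJ \<union> SK) g j r \<gamma> \<Longrightarrow> bd X d j v r = 0"
    using v i unfolding cyc_def by blast+
  have vJ: "q \<in> XJ (Suc j) \<and> divides (gJ (Suc j) q) \<gamma>" if "vJ q \<noteq> 0" for q
    using ch that unfolding chain_def vJ_def by (auto simp: mem_X_simps g_simps pres_def dest: spec[of _ "tJ q"])
  have vK: "q \<in> XK (Suc j) \<and> divides (gK (Suc j) q) \<gamma>" if "vK q \<noteq> 0" for q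
    using ch that unfolding chain_def vK_def by (auto simp: mem_X_simps g_simps pres_def dest: spec[of _ "tK q"])
  have vA: "j \<noteq> 0 \<and> q \<in> XA j \<and> divides (gA j q) \<gamma>" if "vA q \<noteq> 0" for q
    using ch that unfolding chain_def vA_def by (auto simp: mem_X_simps g_simps pres_def dest: spec[of _ "tA q"])
  have bdv': "bd X d (Suc l) v r = 0" if "j = Suc l" for l r
    using bdv[of r] bd_Suc_eq_0[of l \<gamma> v r] ch that by (auto simp: pres_def)
  have bd0: "bd XJ dJ 0 vJ 0 + bd XK dK 0 vK 0 = 0" if "j = 0" "\<gamma> \<in> SJ \<union> SK"
    using bdv[of 0] that unfolding vJ_def vK_def by (simp add: bd_0 pres_def)
  have J0: "bd XJ dJ 0 vJ 0 = 0" if "j = 0" "\<gamma> \<notin> SJ"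
    unfolding bd_def
  proof (rule sum.neutral, safe, rule ccontr)
    fix c assume "dJ 0 0 c * vJ c \<noteq> 0"
    then have "gJ (Suc 0) c \<in> SJ" "divides (gJ (Suc 0) c) \<gamma>" using vJ[of c] supJ[of c 0] that by auto
    then show False using upsetD[OF upJ] that by blast
  qed
  have K0: "bd XK dK 0 vK 0 = 0" if "j = 0" "\<gamma> \<notin> SK"
    unfolding bd_def
  proof (rule sum.neutral, safe, rule ccontr)
    fix c assume "dK 0 0 c * vK c \<noteq> 0"
    then have "gK (Suc 0) c \<in> SK" "divides (gK (Suc 0) c) \<gamma>" using vK[of c] supK[of c 0] that by auto
    then show False using upsetD[OF upK] that by blast
  qed
  \<comment> \<open>For \<open>j = 0\<close> and \<gamma> in the union, this is minus the
    augmentation of \<open>vK\<close>. Outside the intersection it vanishes, by \<open>bd0\<close>,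
    \<open>J0\<close> and \<open>K0\<close>.\<close>
  let ?t = "bd XJ dJ 0 vJ 0"
  have "\<exists>wA. chain (SJ \<inter> SK) XA gA (Suc j) \<gamma> wA \<and> (if j = 0 then bd XA dA 0 wA 0 = (if \<gamma> \<in> SJ \<inter> SK then ?t else 0)
      else (\<forall>r. bd XA dA j wA r = - vA r))"
  proof (cases j)
    case 0
    have "cyc (SJ \<inter> SK) XA gA dA 0 \<gamma> (\<lambda>r. if r = 0 \<and> \<gamma> \<in> SJ \<inter> SK then ?t else 0)"
      by (auto simp: cyc_def chain_def A.X0 pres_def split: if_splits)
    from A.exact[OF this] obtain w where "chain (SJ \<inter> SK) XA gA (Suc 0) \<gamma> w"
      "\<gamma> \<in> SJ \<inter> SK \<Longrightarrow> bd XA dA 0 w 0 = ?t" by (auto simp: pres_def)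
    moreover have "chain (SJ \<inter> SK) XA gA (Suc 0) \<gamma> (\<lambda>c. 0)" "bd XA dA 0 (\<lambda>c. 0) 0 = 0"
      by (simp_all add: chain_def bd_def)
    ultimately show ?thesis using 0 by (cases "\<gamma> \<in> SJ \<inter> SK") auto
  next
    case (Suc l)
    have rowJ: "bd XJ dJ j vJ p + (\<Sum>q\<in>XA j. \<phi> j p q * vA q) = 0" for p
      using bdv'[OF Suc, of "tJ p"] Suc unfolding bd_J vJ_def vA_def by simp
    have "cyc (SJ \<inter> SK) XA gA dA j \<gamma> (\<lambda>q. - vA q)"
      unfolding cyc_def
    proof (intro conjI allI impI)
      show "chain (SJ \<inter> SK) XA gA j \<gamma> (\<lambda>q. - vA q)"
        using vA by (auto simp: chain_def pres_def)
      fix m p assume m: "j = Suc m" and pr: "pres (SJ \<inter> SK) gA m p \<gamma>"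
      have "bd XA dA l vA p = 0"
      proof (cases l)
        case (Suc l')
        then show ?thesis using bdv'[OF \<open>j = Suc l\<close>, of "tA p"] unfolding bd_A vA_def by simp
      next
        case 0
        show ?thesis
        proof (cases "p = 0")
          case True
          \<comment> \<open>The augmentation of the intersection does not occur in the cone. That it
            kills \<open>vA\<close> is read off from the J rows: apply the augmentation of J to them
            and use that \<phi> lifts the identity.\<close>
          have "0 = (\<Sum>r\<in>XJ (Suc 0). dJ 0 0 r * (bd XJ dJ (Suc 0) vJ r + (\<Sum>q\<in>XA (Suc 0). \<phi> (Suc 0) r q * vA q)))"
            using rowJ Suc 0 by simp
          also have "\<dots> = (\<Sum>r\<in>XJ (Suc 0). dJ 0 0 r * bd XJ dJ (Suc 0) vJ r)
              + (\<Sum>r\<in>XJ (Suc 0). dJ 0 0 r * (\<Sum>q\<in>XA (Suc 0). \<phi> (Suc 0) r q * vA q))"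
            by (simp add: distrib_left sum.distrib)
          also have "(\<Sum>r\<in>XJ (Suc 0). dJ 0 0 r * bd XJ dJ (Suc 0) vJ r) =
              (\<Sum>c\<in>XJ (Suc (Suc 0)). (\<Sum>r\<in>XJ (Suc 0). dJ 0 0 r * dJ (Suc 0) r c) * vJ c)"
            unfolding bd_def sum_distrib_left sum_distrib_right by (subst sum.swap) (simp add: mult.assoc)
          also have "\<dots> = 0" using J.dd[of _ 0 0] supJ[of _ 1] by simp
          also have "(\<Sum>r\<in>XJ (Suc 0). dJ 0 0 r * (\<Sum>q\<in>XA (Suc 0). \<phi> (Suc 0) r q * vA q)) =
              (\<Sum>q\<in>XA (Suc 0). (\<Sum>r\<in>XJ (Suc 0). dJ 0 0 r * \<phi> (Suc 0) r q) * vA q)"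
            unfolding sum_distrib_left sum_distrib_right by (subst sum.swap) (simp add: mult.assoc)
          also have "\<dots> = (\<Sum>q\<in>XA (Suc 0). dA 0 0 q * vA q)"
            by (intro sum.cong refl) (simp add: \<phi>c \<phi>0 A.X0)
          finally show ?thesis using True 0 by (simp add: bd_def)
        next
          case False
          then have "dA 0 p q = 0" for q using A.d_nz[of 0 p q] by (auto simp: A.X0)
          then show ?thesis using 0 by (simp add: bd_def)
        qed
      qed
      then show "bd XA dA m (\<lambda>q. - vA q) p = 0" using m Suc by (simp add: bd_def sum_negf)
    qed
    from A.exact[OF this] obtain w where w: "chain (SJ \<inter> SK) XA gA (Suc j) \<gamma> w"
      "\<And>r. pres (SJ \<inter> SK) gA j r \<gamma> \<Longrightarrow> bd XA dA j w r = - vA r" by blast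
    have "bd XA dA j w r = - vA r" for r
      using w A.bd_chain_Suc_eq_0[of l \<gamma> w r] vA[of r] Suc by (cases "divides (gA j r) \<gamma>") (auto simp: pres_def)
    then show ?thesis using w(1) Suc by auto
  qed
  then obtain wA where wA: "chain (SJ \<inter> SK) XA gA (Suc j) \<gamma> wA"
    and wA0: "j = 0 \<Longrightarrow> bd XA dA 0 wA 0 = (if \<gamma> \<in> SJ \<inter> SK then ?t else 0)"
    and wAS: "\<And>r. j \<noteq> 0 \<Longrightarrow> bd XA dA j wA r = - vA r"
    by (metis (full_types))
  have wAnz: "c \<in> XA (Suc j) \<and> divides (gA (Suc j) c) \<gamma>" if "wA c \<noteq> 0" for c
    using wA that unfolding chain_def pres_def by auto
  have "cyc SJ XJ gJ dJ (Suc j) \<gamma> (\<lambda>r. vJ r - (\<Sum>c\<in>XA (Suc j). \<phi> (Suc j) r c * wA c))"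
    unfolding cyc_def
  proof (intro conjI allI impI)
    show "chain SJ XJ gJ (Suc j) \<gamma> (\<lambda>r. vJ r - (\<Sum>c\<in>XA (Suc j). \<phi> (Suc j) r c * wA c))"
      unfolding chain_def
    proof (intro allI impI)
      fix r assume nz: "vJ r - (\<Sum>c\<in>XA (Suc j). \<phi> (Suc j) r c * wA c) \<noteq> 0"
      show "r \<in> XJ (Suc j) \<and> pres SJ gJ (Suc j) r \<gamma>"
      proof (cases "vJ r = 0")
        case True
        then obtain c where "\<phi> (Suc j) r c \<noteq> 0" "wA c \<noteq> 0"
          using nz by (auto elim!: sum.not_neutral_contains_not_neutral)
        then show ?thesis using \<phi>nz[of j r c] wAnz[of c] divides_trans by (auto simp: pres_def)
      qed (use vJ in \<open>simp add: pres_def\<close>)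
    qed
    fix m r assume m: "Suc j = Suc m" and pr: "pres SJ gJ m r \<gamma>"
    have "bd XJ dJ j (\<lambda>r. vJ r - (\<Sum>c\<in>XA (Suc j). \<phi> (Suc j) r c * wA c)) r =
        bd XJ dJ j vJ r - (\<Sum>s\<in>XJ (Suc j). dJ j r s * (\<Sum>c\<in>XA (Suc j). \<phi> (Suc j) s c * wA c))"
      unfolding bd_def by (simp add: right_diff_distrib sum_subtractf)
    also have "(\<Sum>s\<in>XJ (Suc j). dJ j r s * (\<Sum>c\<in>XA (Suc j). \<phi> (Suc j) s c * wA c)) =
        (\<Sum>c\<in>XA (Suc j). (\<Sum>s\<in>XJ (Suc j). dJ j r s * \<phi> (Suc j) s c) * wA c)"
      unfolding sum_distrib_left sum_distrib_right by (subst sum.swap) (simp add: mult.assoc)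
    also have "\<dots> = (\<Sum>c\<in>XA (Suc j). (\<Sum>s\<in>XA j. \<phi> j r s * dA j s c) * wA c)"
      by (simp add: \<phi>c)
    also have "\<dots> = (\<Sum>s\<in>XA j. \<phi> j r s * bd XA dA j wA s)"
      unfolding bd_def sum_distrib_left sum_distrib_right by (subst sum.swap) (simp add: mult.assoc)
    finally have eq: "bd XJ dJ j (\<lambda>r. vJ r - (\<Sum>c\<in>XA (Suc j). \<phi> (Suc j) r c * wA c)) r =
        bd XJ dJ j vJ r - (\<Sum>s\<in>XA j. \<phi> j r s * bd XA dA j wA s)" .
    have "\<dots> = 0"
    proof (cases j)
      case 0
      show ?thesis
      proof (cases "r = 0")
        case True
        have "bd XJ dJ 0 vJ 0 = bd XA dA 0 wA 0"
          using wA0 0 bd0 K0 pr m by (auto simp: pres_def)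
        then show ?thesis using True 0 by (simp add: \<phi>0 A.X0)
      next
        case False
        then have "dJ 0 r q = 0" for q using J.d_nz[of 0 r q] by (auto simp: J.X0)
        then show ?thesis using False 0 by (simp add: bd_def \<phi>0)
      qed
    next
      case (Suc l)
      show ?thesis using bdv'[OF Suc, of "tJ r"] Suc wAS
        unfolding bd_J vJ_def vA_def by (simp add: sum_negf)
    qed
    then show "bd XJ dJ m (\<lambda>r. vJ r - (\<Sum>c\<in>XA (Suc j). \<phi> (Suc j) r c * wA c)) r = 0" using m eq by simp
  qed
  from J.exact[OF this] obtain wJ where wJ: "chain SJ XJ gJ (Suc (Suc j)) \<gamma> wJ"
    "\<And>r. divides (gJ (Suc j) r) \<gamma> \<Longrightarrow>
      bd XJ dJ (Suc j) wJ r = vJ r - (\<Sum>c\<in>XA (Suc j). \<phi> (Suc j) r c * wA c)"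
    by (auto simp: pres_def)
  have "cyc SK XK gK dK (Suc j) \<gamma> (\<lambda>r. vK r + (\<Sum>c\<in>XA (Suc j). \<psi> (Suc j) r c * wA c))"
    unfolding cyc_def
  proof (intro conjI allI impI)
    show "chain SK XK gK (Suc j) \<gamma> (\<lambda>r. vK r + (\<Sum>c\<in>XA (Suc j). \<psi> (Suc j) r c * wA c))"
      unfolding chain_def
    proof (intro allI impI)
      fix r assume nz: "vK r + (\<Sum>c\<in>XA (Suc j). \<psi> (Suc j) r c * wA c) \<noteq> 0"
      show "r \<in> XK (Suc j) \<and> pres SK gK (Suc j) r \<gamma>"
      proof (cases "vK r = 0")
        case True
        then obtain c where "\<psi> (Suc j) r c \<noteq> 0" "wA c \<noteq> 0"
          using nz by (auto elim!: sum.not_neutral_contains_not_neutral)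
        then show ?thesis using \<psi>nz[of j r c] wAnz[of c] divides_trans by (auto simp: pres_def)
      qed (use vK in \<open>simp add: pres_def\<close>)
    qed
    fix m r assume m: "Suc j = Suc m" and pr: "pres SK gK m r \<gamma>"
    have "bd XK dK j (\<lambda>r. vK r + (\<Sum>c\<in>XA (Suc j). \<psi> (Suc j) r c * wA c)) r =
        bd XK dK j vK r + (\<Sum>s\<in>XK (Suc j). dK j r s * (\<Sum>c\<in>XA (Suc j). \<psi> (Suc j) s c * wA c))"
      unfolding bd_def by (simp add: distrib_left sum.distrib)
    also have "(\<Sum>s\<in>XK (Suc j). dK j r s * (\<Sum>c\<in>XA (Suc j). \<psi> (Suc j) s c * wA c)) =
        (\<Sum>c\<in>XA (Suc j). (\<Sum>s\<in>XK (Suc j). dK j r s * \<psi> (Suc j) s c) * wA c)"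
      unfolding sum_distrib_left sum_distrib_right by (subst sum.swap) (simp add: mult.assoc)
    also have "\<dots> = (\<Sum>c\<in>XA (Suc j). (\<Sum>s\<in>XA j. \<psi> j r s * dA j s c) * wA c)"
      by (simp add: \<psi>c)
    also have "\<dots> = (\<Sum>s\<in>XA j. \<psi> j r s * bd XA dA j wA s)"
      unfolding bd_def sum_distrib_left sum_distrib_right by (subst sum.swap) (simp add: mult.assoc)
    finally have eq: "bd XK dK j (\<lambda>r. vK r + (\<Sum>c\<in>XA (Suc j). \<psi> (Suc j) r c * wA c)) r =
        bd XK dK j vK r + (\<Sum>s\<in>XA j. \<psi> j r s * bd XA dA j wA s)" .
    have "\<dots> = 0"
    proof (cases j)
      case 0
      show ?thesis
      proof (cases "r = 0")
        case True
        have "bd XK dK 0 vK 0 + bd XA dA 0 wA 0 = 0"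
          using wA0 0 bd0 J0 pr m by (auto simp: pres_def add.commute)
        then show ?thesis using True 0 by (simp add: \<psi>0 A.X0)
      next
        case False
        then have "dK 0 r q = 0" for q using K.d_nz[of 0 r q] by (auto simp: K.X0)
        then show ?thesis using False 0 by (simp add: bd_def \<psi>0)
      qed
    next
      case (Suc l)
      show ?thesis using bdv'[OF Suc, of "tK r"] Suc wAS
        unfolding bd_K vK_def vA_def by (simp add: sum_negf)
    qed
    then show "bd XK dK m (\<lambda>r. vK r + (\<Sum>c\<in>XA (Suc j). \<psi> (Suc j) r c * wA c)) r = 0" using m eq by simp
  qed
  from K.exact[OF this] obtain wK where wK: "chain SK XK gK (Suc (Suc j)) \<gamma> wK"
    "\<And>r. divides (gK (Suc j) r) \<gamma> \<Longrightarrow>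
      bd XK dK (Suc j) wK r = vK r + (\<Sum>c\<in>XA (Suc j). \<psi> (Suc j) r c * wA c)"
    by (auto simp: pres_def)
  define w where "w c = (if c mod 3 = 0 then wJ (c div 3) else if c mod 3 = 1 then wK (c div 3)
    else wA (c div 3))" for c
  have w_simps: "w (tJ q) = wJ q" "w (tK q) = wK q" "w (tA q) = wA q" for q
    unfolding w_def by simp_all
  have "chain (SJ \<union> SK) X g (Suc i) \<gamma> w"
    unfolding chain_def
  proof (intro allI impI)
    fix c assume "w c \<noteq> 0"
    then show "c \<in> X (Suc i) \<and> pres (SJ \<union> SK) g (Suc i) c \<gamma>"
      using wJ(1) wK(1) wA i
      by (cases c rule: t_cases) (simp_all add: chain_def mem_X_simps pres_def g_simps w_simps)
  qed
  moreover have "bd X d i w r = v r" if pr: "pres (SJ \<union> SK) g i r \<gamma>" for r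
  proof (cases r rule: t_cases)
    case (J p)
    then show ?thesis using wJ(2)[of p] pr i unfolding vJ_def
      by (simp add: bd_J w_simps pres_def g_simps)
  next
    case (K p)
    then show ?thesis using wK(2)[of p] pr i unfolding vK_def
      by (simp add: bd_K w_simps pres_def g_simps)
  next
    case (A p)
    have "vA p = 0" if "j = 0" using vA[of p] that by blast
    then show ?thesis using A wAS[of p] i unfolding vA_def by (simp add: bd_A w_simps)
  qed
  ultimately show ?thesis by blast
qed

lemma gcx_cone: "gcx (SJ \<union> SK) X g d"
proof
  show "finite (X i)" for i by (rule finite_X)
  show "X 0 = {0}" by (rule X_0)
  show "\<gamma> \<in> SJ \<union> SK" if "\<alpha> \<in> SJ \<union> SK" "divides \<alpha> \<gamma>" for \<alpha> \<gamma>
    using that upsetD[OF upJ] upsetD[OF upK] by blast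
qed (use d_nz dd exact minimal in blast)+

text \<open>Since the cone is minimal, this count is the formula of a Betti splitting.\<close>

lemma card_cone: "card {c \<in> X (Suc i). g (Suc i) c = \<alpha>} =
  card {c \<in> XJ (Suc i). gJ (Suc i) c = \<alpha>} + card {c \<in> XK (Suc i). gK (Suc i) c = \<alpha>} +
  (if i = 0 then 0 else card {c \<in> XA i. gA i c = \<alpha>})"
proof -
  have "card {c \<in> Y. P c} = (\<Sum>c\<in>Y. if P c then 1 else 0)" if "finite Y" for Y :: "nat set" and P
    using that by (simp add: sum.If_cases Int_def)
  then show ?thesis
    using J.fin K.fin A.fin finite_X by (simp add: sum_X g_simps)
qed

lemma sup_cone: "c \<in> X (Suc i) \<Longrightarrow> g (Suc i) c \<in> SJ \<union> SK"
  by (cases c rule: t_cases; cases i) (use supJ supK supA in \<open>auto simp: mem_X_simps g_simps\<close>)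

end

section \<open>Homogeneous matrices over the polynomial ring and scalar complexes\<close>

definition Mon :: "'v expo set \<Rightarrow> ('v, 'k::field) mpoly set" where
  "Mon S = {f. Poly_Mapping.keys f \<subseteq> S}"

lemma Mon_iff: "f \<in> Mon S \<longleftrightarrow> (\<forall>t. Poly_Mapping.lookup f t \<noteq> 0 \<longrightarrow> t \<in> S)"
  unfolding Mon_def by (auto simp: in_keys_iff)

text \<open>Matrices are indexed by initial segments of the natural numbers, whereas cones produce
  scattered index sets. Entries are set to 0 outside the new sets, as \<open>d_nz\<close>
  requires.\<close>

lemma gcx_reindex:
  assumes "gcx P X g d"
    and b: "\<And>i. bij_betw (b i) (Y i) (X i)" and Y0: "Y 0 = {0}" and b0: "b 0 0 = (0::nat)"
  shows "gcx P Y (\<lambda>i c. g i (b i c)) (\<lambda>i r c. if r \<in> Y i \<and> c \<in> Y (Suc i) then d i (b i r) (b (Suc i) c) else 0)"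
    (is "gcx P Y ?g ?d")
proof -
  interpret gcx P X g d by fact
  have bX: "b i c \<in> X i" if "c \<in> Y i" for i c using b[of i] that by (auto simp: bij_betw_def)
  have presb: "pres P ?g i r \<gamma> \<longleftrightarrow> pres P g i (b i r) \<gamma>" for i r \<gamma> by (simp add: pres_def)
  have sumb: "(\<Sum>c\<in>X i. f c) = (\<Sum>c\<in>Y i. f (b i c))" for i and f :: "nat \<Rightarrow> 'b"
    using sum.reindex_bij_betw[OF b[of i], of f] by simp
  define binv where "binv i = the_inv_into (Y i) (b i)" for i
  have binv: "binv i c \<in> Y i" "b i (binv i c) = c" if "c \<in> X i" for i c
    using b[of i] that unfolding binv_def bij_betw_def
    by (auto intro: the_inv_into_into f_the_inv_into_f)
  have binv_b: "binv i (b i c) = c" if "c \<in> Y i" for i c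
    using b[of i] that unfolding binv_def bij_betw_def by (auto intro: the_inv_into_f_f)
  define ext where "ext i v c = (if c \<in> X i then v (binv i c) else (0::'b))" for i v c
  have bd_ext: "bd X d i (ext (Suc i) v) (b i r) = bd Y ?d i v r" if "r \<in> Y i" for i v r
    unfolding bd_def sumb by (intro sum.cong refl) (auto simp: that ext_def bX binv_b)
  show ?thesis
  proof
    show "finite (Y i)" for i using b[of i] fin bij_betw_finite by blast
    show "Y 0 = {0}" by fact
    show "\<And>\<alpha> \<beta> \<gamma>. \<alpha> \<in> P \<Longrightarrow> \<beta> \<in> P \<Longrightarrow> divides \<alpha> \<gamma> \<Longrightarrow> divides \<gamma> \<beta> \<Longrightarrow> \<gamma> \<in> P"
      by (rule convex)
    show "r \<in> Y i \<and> c \<in> Y (Suc i) \<and> pres P ?g i r (?g (Suc i) c)" if "?d i r c \<noteq> 0" for i r c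
      using that d_nz[of i "b i r" "b (Suc i) c"] unfolding presb by (auto split: if_splits)
    show "(\<Sum>s\<in>Y (Suc i). ?d i r s * ?d (Suc i) s c) = 0"
      if "c \<in> Y (Suc (Suc i))" "i = 0 \<Longrightarrow> ?g (Suc (Suc i)) c \<in> P" for c i r
    proof (cases "r \<in> Y i")
      case True
      have "(\<Sum>s\<in>Y (Suc i). ?d i r s * ?d (Suc i) s c) =
          (\<Sum>s\<in>X (Suc i). d i (b i r) s * d (Suc i) s (b (Suc (Suc i)) c))"
        unfolding sumb using that True by (intro sum.cong) auto
      then show ?thesis using dd[OF bX[OF that(1)], of "b i r"] that(2) by simp
    qed simp
    show "?g (Suc i) r \<noteq> ?g (Suc (Suc i)) c" if "?d (Suc i) r c \<noteq> 0" for i r c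
      using that minimal by (auto split: if_splits)
    fix i \<gamma> v assume v: "cyc P Y ?g ?d i \<gamma> v"
    have ch: "chain P Y ?g i \<gamma> v" using v unfolding cyc_def by blast
    have "cyc P X g d i \<gamma> (ext i v)"
      unfolding cyc_def
    proof (intro conjI allI impI)
      show "chain P X g i \<gamma> (ext i v)"
        unfolding chain_def
      proof (intro allI impI)
        fix c assume "ext i v c \<noteq> 0"
        then have "c \<in> X i" "v (binv i c) \<noteq> 0" by (auto simp: ext_def split: if_splits)
        then show "c \<in> X i \<and> pres P g i c \<gamma>"
          using ch binv(2) unfolding chain_def presb by metis
      qed
      fix j r assume j: "i = Suc j" and r: "pres P g j r \<gamma>"
      show "bd X d j (ext i v) r = 0"
      proof (cases "r \<in> X j")
        case True
        have "pres P ?g j (binv j r) \<gamma>" using r binv(2)[OF True] unfolding presb by simp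
        then have "bd Y ?d j v (binv j r) = 0" using v j unfolding cyc_def by blast
        then show ?thesis using bd_ext[OF binv(1)[OF True], of v] binv(2)[OF True] j by simp
      next
        case False
        then have "d j r c = 0" for c using d_nz by blast
        then show ?thesis by (simp add: bd_def)
      qed
    qed
    from exact[OF this] obtain w where w: "chain P X g (Suc i) \<gamma> w"
      "\<And>r. pres P g i r \<gamma> \<Longrightarrow> bd X d i w r = ext i v r" by blast
    define w' where "w' c = (if c \<in> Y (Suc i) then w (b (Suc i) c) else 0)" for c
    have "chain P Y ?g (Suc i) \<gamma> w'"
      using w(1) unfolding chain_def presb w'_def by auto
    moreover have "bd Y ?d i w' r = v r" if pr: "pres P ?g i r \<gamma>" for r
    proof (cases "r \<in> Y i")
      case True
      have "bd Y ?d i w' r = bd X d i w (b i r)"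
        unfolding bd_def sumb w'_def using True by (intro sum.cong) auto
      also have "\<dots> = v r" using w(2)[of "b i r"] pr True bX binv_b unfolding presb by (simp add: ext_def)
      finally show ?thesis .
    next
      case False
      then have "v r = 0" using ch unfolding chain_def by blast
      then show ?thesis using False by (simp add: bd_def)
    qed
    ultimately show "\<exists>w. chain P Y ?g (Suc i) \<gamma> w \<and> (\<forall>r. pres P ?g i r \<gamma> \<longrightarrow> bd Y ?d i w r = v r)"
      by blast
  qed
qed

text \<open>The part of multidegree \<gamma> of a vector in the free module with generators of
  degrees \<open>g j\<close>: in coordinate \<open>j\<close> it is a scalar multiple of the monomial
  \<open>\<gamma> - g j\<close>.\<close>

definition cmp :: "(nat \<Rightarrow> 'v expo) \<Rightarrow> 'v expo \<Rightarrow> ('v, 'k::field) mpoly vec \<Rightarrow> nat \<Rightarrow> 'k" where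
  "cmp g \<gamma> v j = (if j < dim_vec v \<and> divides (g j) \<gamma> then Poly_Mapping.lookup (v $ j) (\<gamma> - g j) else 0)"

lemma cmp_nz: "cmp g \<gamma> v j \<noteq> 0 \<Longrightarrow> j < dim_vec v \<and> divides (g j) \<gamma>"
  unfolding cmp_def by (auto split: if_splits)

lemma cmp_zero [simp]: "cmp g \<gamma> (0\<^sub>v n) j = 0"
  by (simp add: cmp_def)

lemma vec_eqI_cmp:
  assumes "dim_vec v = dim_vec w" and "\<And>\<gamma> j. cmp g \<gamma> v j = cmp g \<gamma> w j"
  shows "v = w"
proof (rule eq_vecI)
  fix j assume j: "j < dim_vec w"
  show "v $ j = w $ j"
  proof (rule poly_mapping_eqI)
    fix t
    show "Poly_Mapping.lookup (v $ j) t = Poly_Mapping.lookup (w $ j) t"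
      using assms(2)[of "g j + t" j] j assms(1) by (simp add: cmp_def)
  qed
qed (fact assms(1))

text \<open>Converse to taking components; finiteness of the set of multidegrees makes each
  coordinate a polynomial.\<close>

lemma vec_of_components:
  fixes u :: "'v expo \<Rightarrow> nat \<Rightarrow> 'k::field"
  assumes "finite \<Gamma>" and u: "\<And>\<gamma> c. u \<gamma> c \<noteq> 0 \<Longrightarrow> c < n \<and> divides (g c) \<gamma>"
  shows "\<exists>y\<in>carrier_vec n. \<forall>\<gamma> c. cmp g \<gamma> y c = (if \<gamma> \<in> \<Gamma> then u \<gamma> c else 0)"
proof
  let ?y = "vec n (\<lambda>c. \<Sum>\<gamma>\<in>{\<gamma>\<in>\<Gamma>. divides (g c) \<gamma>}. Poly_Mapping.single (\<gamma> - g c) (u \<gamma> c))"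
  show "?y \<in> carrier_vec n" by simp
  have "cmp g \<gamma> ?y c = (if \<gamma> \<in> \<Gamma> then u \<gamma> c else 0)" for \<gamma> c
  proof (cases "c < n \<and> divides (g c) \<gamma>")
    case True
    have "cmp g \<gamma> ?y c = (\<Sum>\<beta>\<in>{\<beta>\<in>\<Gamma>. divides (g c) \<beta>}. if \<beta> = \<gamma> then u \<beta> c else 0)"
      using True unfolding cmp_def
      by (auto simp: lookup_sum lookup_single when_def intro!: sum.cong dest: minus_eqI_divides)
    also have "\<dots> = (if \<gamma> \<in> \<Gamma> then u \<gamma> c else 0)"
      using True \<open>finite \<Gamma>\<close> by (simp add: sum.delta)
    finally show ?thesis .
  next
    case False
    then show ?thesis using u[of \<gamma> c] unfolding cmp_def by auto
  qed
  then show "\<forall>\<gamma> c. cmp g \<gamma> ?y c = (if \<gamma> \<in> \<Gamma> then u \<gamma> c else 0)" by blast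
qed

lemma finite_components: "finite {\<gamma>. \<exists>j. cmp g \<gamma> v j \<noteq> 0}"
proof (rule finite_subset)
  show "{\<gamma>. \<exists>j. cmp g \<gamma> v j \<noteq> 0} \<subseteq> (\<Union>j<dim_vec v. (\<lambda>t. g j + t) ` Poly_Mapping.keys (v $ j))"
  proof
    fix \<gamma> assume "\<gamma> \<in> {\<gamma>. \<exists>j. cmp g \<gamma> v j \<noteq> 0}"
    then obtain j where j: "cmp g \<gamma> v j \<noteq> 0" by blast
    then have "j < dim_vec v" "divides (g j) \<gamma>" "\<gamma> - g j \<in> Poly_Mapping.keys (v $ j)"
      by (auto simp: cmp_def in_keys_iff split: if_splits)
    then show "\<gamma> \<in> (\<Union>j<dim_vec v. (\<lambda>t. g j + t) ` Poly_Mapping.keys (v $ j))"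
      using add_minus_divides by (metis (no_types, lifting) UN_I imageI lessThan_iff)
  qed
qed simp

text \<open>Homogeneity determines every entry up to a scalar; \<open>a\<close> and \<open>d\<close>
  collect these scalars.\<close>

locale matrix_form =
  fixes rk :: "nat \<Rightarrow> nat" and dg :: "nat \<Rightarrow> nat \<Rightarrow> 'v expo"
    and e :: "('v, 'k::field) mpoly vec" and D :: "nat \<Rightarrow> ('v, 'k) mpoly mat"
    and a :: "nat \<Rightarrow> 'k" and d :: "nat \<Rightarrow> nat \<Rightarrow> nat \<Rightarrow> 'k"
  assumes e: "e \<in> carrier_vec (rk 0)" and D: "D i \<in> carrier_mat (rk i) (rk (Suc i))"
    and ea: "j < rk 0 \<Longrightarrow> e $ j = Poly_Mapping.single (dg 0 j) (a j)"
    and Dd: "r < rk i \<Longrightarrow> c < rk (Suc i) \<Longrightarrow>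
      D i $$ (r, c) = Poly_Mapping.single (dg (Suc i) c - dg i r) (d i r c)"
    and d_div: "r < rk i \<Longrightarrow> c < rk (Suc i) \<Longrightarrow> d i r c \<noteq> 0 \<Longrightarrow> divides (dg i r) (dg (Suc i) c)"
begin

lemma lookup_e: 
  assumes "v \<in> carrier_vec (rk 0)"
  shows "Poly_Mapping.lookup (e \<bullet> v) \<gamma> = (\<Sum>c<rk 0. a c * cmp (dg 0) \<gamma> v c)"
  using assms e unfolding scalar_prod_def lookup_sum atLeast0LessThan
  by (intro sum.cong) (auto simp: ea lookup_single_mult cmp_def)

text \<open>The monomial of an entry turns \<open>\<gamma> - dg (Suc i) c\<close> into
  \<open>\<gamma> - dg i r\<close>, so in a fixed multidegree only the scalar is left.\<close>

lemma cmp_D: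
  assumes v: "v \<in> carrier_vec (rk (Suc i))" and r: "r < rk i"
  shows "cmp (dg i) \<gamma> (D i *\<^sub>v v) r = (\<Sum>c<rk (Suc i). d i r c * cmp (dg (Suc i)) \<gamma> v c)"
proof (cases "divides (dg i r) \<gamma>")
  case True
  have "cmp (dg i) \<gamma> (D i *\<^sub>v v) r = (\<Sum>c<rk (Suc i). Poly_Mapping.lookup (D i $$ (r, c) * v $ c) (\<gamma> - dg i r))"
    using v r True D[of i] by (simp add: cmp_def scalar_prod_def lookup_sum atLeast0LessThan)
  also have "\<dots> = (\<Sum>c<rk (Suc i). d i r c * cmp (dg (Suc i)) \<gamma> v c)"
  proof (rule sum.cong[OF refl])
    fix c assume "c \<in> {..<rk (Suc i)}"
    then have c: "c < rk (Suc i)" by simp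
    show "Poly_Mapping.lookup (D i $$ (r, c) * v $ c) (\<gamma> - dg i r) = d i r c * cmp (dg (Suc i)) \<gamma> v c"
    proof (cases "d i r c = 0")
      case True
      then show ?thesis using r c by (simp add: Dd)
    next
      case False
      have le: "divides (dg i r) (dg (Suc i) c)" using d_div[OF r c False] .
      have "divides (dg (Suc i) c - dg i r) (\<gamma> - dg i r) \<longleftrightarrow> divides (dg (Suc i) c) \<gamma>"
        using le True unfolding divides_iff lookup_minus by (metis diff_le_mono le_diff_iff)
      moreover have "\<gamma> - dg i r - (dg (Suc i) c - dg i r) = \<gamma> - dg (Suc i) c"
        using le True unfolding divides_iff by (intro poly_mapping_eqI) (simp add: lookup_minus)
      ultimately show ?thesis
        using r c v by (simp add: Dd lookup_single_mult cmp_def)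
    qed
  qed
  finally show ?thesis .
next
  case False
  have "(\<Sum>c<rk (Suc i). d i r c * cmp (dg (Suc i)) \<gamma> v c) = 0"
  proof (intro sum.neutral ballI, rule ccontr)
    fix c assume "c \<in> {..<rk (Suc i)}" "d i r c * cmp (dg (Suc i)) \<gamma> v c \<noteq> 0"
    then have "divides (dg i r) (dg (Suc i) c)" "divides (dg (Suc i) c) \<gamma>"
      using d_div[OF r] cmp_nz[of "dg (Suc i)" \<gamma> v c] by auto
    then show False using False divides_trans by blast
  qed
  then show ?thesis using False by (simp add: cmp_def)
qed

lemma D_eqI:
  assumes "v \<in> carrier_vec (rk (Suc i))" "w \<in> carrier_vec (rk i)"
    and "\<And>\<gamma> r. r < rk i \<Longrightarrow> (\<Sum>c<rk (Suc i). d i r c * cmp (dg (Suc i)) \<gamma> v c) = cmp (dg i) \<gamma> w r"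
  shows "D i *\<^sub>v v = w"
proof (rule vec_eqI_cmp[where g = "dg i"])
  show "dim_vec (D i *\<^sub>v v) = dim_vec w" using assms D[of i] by simp
  fix \<gamma> r
  show "cmp (dg i) \<gamma> (D i *\<^sub>v v) r = cmp (dg i) \<gamma> w r"
    using assms cmp_D[OF assms(1), of r \<gamma>] D[of i] by (cases "r < rk i") (auto simp: cmp_def)
qed

end

lemma smult_in_Mon: "f \<in> Mon S \<Longrightarrow> upset S \<Longrightarrow> f * h \<in> Mon S"
proof -
  assume f: "f \<in> Mon S" and S: "upset S"
  have "Poly_Mapping.keys (f * h) \<subseteq> S"
  proof
    fix t assume "t \<in> Poly_Mapping.keys (f * h)"
    then obtain s u where "s \<in> Poly_Mapping.keys f" "t = s + u" using keys_mult[of f h] by auto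
    then show "t \<in> S" using f upsetD[OF S, of s t] by (auto simp: Mon_def)
  qed
  then show ?thesis by (simp add: Mon_def)
qed

text \<open>Components of a fixed multidegree turn a resolution by matrices into exact sequences of
  vector spaces. Equal labels at a nonzero entry would make it a nonzero constant, hence a
  unit.\<close>

lemma gcx_of_resolution:
  fixes e :: "('v, 'k::field) mpoly vec"
  assumes res: "minimal_free_resolution (Mon SA) (Mon SB) rk dg e D"
    and upA: "upset SA" and upB: "upset SB"
  shows "\<exists>g' d'. gcx (SA - SB) (\<lambda>i. case i of 0 \<Rightarrow> {0} | Suc j \<Rightarrow> {..<rk j}) g' (d' :: nat \<Rightarrow> nat \<Rightarrow> nat \<Rightarrow> 'k) \<and>
    (\<forall>i c. g' (Suc i) c = dg i c)"
proof -
  define a where "a c = Poly_Mapping.lookup (e $ c) (dg 0 c)" for c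
  define d where "d i r c = (if divides (dg i r) (dg (Suc i) c)
    then Poly_Mapping.lookup (D i $$ (r, c)) (dg (Suc i) c - dg i r) else 0)" for i r c
  have res': "free_resolution (Mon SA) (Mon SB) rk dg e D"
    and unit: "\<And>i r c. r < rk i \<Longrightarrow> c < rk (Suc i) \<Longrightarrow> \<not> D i $$ (r, c) dvd 1"
    using res unfolding minimal_free_resolution_def by blast+
  have R1: "e \<in> carrier_vec (rk 0)"
    and R2: "\<forall>i. D i \<in> carrier_mat (rk i) (rk (Suc i))"
    and R3: "\<forall>j<rk 0. \<forall>t\<in>Poly_Mapping.keys (e $ j). t = dg 0 j"
    and R4: "\<forall>i. \<forall>r<rk i. \<forall>c<rk (Suc i). \<forall>t\<in>Poly_Mapping.keys (D i $$ (r, c)). dg i r + t = dg (Suc i) c"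
    and R5: "{e \<bullet> v + b | v b. v \<in> carrier_vec (rk 0) \<and> b \<in> Mon SB} = Mon SA"
    and R6: "{v \<in> carrier_vec (rk 0). e \<bullet> v \<in> Mon SB} = (*\<^sub>v) (D 0) ` carrier_vec (rk 1)"
    and R7: "\<forall>i. {v \<in> carrier_vec (rk (Suc i)). D i *\<^sub>v v = 0\<^sub>v (rk i)} =
      (*\<^sub>v) (D (Suc i)) ` carrier_vec (rk (Suc (Suc i)))"
    using res' unfolding free_resolution_def by - (elim conjE, assumption)+
  have keys_D: "dg i r + t = dg (Suc i) c" if "r < rk i" "c < rk (Suc i)"
    "t \<in> Poly_Mapping.keys (D i $$ (r, c))" for i r c t
    using R4 that by blast
  have keys_e: "t = dg 0 c" if "c < rk 0" "t \<in> Poly_Mapping.keys (e $ c)" for c t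
    using R3 that by blast
  have e: "e \<in> carrier_vec (rk 0)" and D: "D i \<in> carrier_mat (rk i) (rk (Suc i))" for i
    using R1 R2 by blast+
  interpret matrix_form rk dg e D a d
  proof
    show "e \<in> carrier_vec (rk 0)" "D i \<in> carrier_mat (rk i) (rk (Suc i))" for i by (fact e D)+
    show "e $ j = Poly_Mapping.single (dg 0 j) (a j)" if "j < rk 0" for j
      using keys_e[OF that] unfolding a_def
      by (intro poly_mapping_eqI) (auto simp: lookup_single when_def in_keys_iff)
    show "D i $$ (r, c) = Poly_Mapping.single (dg (Suc i) c - dg i r) (d i r c)"
      if "r < rk i" "c < rk (Suc i)" for i r c
    proof (rule poly_mapping_eqI)
      fix t
      have "t = dg (Suc i) c - dg i r" "divides (dg i r) (dg (Suc i) c)"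
        if "Poly_Mapping.lookup (D i $$ (r, c)) t \<noteq> 0"
        using keys_D[OF \<open>r < rk i\<close> \<open>c < rk (Suc i)\<close>, of t] that divides_add(1)[of "dg i r" t]
        by (auto simp: in_keys_iff) (metis add_diff_cancel_left')
      then show "Poly_Mapping.lookup (D i $$ (r, c)) t =
          Poly_Mapping.lookup (Poly_Mapping.single (dg (Suc i) c - dg i r) (d i r c)) t"
        unfolding d_def by (auto simp: lookup_single when_def)
    qed
    show "divides (dg i r) (dg (Suc i) c)" if "d i r c \<noteq> 0" for i r c
      using that unfolding d_def by (auto split: if_splits)
  qed
  have imA: "e \<bullet> v + b \<in> Mon SA" if "v \<in> carrier_vec (rk 0)" "b \<in> Mon SB" for v b
    unfolding R5[symmetric] using that by blast
  have surA: "\<exists>v b. v \<in> carrier_vec (rk 0) \<and> b \<in> Mon SB \<and> f = e \<bullet> v + b" if "f \<in> Mon SA" for f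
    using that unfolding R5[symmetric] by blast
  have ker0: "v \<in> carrier_vec (rk 0) \<and> e \<bullet> v \<in> Mon SB \<longleftrightarrow> v \<in> (*\<^sub>v) (D 0) ` carrier_vec (rk (Suc 0))" for v
    using eqset_imp_iff[OF R6, of v] by simp
  have kerS: "v \<in> carrier_vec (rk (Suc i)) \<and> D i *\<^sub>v v = 0\<^sub>v (rk i) \<longleftrightarrow>
      v \<in> (*\<^sub>v) (D (Suc i)) ` carrier_vec (rk (Suc (Suc i)))" for i v
    using eqset_imp_iff[OF R7[rule_format, of i], of v] by simp
  have zeroB: "(0 :: ('v, 'k) mpoly) \<in> Mon SB" by (simp add: Mon_def)
  have coeffA: "\<gamma> \<in> SA" if "(\<Sum>c<rk 0. a c * cmp (dg 0) \<gamma> v c) \<noteq> 0" "v \<in> carrier_vec (rk 0)" for \<gamma> v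
    using imA[OF that(2) zeroB] that by (auto simp: Mon_iff lookup_e)
  have cmp_unit: "cmp g \<gamma> (unit_vec n c) j = (if j = c \<and> g c = \<gamma> then 1 else 0)"
    if "\<gamma> = g c" "c < n" for g :: "nat \<Rightarrow> 'v expo" and \<gamma> n c j
    using that by (auto simp: cmp_def unit_vec_def lookup_one)
  define P where "P = SA - SB"
  define X where "X i = (case i of 0 \<Rightarrow> {0} | Suc j \<Rightarrow> {..<rk j})" for i
  define g' where "g' i c = (case i of 0 \<Rightarrow> 0 | Suc j \<Rightarrow> dg j c)" for i c
  \<comment> \<open>The augmentation entry of a generator labelled outside \<open>P\<close> is
    discarded, since its image is zero in the quotient module.\<close>
  define d' where "d' i r c = (case i of 0 \<Rightarrow> if r = 0 \<and> c < rk 0 \<and> dg 0 c \<in> P then a c else 0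
    | Suc j \<Rightarrow> if r < rk j \<and> c < rk (Suc j) then d j r c else 0)" for i r c
  have X0: "X 0 = {0}" and XS: "X (Suc i) = {..<rk i}" for i by (simp_all add: X_def)
  have gS: "g' (Suc i) c = dg i c" for i c by (simp add: g'_def)
  have d'0: "d' 0 r c = (if r = 0 \<and> c < rk 0 \<and> dg 0 c \<in> P then a c else 0)"
    and d'S: "d' (Suc i) r c = (if r < rk i \<and> c < rk (Suc i) then d i r c else 0)" for i r c
    by (simp_all add: d'_def)
  have bd0: "bd X d' 0 w 0 = (\<Sum>c<rk 0. a c * w c)"
    if \<gamma>: "\<gamma> \<in> P" and w: "\<And>c. w c \<noteq> 0 \<Longrightarrow> c < rk 0 \<and> divides (dg 0 c) \<gamma>" for \<gamma> w
    unfolding bd_def XS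
  proof (rule sum.cong[OF refl])
    fix c assume "c \<in> {..<rk 0}"
    then have c: "c < rk 0" by simp
    show "d' 0 0 c * w c = a c * w c"
    proof (cases "w c = 0 \<or> a c = 0")
      case False
      \<comment> \<open>Testing the image on a unit vector places the label of a generator with
        nonzero image in \<open>SA\<close>. It is not in \<open>SB\<close>, because it divides
        \<gamma>, which lies outside the up-closed \<open>SB\<close>.\<close>
      have "(\<Sum>j<rk 0. a j * cmp (dg 0) (dg 0 c) (unit_vec (rk 0) c) j) = a c"
        using c by (simp add: cmp_unit if_distrib[of "\<lambda>x. _ * x"] sum.delta cong: if_cong)
      then have "dg 0 c \<in> SA" using coeffA[of "dg 0 c" "unit_vec (rk 0) c"] False by simp
      moreover have "dg 0 c \<notin> SB" using w[of c] False \<gamma> upsetD[OF upB] unfolding P_def by blast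
      ultimately show ?thesis using c by (simp add: d'0 P_def)
    qed (auto simp: d'0)
  qed
  have bdS: "bd X d' (Suc i) w r = (if r < rk i then \<Sum>c<rk (Suc i). d i r c * w c else 0)" for i w r
    unfolding bd_def XS by (simp add: d'S)
  have "gcx P X g' d'"
  proof
    show "finite (X i)" for i by (cases i) (simp_all add: X0 XS)
    show "X 0 = {0}" by (rule X0)
    show "\<gamma> \<in> P" if "\<alpha> \<in> P" "\<beta> \<in> P" "divides \<alpha> \<gamma>" "divides \<gamma> \<beta>" for \<alpha> \<beta> \<gamma>
      using that upsetD[OF upA] upsetD[OF upB] unfolding P_def by blast
    show "r \<in> X i \<and> c \<in> X (Suc i) \<and> pres P g' i r (g' (Suc i) c)" if "d' i r c \<noteq> 0" for i r c
      using that d_div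
      by (cases i) (auto simp: X0 XS d'0 d'S gS pres_def split: if_splits)
    show "g' (Suc i) r \<noteq> g' (Suc (Suc i)) c" if nz: "d' (Suc i) r c \<noteq> 0" for i r c
    proof
      assume eq: "g' (Suc i) r = g' (Suc (Suc i)) c"
      have rc: "r < rk i" "c < rk (Suc i)" "d i r c \<noteq> 0" using nz by (auto simp: d'S split: if_splits)
      have "D i $$ (r, c) = Poly_Mapping.single 0 (d i r c)"
        using Dd[OF rc(1,2)] eq by (simp add: gS)
      then have "D i $$ (r, c) * Poly_Mapping.single 0 (1 / d i r c) = 1"
        using rc(3) by (simp add: mult_single single_one)
      then have "D i $$ (r, c) dvd 1" by (metis dvd_triv_left)
      then show False using unit rc by blast
    qed
    show "(\<Sum>s\<in>X (Suc i). d' i r s * d' (Suc i) s c) = 0"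
      if c: "c \<in> X (Suc (Suc i))" and P: "i = 0 \<Longrightarrow> g' (Suc (Suc i)) c \<in> P" for c i r
    proof -
      let ?u = "unit_vec (rk (Suc i)) c" and ?\<gamma> = "dg (Suc i) c"
      have c': "c < rk (Suc i)" using c by (simp add: XS)
      have u: "?u \<in> carrier_vec (rk (Suc i))" by simp
      have col: "cmp (dg i) ?\<gamma> (D i *\<^sub>v ?u) s = d i s c" if "s < rk i" for s
        using cmp_D[OF u that, of ?\<gamma>] c'
        by (simp add: cmp_unit if_distrib[of "\<lambda>x. _ * x"] sum.delta cong: if_cong)
      have Du: "D i *\<^sub>v ?u \<in> carrier_vec (rk i)" using D[of i] u by simp
      have "bd X d' i (\<lambda>s. d' (Suc i) s c) r = 0"
      proof (cases i)
        case 0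
        have "e \<bullet> (D 0 *\<^sub>v ?u) \<in> Mon SB" using ker0[of "D 0 *\<^sub>v ?u"] u 0 by blast
        moreover have \<gamma>: "?\<gamma> \<in> P" using P 0 by (simp add: gS)
        ultimately have "Poly_Mapping.lookup (e \<bullet> (D 0 *\<^sub>v ?u)) ?\<gamma> = 0"
          unfolding Mon_iff P_def by blast
        then have "(\<Sum>s<rk 0. a s * d 0 s c) = 0"
          using lookup_e[of "D 0 *\<^sub>v ?u" ?\<gamma>] Du col 0 by simp
        moreover have "bd X d' 0 (\<lambda>s. d' (Suc 0) s c) 0 = (\<Sum>s<rk 0. a s * d' (Suc 0) s c)"
          by (rule bd0[OF \<gamma>]) (use d_div 0 in \<open>auto simp: d'S split: if_splits\<close>)
        ultimately show ?thesis using 0 c' by (cases "r = 0") (simp_all add: d'S d'0 bd_def)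
      next
        case (Suc j)
        have "D j *\<^sub>v (D (Suc j) *\<^sub>v ?u) = 0\<^sub>v (rk j)"
          using kerS[of "D (Suc j) *\<^sub>v ?u" j] u Suc by blast
        then have "(\<Sum>s<rk (Suc j). d j r s * d (Suc j) s c) = 0" if "r < rk j"
          using cmp_D[of "D (Suc j) *\<^sub>v ?u" j r ?\<gamma>] Du col Suc that by simp
        then show ?thesis using Suc c' by (simp add: bdS d'S)
      qed
      then show ?thesis by (simp add: bd_def)
    qed
    fix i \<gamma> v assume v: "cyc P X g' d' i \<gamma> v"
    have ch: "chain P X g' i \<gamma> v" using v unfolding cyc_def by blast
    show "\<exists>w. chain P X g' (Suc i) \<gamma> w \<and> (\<forall>r. pres P g' i r \<gamma> \<longrightarrow> bd X d' i w r = v r)"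
    proof (cases i)
      case 0
      have v0: "r = 0 \<and> \<gamma> \<in> P" if "v r \<noteq> 0" for r
        using ch that 0 unfolding chain_def by (auto simp: X0 pres_def)
      show ?thesis
      proof (cases "\<gamma> \<in> P")
        case True
        then have "Poly_Mapping.single \<gamma> (v 0) \<in> Mon SA" by (auto simp: Mon_iff P_def lookup_single when_def)
        then obtain u b where u: "u \<in> carrier_vec (rk 0)" and b: "b \<in> Mon SB"
          and eq: "Poly_Mapping.single \<gamma> (v 0) = e \<bullet> u + b" using surA by blast
        have "Poly_Mapping.lookup b \<gamma> = 0" using b True by (auto simp: Mon_iff P_def)
        then have "v 0 = (\<Sum>c<rk 0. a c * cmp (dg 0) \<gamma> u c)"
          using arg_cong[OF eq, of "\<lambda>p. Poly_Mapping.lookup p \<gamma>"] lookup_e[OF u] by (simp add: lookup_add)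
        moreover have nz: "c < rk 0 \<and> divides (dg 0 c) \<gamma>" if "cmp (dg 0) \<gamma> u c \<noteq> 0" for c
          using cmp_nz[OF that] u by simp
        ultimately have "bd X d' 0 (cmp (dg 0) \<gamma> u) 0 = v 0" using bd0[OF True, of "cmp (dg 0) \<gamma> u"] by simp
        moreover have "bd X d' 0 (cmp (dg 0) \<gamma> u) r = v r" if "r \<noteq> 0" for r
          using that v0[of r] by (auto simp: bd_def d'0)
        ultimately have "bd X d' 0 (cmp (dg 0) \<gamma> u) r = v r" for r by (cases "r = 0") auto
        moreover have "chain P X g' (Suc 0) \<gamma> (cmp (dg 0) \<gamma> u)"
          using nz by (simp add: chain_def XS pres_def gS)
        ultimately show ?thesis using 0 by blast
      next
        case False
        then have "chain P X g' (Suc 0) \<gamma> (\<lambda>_. 0)" by (simp add: chain_def)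
        then show ?thesis using 0 False by (auto simp: pres_def)
      qed
    next
      case (Suc j)
      have v': "c < rk j \<and> divides (dg j c) \<gamma>" if "v c \<noteq> 0" for c
        using ch that Suc unfolding chain_def by (auto simp: XS pres_def gS)
      \<comment> \<open>The scalar chain becomes a vector concentrated in the single multidegree
        \<gamma>.\<close>
      have "\<exists>u\<in>carrier_vec (rk j). \<forall>\<beta> c. cmp (dg j) \<beta> u c = (if \<beta> \<in> {\<gamma>} then if \<beta> = \<gamma> then v c else 0 else 0)"
        by (rule vec_of_components) (use v' in \<open>auto split: if_splits\<close>)
      then obtain u where u: "u \<in> carrier_vec (rk j)"
        and cu: "\<And>\<beta> c. cmp (dg j) \<beta> u c = (if \<beta> = \<gamma> then v c else 0)" by auto
      have "u \<in> (*\<^sub>v) (D j) ` carrier_vec (rk (Suc j))"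
      proof (cases j)
        case 0
        have "e \<bullet> u \<in> Mon SB"
          unfolding Mon_iff
        proof (intro allI impI)
          fix t assume t: "Poly_Mapping.lookup (e \<bullet> u) t \<noteq> 0"
          then have t': "(\<Sum>c<rk 0. a c * cmp (dg 0) t u c) \<noteq> 0" using lookup_e u 0 by simp
          then have "t \<in> SA" using coeffA u 0 by blast
          have "t = \<gamma>" using t' cu 0 by (cases "t = \<gamma>") auto
          have "\<gamma> \<notin> P"
          proof
            assume "\<gamma> \<in> P"
            then have "bd X d' 0 v 0 = 0" using v Suc 0 unfolding cyc_def by (simp add: pres_def)
            then show False using bd0[OF \<open>\<gamma> \<in> P\<close>, of v] v' t' cu 0 \<open>t = \<gamma>\<close> by simp
          qed
          then show "t \<in> SB" using \<open>t \<in> SA\<close> \<open>t = \<gamma>\<close> by (simp add: P_def)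
        qed
        then show ?thesis using ker0[of u] u 0 by simp
      next
        case j: (Suc l)
        have "D l *\<^sub>v u = 0\<^sub>v (rk l)"
        proof (rule D_eqI)
          show "u \<in> carrier_vec (rk (Suc l))" "0\<^sub>v (rk l) \<in> carrier_vec (rk l)" using u j by simp_all
          fix \<beta> r assume r: "r < rk l"
          have "bd X d' (Suc l) v r = 0"
          proof (cases "divides (dg l r) \<gamma>")
            case True
            then show ?thesis using v Suc j unfolding cyc_def by (simp add: pres_def gS)
          next
            case False
            then have "d l r c * v c = 0" if "c < rk (Suc l)" for c
              using v'[of c] d_div[OF r that] divides_trans[of "dg l r"] j by auto
            then have "(\<Sum>c<rk (Suc l). d l r c * v c) = 0" by (intro sum.neutral) simp
            then show ?thesis unfolding bdS by simp
          qed
          then show "(\<Sum>c<rk (Suc l). d l r c * cmp (dg (Suc l)) \<beta> u c) = cmp (dg l) \<beta> (0\<^sub>v (rk l)) r"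
            using r cu j unfolding bdS by (cases "\<beta> = \<gamma>") simp_all
        qed
        then show ?thesis using kerS[of u l] u j by simp
      qed
      then obtain y where y: "y \<in> carrier_vec (rk (Suc j))" "u = D j *\<^sub>v y" by blast
      let ?w = "cmp (dg (Suc j)) \<gamma> y"
      have "chain P X g' (Suc i) \<gamma> ?w"
        using cmp_nz[of "dg (Suc j)" \<gamma> y] y(1) Suc by (simp add: chain_def XS pres_def gS)
      moreover have "bd X d' i ?w r = v r" for r
        using cmp_D[OF y(1), of r \<gamma>] y(2) cu[of \<gamma> r] v'[of r] Suc by (auto simp: bdS)
      ultimately show ?thesis by blast
    qed
  qed
  moreover have "X = (\<lambda>i. case i of 0 \<Rightarrow> {0} | Suc j \<Rightarrow> {..<rk j})" by (rule ext) (simp add: X_def)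
  ultimately show ?thesis using gS unfolding P_def by metis
qed

text \<open>Exactness over the polynomial ring follows multidegree by multidegree: a vector has
  finitely many nonzero components, so preimages chosen separately for them can be put
  together.\<close>

lemma resolution_of_gcx:
  assumes C: "gcx (SA - SB) X g (d' :: nat \<Rightarrow> nat \<Rightarrow> nat \<Rightarrow> 'k::field)"
    and XS: "\<And>i. X (Suc i) = {..<rk i}"
    and upA: "upset SA" and upB: "upset SB" and sub: "SB \<subseteq> SA"
  shows "\<exists>(e :: ('v, 'k) mpoly vec) D.
    minimal_free_resolution (Mon SA) (Mon SB) rk (\<lambda>i. g (Suc i)) e D"
proof -
  interpret C: gcx "SA - SB" X g d' by fact
  define dg where "dg i = g (Suc i)" for i
  define a where "a = d' 0 0"
  define d where "d i = d' (Suc i)" for i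
  define e where "e = vec (rk 0) (\<lambda>c. Poly_Mapping.single (dg 0 c) (a c))"
  define D where "D i = mat (rk i) (rk (Suc i))
    (\<lambda>(r, c). Poly_Mapping.single (dg (Suc i) c - dg i r) (d i r c))" for i
  have dnz: "r < rk i \<and> c < rk (Suc i) \<and> divides (dg i r) (dg (Suc i) c)" if "d i r c \<noteq> 0" for i r c
    using C.d_nz[of "Suc i" r c] that by (simp add: d_def dg_def XS pres_def)
  have anz: "c < rk 0 \<and> dg 0 c \<in> SA - SB" if "a c \<noteq> 0" for c
    using C.d_nz[of 0 0 c] that by (simp add: a_def dg_def XS pres_def)
  interpret matrix_form rk dg e D a d
    by unfold_locales (use dnz in \<open>auto simp: e_def D_def\<close>)
  have bd0: "bd X d' 0 w 0 = (\<Sum>c<rk 0. a c * w c)" for w by (simp add: bd_def XS a_def)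
  have bdS: "bd X d' (Suc i) w r = (\<Sum>c<rk (Suc i). d i r c * w c)" for w r i by (simp add: bd_def XS d_def)
  have d0r: "d' 0 r c = 0" if "r \<noteq> 0" for r c using C.d_nz[of 0 r c] that C.X0 by auto
  have chain_cmp: "chain (SA - SB) X g (Suc i) \<gamma> (cmp (dg i) \<gamma> v)" if "v \<in> carrier_vec (rk i)" for i \<gamma> v
    using cmp_nz[of "dg i" \<gamma> v] that by (simp add: chain_def XS pres_def dg_def)
  have coeffA: "\<gamma> \<in> SA" if nz: "Poly_Mapping.lookup (e \<bullet> v) \<gamma> \<noteq> 0" and v: "v \<in> carrier_vec (rk 0)" for \<gamma> v
  proof -
    obtain c where "a c \<noteq> 0" "cmp (dg 0) \<gamma> v c \<noteq> 0"
      using nz unfolding lookup_e[OF v]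
      by (auto elim!: sum.not_neutral_contains_not_neutral)
    then show ?thesis using anz[of c] cmp_nz[of "dg 0" \<gamma> v c] upsetD[OF upA] by blast
  qed
  have im_D: "v \<in> (*\<^sub>v) (D i) ` carrier_vec (rk (Suc i))"
    if v: "v \<in> carrier_vec (rk i)" and cyc: "\<And>\<gamma>. cyc (SA - SB) X g d' (Suc i) \<gamma> (cmp (dg i) \<gamma> v)" for v i
  proof -
    have "\<exists>w. chain (SA - SB) X g (Suc (Suc i)) \<gamma> w \<and>
        (\<forall>r. divides (dg i r) \<gamma> \<longrightarrow> (\<Sum>c<rk (Suc i). d i r c * w c) = cmp (dg i) \<gamma> v r)" for \<gamma>
      using C.exact[OF cyc[of \<gamma>]] by (simp add: bdS pres_def dg_def)
    then have "\<exists>w. \<forall>\<gamma>. chain (SA - SB) X g (Suc (Suc i)) \<gamma> (w \<gamma>) \<and>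
        (\<forall>r. divides (dg i r) \<gamma> \<longrightarrow> (\<Sum>c<rk (Suc i). d i r c * w \<gamma> c) = cmp (dg i) \<gamma> v r)"
      by (intro choice allI)
    then obtain w where w: "\<And>\<gamma>. chain (SA - SB) X g (Suc (Suc i)) \<gamma> (w \<gamma>)"
      "\<And>\<gamma> r. divides (dg i r) \<gamma> \<Longrightarrow> (\<Sum>c<rk (Suc i). d i r c * w \<gamma> c) = cmp (dg i) \<gamma> v r"
      by blast
    have wnz: "c < rk (Suc i) \<and> divides (dg (Suc i) c) \<gamma>" if "w \<gamma> c \<noteq> 0" for \<gamma> c
      using w(1)[of \<gamma>] that by (simp add: chain_def XS pres_def dg_def)
    have w2: "(\<Sum>c<rk (Suc i). d i r c * w \<gamma> c) = cmp (dg i) \<gamma> v r" if "r < rk i" for \<gamma> r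
    proof (cases "divides (dg i r) \<gamma>")
      case False
      have "d i r c * w \<gamma> c = 0" for c
        using False dnz[of i r c] wnz[of \<gamma> c] divides_trans by auto
      then have "(\<Sum>c<rk (Suc i). d i r c * w \<gamma> c) = 0" by (intro sum.neutral) simp
      then show ?thesis using False by (simp add: cmp_def)
    qed (rule w(2))
    let ?G = "{\<gamma>. \<exists>j. cmp (dg i) \<gamma> v j \<noteq> 0}"
    have "\<exists>y\<in>carrier_vec (rk (Suc i)). \<forall>\<gamma> c. cmp (dg (Suc i)) \<gamma> y c = (if \<gamma> \<in> ?G then w \<gamma> c else 0)"
      by (rule vec_of_components[OF finite_components wnz])
    then obtain y where y: "y \<in> carrier_vec (rk (Suc i))"
      and cy: "\<And>\<gamma> c. cmp (dg (Suc i)) \<gamma> y c = (if \<gamma> \<in> ?G then w \<gamma> c else 0)"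
      by (elim bexE) (simp only:)
    have "D i *\<^sub>v y = v"
    proof (rule D_eqI[OF y v])
      fix \<gamma> r assume "r < rk i"
      then show "(\<Sum>c<rk (Suc i). d i r c * cmp (dg (Suc i)) \<gamma> y c) = cmp (dg i) \<gamma> v r"
        using w2[of r \<gamma>] unfolding cy by (cases "\<gamma> \<in> ?G") auto
    qed
    then show ?thesis using y by blast
  qed
  have F1: "{e \<bullet> v + b | v b. v \<in> carrier_vec (rk 0) \<and> b \<in> Mon SB} = Mon SA" (is "?L = _")
  proof (intro equalityI subsetI)
    fix f assume "f \<in> ?L"
    then obtain v b where v: "v \<in> carrier_vec (rk 0)" "b \<in> Mon SB" "f = e \<bullet> v + b" by blast
    have "t \<in> SA" if "Poly_Mapping.lookup f t \<noteq> 0" for t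
      using that v coeffA[of v t] sub by (cases "Poly_Mapping.lookup b t = 0") (auto simp: lookup_add Mon_iff)
    then show "f \<in> Mon SA" by (simp add: Mon_iff)
  next
    fix f :: "('v, 'k) mpoly" assume f: "f \<in> Mon SA"
    let ?G = "{\<gamma>. \<gamma> \<in> Poly_Mapping.keys f \<and> \<gamma> \<in> SA - SB}"
    have "\<exists>w. \<gamma> \<in> ?G \<longrightarrow> chain (SA - SB) X g (Suc 0) \<gamma> w \<and>
        (\<Sum>c<rk 0. a c * w c) = Poly_Mapping.lookup f \<gamma>" for \<gamma>
    proof (cases "\<gamma> \<in> ?G")
      case True
      then have "cyc (SA - SB) X g d' 0 \<gamma> (\<lambda>r. if r = 0 then Poly_Mapping.lookup f \<gamma> else 0)"
        by (auto simp: cyc_def chain_def C.X0 pres_def)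
      from C.exact[OF this] obtain w where "chain (SA - SB) X g (Suc 0) \<gamma> w"
        "bd X d' 0 w 0 = Poly_Mapping.lookup f \<gamma>" using True by (auto simp: pres_def)
      then show ?thesis using bd0[of w] by auto
    qed blast
    then have "\<exists>w. \<forall>\<gamma>. \<gamma> \<in> ?G \<longrightarrow> chain (SA - SB) X g (Suc 0) \<gamma> (w \<gamma>) \<and>
        (\<Sum>c<rk 0. a c * w \<gamma> c) = Poly_Mapping.lookup f \<gamma>"
      by (intro choice allI)
    then obtain w where w: "\<And>\<gamma>. \<gamma> \<in> ?G \<Longrightarrow> chain (SA - SB) X g (Suc 0) \<gamma> (w \<gamma>)"
      "\<And>\<gamma>. \<gamma> \<in> ?G \<Longrightarrow> (\<Sum>c<rk 0. a c * w \<gamma> c) = Poly_Mapping.lookup f \<gamma>" by blast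
    define w' where "w' \<gamma> c = (if \<gamma> \<in> ?G then w \<gamma> c else 0)" for \<gamma> c
    have "c < rk 0 \<and> divides (dg 0 c) \<gamma>" if "w' \<gamma> c \<noteq> 0" for \<gamma> c
      using w(1)[of \<gamma>] that unfolding w'_def by (auto simp: chain_def XS pres_def dg_def split: if_splits)
    moreover have "finite ?G" by simp
    ultimately have "\<exists>y\<in>carrier_vec (rk 0). \<forall>\<gamma> c. cmp (dg 0) \<gamma> y c = (if \<gamma> \<in> ?G then w' \<gamma> c else 0)"
      by (intro vec_of_components)
    then obtain y where y: "y \<in> carrier_vec (rk 0)"
      and cy: "\<And>\<gamma> c. cmp (dg 0) \<gamma> y c = (if \<gamma> \<in> ?G then w' \<gamma> c else 0)"
      by (elim bexE) (simp only:)
    have ey: "Poly_Mapping.lookup (e \<bullet> y) \<gamma> = (if \<gamma> \<in> ?G then Poly_Mapping.lookup f \<gamma> else 0)" for \<gamma>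
      unfolding lookup_e[OF y] cy using w(2)[of \<gamma>] by (cases "\<gamma> \<in> ?G") (simp_all only: w'_def if_True if_False, simp_all)
    have "f - e \<bullet> y \<in> Mon SB"
      unfolding Mon_iff lookup_minus ey using f by (auto simp: Mon_iff in_keys_iff split: if_splits)
    moreover have "f = e \<bullet> y + (f - e \<bullet> y)" by simp
    ultimately show "f \<in> ?L" using y by blast
  qed
  have F2: "{v \<in> carrier_vec (rk 0). e \<bullet> v \<in> Mon SB} = (*\<^sub>v) (D 0) ` carrier_vec (rk 1)" (is "?L = ?R")
  proof (intro equalityI subsetI)
    fix v assume "v \<in> ?L"
    then have v: "v \<in> carrier_vec (rk 0)" "e \<bullet> v \<in> Mon SB" by auto
    have "cyc (SA - SB) X g d' (Suc 0) \<gamma> (cmp (dg 0) \<gamma> v)" for \<gamma>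
      unfolding cyc_def
    proof (intro conjI allI impI)
      fix j r assume j: "Suc 0 = Suc j" and pr: "pres (SA - SB) g j r \<gamma>"
      then have "Poly_Mapping.lookup (e \<bullet> v) \<gamma> = 0" using v(2) by (auto simp: Mon_iff pres_def)
      then show "bd X d' j (cmp (dg 0) \<gamma> v) r = 0"
        using lookup_e[OF v(1), of \<gamma>] j bd0 d0r by (cases "r = 0") (auto simp: bd_def)
    qed (rule chain_cmp[OF v(1)])
    then show "v \<in> ?R" using im_D[OF v(1)] by simp
  next
    fix v assume "v \<in> ?R"
    then obtain y where y: "y \<in> carrier_vec (rk (Suc 0))" "v = D 0 *\<^sub>v y" by auto
    then have v: "v \<in> carrier_vec (rk 0)" using D[of 0] by simp
    have "\<gamma> \<in> SB" if nz: "Poly_Mapping.lookup (e \<bullet> v) \<gamma> \<noteq> 0" for \<gamma>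
    proof (rule ccontr)
      assume "\<gamma> \<notin> SB"
      then have P: "\<gamma> \<in> SA - SB" using coeffA[OF nz v] by blast
      have "Poly_Mapping.lookup (e \<bullet> v) \<gamma> = (\<Sum>r<rk 0. a r * (\<Sum>c<rk (Suc 0). d 0 r c * cmp (dg (Suc 0)) \<gamma> y c))"
        unfolding lookup_e[OF v] using cmp_D[OF y(1), of _ \<gamma>] y(2) by simp
      also have "\<dots> = (\<Sum>c<rk (Suc 0). (\<Sum>r<rk 0. a r * d 0 r c) * cmp (dg (Suc 0)) \<gamma> y c)"
        unfolding sum_distrib_left sum_distrib_right by (subst sum.swap) (simp add: mult.assoc)
      also have "\<dots> = 0"
      proof (intro sum.neutral ballI)
        fix c assume c: "c \<in> {..<rk (Suc 0)}"
        show "(\<Sum>r<rk 0. a r * d 0 r c) * cmp (dg (Suc 0)) \<gamma> y c = 0"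
        proof (cases "dg (Suc 0) c \<in> SA - SB")
          case True
          then have "(\<Sum>r<rk 0. a r * d 0 r c) = 0"
            using C.dd[of c 0 0] c unfolding XS a_def d_def dg_def by simp
          then show ?thesis by simp
        next
          \<comment> \<open>For a label outside \<open>P\<close> the composite with the augmentation
            need not vanish. But a nonzero contribution would place this label between a label in
            \<open>P\<close> and \<gamma>, which is in \<open>P\<close>.\<close>
          case False
          have "a r * d 0 r c = 0 \<or> cmp (dg (Suc 0)) \<gamma> y c = 0" for r
            using False anz[of r] dnz[of 0 r c] cmp_nz[of "dg (Suc 0)" \<gamma> y c]
              C.convex[of "dg 0 r" \<gamma> "dg (Suc 0) c"] P by auto
          then have "cmp (dg (Suc 0)) \<gamma> y c = 0 \<or> (\<forall>r. a r * d 0 r c = 0)" by blast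
          then show ?thesis by (auto intro!: sum.neutral)
        qed
      qed
      finally show False using nz by simp
    qed
    then show "v \<in> ?L" using v by (simp add: Mon_iff)
  qed
  have F3: "{v \<in> carrier_vec (rk (Suc i)). D i *\<^sub>v v = 0\<^sub>v (rk i)} =
      (*\<^sub>v) (D (Suc i)) ` carrier_vec (rk (Suc (Suc i)))" (is "?L = ?R") for i
  proof (intro equalityI subsetI)
    fix v assume "v \<in> ?L"
    then have v: "v \<in> carrier_vec (rk (Suc i))" "D i *\<^sub>v v = 0\<^sub>v (rk i)" by auto
    have "cyc (SA - SB) X g d' (Suc (Suc i)) \<gamma> (cmp (dg (Suc i)) \<gamma> v)" for \<gamma>
      unfolding cyc_def
    proof (intro conjI allI impI)
      fix j r assume j: "Suc (Suc i) = Suc j" and pr: "pres (SA - SB) g j r \<gamma>"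
      have "(\<Sum>c<rk (Suc i). d i r c * cmp (dg (Suc i)) \<gamma> v c) = 0"
      proof (cases "r < rk i")
        case True
        then show ?thesis using cmp_D[OF v(1), of r \<gamma>] v(2) by simp
      next
        case False
        then have "d i r c = 0" for c using dnz[of i r c] by blast
        then show ?thesis by simp
      qed
      then show "bd X d' j (cmp (dg (Suc i)) \<gamma> v) r = 0" using j by (auto simp: bdS)
    qed (rule chain_cmp[OF v(1)])
    then show "v \<in> ?R" using im_D[OF v(1)] by simp
  next
    fix v assume "v \<in> ?R"
    then obtain y where y: "y \<in> carrier_vec (rk (Suc (Suc i)))" "v = D (Suc i) *\<^sub>v y" by auto
    then have v: "v \<in> carrier_vec (rk (Suc i))" using D[of "Suc i"] by simp
    have "D i *\<^sub>v v = 0\<^sub>v (rk i)"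
    proof (rule D_eqI[OF v])
      fix \<gamma> r assume r: "r < rk i"
      have "(\<Sum>s<rk (Suc i). d i r s * cmp (dg (Suc i)) \<gamma> v s) =
          (\<Sum>s<rk (Suc i). d i r s * (\<Sum>c<rk (Suc (Suc i)). d (Suc i) s c * cmp (dg (Suc (Suc i))) \<gamma> y c))"
        using cmp_D[OF y(1), of _ \<gamma>] y(2) by simp
      also have "\<dots> = (\<Sum>c<rk (Suc (Suc i)). (\<Sum>s<rk (Suc i). d i r s * d (Suc i) s c) * cmp (dg (Suc (Suc i))) \<gamma> y c)"
        unfolding sum_distrib_left sum_distrib_right by (subst sum.swap) (simp add: mult.assoc)
      also have "\<dots> = 0"
        using C.dd[of _ "Suc i" r] unfolding XS d_def by simp
      finally show "(\<Sum>s<rk (Suc i). d i r s * cmp (dg (Suc i)) \<gamma> v s) = cmp (dg i) \<gamma> (0\<^sub>v (rk i)) r" by simp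
    qed simp
    then show "v \<in> ?L" using v by simp
  qed
  have F4: "\<forall>j<rk 0. \<forall>t\<in>Poly_Mapping.keys (e $ j). t = dg 0 j"
    by (simp add: ea)
  have F5: "\<forall>i. \<forall>r<rk i. \<forall>c<rk (Suc i). \<forall>t\<in>Poly_Mapping.keys (D i $$ (r, c)). dg i r + t = dg (Suc i) c"
    using dnz by (auto simp: Dd add_minus_divides)
  have "free_resolution (Mon SA) (Mon SB) rk dg e D"
    unfolding free_resolution_def
    by (intro conjI; (rule e F1 F2 F4 F5 | (rule allI, rule D) | (rule allI, rule F3)))
  moreover have "\<not> D i $$ (r, c) dvd 1" if rc: "r < rk i" "c < rk (Suc i)" for i r c
  proof
    assume "D i $$ (r, c) dvd 1"
    then obtain f where f: "1 = Poly_Mapping.single (dg (Suc i) c - dg i r) (d i r c) * f"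
      unfolding Dd[OF rc] by (auto elim: dvdE)
    \<comment> \<open>Compare constant coefficients: a multiple of a monomial has a constant term
      only if the monomial is 1. The labels are then equal, against minimality.\<close>
    have "divides (dg (Suc i) c - dg i r) 0 \<and> d i r c \<noteq> 0"
      using arg_cong[OF f, of "\<lambda>p. Poly_Mapping.lookup p 0"]
      by (auto simp: lookup_single_mult lookup_one split: if_splits)
    then have "dg (Suc i) c - dg i r = 0" "d i r c \<noteq> 0" by simp_all
    then have "dg i r = dg (Suc i) c" using add_minus_divides[of "dg i r" "dg (Suc i) c"] dnz[of i r c] by simp
    then show False using C.minimal[of i r c] \<open>d i r c \<noteq> 0\<close> by (simp add: d_def dg_def)
  qed
  ultimately have "minimal_free_resolution (Mon SA) (Mon SB) rk dg e D"
    unfolding minimal_free_resolution_def by blast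
  then show ?thesis unfolding dg_def by blast
qed

text \<open>This makes the definite description in \<open>betti\<close> usable: the complex yields
  one minimal resolution, and any other has the same count by comparison of complexes.\<close>

theorem betti_eq_card:
  assumes C: "gcx (SA - SB) X g (d :: nat \<Rightarrow> nat \<Rightarrow> nat \<Rightarrow> 'k::field)"
    and up: "upset SA" "upset SB" "SB \<subseteq> SA"
  shows "betti (Mon SA :: ('v, 'k) mpoly set) (Mon SB) i \<alpha> = card {c \<in> X (Suc i). g (Suc i) c = \<alpha>}"
proof -
  interpret C: gcx "SA - SB" X g d by fact
  define rk where "rk i = card (X (Suc i))" for i
  define Y where "Y i = (case i of 0 \<Rightarrow> {0} | Suc j \<Rightarrow> {..<rk j})" for i
  have "\<exists>b. \<forall>i. bij_betw (b i) (Y i) (X i) \<and> (i = 0 \<longrightarrow> b i 0 = (0::nat))"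
  proof (intro choice allI)
    fix i
    show "\<exists>b. bij_betw b (Y i) (X i) \<and> (i = 0 \<longrightarrow> b 0 = (0::nat))"
    proof (cases i)
      case 0
      then show ?thesis using C.X0 by (intro exI[of _ id]) (simp add: Y_def)
    next
      case (Suc j)
      then show ?thesis using ex_bij_betw_nat_finite[OF C.fin[of i]]
        by (auto simp: Y_def rk_def atLeast0LessThan)
    qed
  qed
  then obtain b where b: "\<And>i. bij_betw (b i) (Y i) (X i)" "b 0 0 = (0::nat)" by blast
  have Y: "gcx (SA - SB) Y (\<lambda>i c. g i (b i c)) (\<lambda>i r c. if r \<in> Y i \<and> c \<in> Y (Suc i) then d i (b i r) (b (Suc i) c) else 0)"
    by (rule gcx_reindex[OF C b(1) _ b(2)]) (simp add: Y_def)
  have "\<exists>(e :: ('v, 'k) mpoly vec) D.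
      minimal_free_resolution (Mon SA) (Mon SB) rk (\<lambda>i c. g (Suc i) (b (Suc i) c)) e D"
    by (rule resolution_of_gcx[OF Y _ up]) (simp add: Y_def)
  then obtain e :: "('v, 'k) mpoly vec" and D where res:
    "minimal_free_resolution (Mon SA) (Mon SB) rk (\<lambda>i c. g (Suc i) (b (Suc i) c)) e D" by blast
  have uniq: "card {j. j < rk' i \<and> dg' i j = \<alpha>} = card {c \<in> X (Suc i). g (Suc i) c = \<alpha>}"
    if res': "minimal_free_resolution (Mon SA) (Mon SB) rk' dg' (e' :: ('v, 'k) mpoly vec) D'" for rk' dg' e' D'
  proof -
    from gcx_of_resolution[OF res' up(1,2)]
    obtain g' and d' :: "nat \<Rightarrow> nat \<Rightarrow> nat \<Rightarrow> 'k" where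
      C': "gcx (SA - SB) (\<lambda>i. case i of 0 \<Rightarrow> {0} | Suc j \<Rightarrow> {..<rk' j}) g' d'"
      and g'_all: "\<forall>i c. g' (Suc i) c = dg' i c"
      by (elim exE conjE)
    have g': "g' (Suc i) c = dg' i c" for i c using g'_all by (elim allE)
    have eq: "{j. j < rk' i \<and> dg' i j = \<alpha>} =
        {c \<in> case Suc i of 0 \<Rightarrow> {0} | Suc j \<Rightarrow> {..<rk' j}. g' (Suc i) c = \<alpha>}"
      by (simp add: g' lessThan_def)
    show ?thesis unfolding eq by (rule card_generators_unique[OF C' C])
  qed
  show ?thesis
    unfolding betti_def
  proof (rule the_equality)
    show "\<exists>rk dg (e :: ('v, 'k) mpoly vec) D. minimal_free_resolution (Mon SA) (Mon SB) rk dg e D \<and>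
        card {c \<in> X (Suc i). g (Suc i) c = \<alpha>} = card {j. j < rk i \<and> dg i j = \<alpha>}"
      by (intro exI conjI, rule res, rule uniq[OF res, symmetric])
  next
    fix n assume "\<exists>rk dg (e :: ('v, 'k) mpoly vec) D. minimal_free_resolution (Mon SA) (Mon SB) rk dg e D \<and>
        n = card {j. j < rk i \<and> dg i j = \<alpha>}"
    then show "n = card {c \<in> X (Suc i). g (Suc i) c = \<alpha>}" using uniq by (elim exE conjE) simp
  qed
qed

section \<open>Monomial ideals and up-closed sets of exponents\<close>

definition upc :: "'v expo set \<Rightarrow> 'v expo set" where
  "upc S = {t. \<exists>s\<in>S. divides s t}"

definition minel :: "'v expo set \<Rightarrow> 'v expo set" where
  "minel S = {s \<in> S. \<forall>t\<in>S. divides t s \<longrightarrow> t = s}"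

lemma upset_upc: "upset (upc S)"
  unfolding upset_def upc_def by (auto intro: divides_trans)

lemma upc_upset: "upset S \<Longrightarrow> upc S = S"
  unfolding upc_def by (auto intro: upsetD divides_refl)

lemma upset_Un: "upset S \<Longrightarrow> upset T \<Longrightarrow> upset (S \<union> T)"
  and upset_Int: "upset S \<Longrightarrow> upset T \<Longrightarrow> upset (S \<inter> T)"
  and upset_empty: "upset {}" and upset_UNIV: "upset UNIV"
  and upset_principal: "upset {t. divides m t}"
  unfolding upset_def by (auto intro: divides_trans)

lemma monom_in_Mon: "(monom s :: ('v, 'k::field) mpoly) \<in> Mon S \<longleftrightarrow> s \<in> S"
  by (auto simp: monom_def Mon_iff lookup_single when_def)

lemma Mon_cancel: "(Mon S :: ('v, 'k::field) mpoly set) = Mon T \<longleftrightarrow> S = T"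
proof
  assume eq: "(Mon S :: ('v, 'k) mpoly set) = Mon T"
  have "s \<in> S \<longleftrightarrow> s \<in> T" for s
    using monom_in_Mon[where 'k = 'k, of s S] monom_in_Mon[where 'k = 'k, of s T] eq by simp
  then show "S = T" by blast
qed simp

lemma Mon_empty: "(Mon {} :: ('v, 'k::field) mpoly set) = {0}"
  by (auto simp: Mon_def)

lemma Mon_UNIV: "(Mon UNIV :: ('v, 'k::field) mpoly set) = UNIV"
  by (auto simp: Mon_def)

lemma Mon_Int: "Mon S \<inter> Mon T = Mon (S \<inter> T)"
  by (auto simp: Mon_def)

lemma Mon_zero: "0 \<in> Mon S"
  by (simp add: Mon_def)

lemma Mon_add: "f \<in> Mon S \<Longrightarrow> g \<in> Mon S \<Longrightarrow> f + g \<in> Mon S"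
  unfolding Mon_iff lookup_add by (metis add_0)

lemma Mon_sum: "(\<And>x. x \<in> X \<Longrightarrow> f x \<in> Mon S) \<Longrightarrow> sum f X \<in> Mon S"
  by (induction X rule: infinite_finite_induct) (simp_all add: Mon_add Mon_zero)

lemma mult_module: "Modules.module ((*) :: 'r::comm_ring_1 \<Rightarrow> _)"
  by unfold_locales (simp_all add: algebra_simps)

lemma ideal_gen_monom: "(ideal_gen (monom ` S) :: ('v, 'k::field) mpoly set) = Mon (upc S)"
proof (intro equalityI subsetI)
  interpret R: Modules.module "(*) :: ('v, 'k) mpoly \<Rightarrow> _" by (rule mult_module)
  fix f :: "('v, 'k) mpoly"
  { assume f: "f \<in> ideal_gen (monom ` S)"
    have "R.span (monom ` S) \<subseteq> Mon (upc S)"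
    proof (rule R.span_minimal)
      show "monom ` S \<subseteq> (Mon (upc S) :: ('v, 'k) mpoly set)"
        by (simp add: monom_in_Mon upc_def image_subset_iff) (use divides_refl in blast)
      show "R.subspace (Mon (upc S))"
      proof (rule R.subspaceI)
        show "c * x \<in> Mon (upc S)" if "x \<in> Mon (upc S)" for c x :: "('v, 'k) mpoly"
          using smult_in_Mon[OF that upset_upc, of c] by (simp add: mult.commute)
      qed (simp_all add: Mon_zero Mon_add)
    qed
    then show "f \<in> Mon (upc S)" using f by (auto simp: ideal_gen_def) }
  assume f: "f \<in> Mon (upc S)"
  have "(\<Sum>k\<in>Poly_Mapping.keys f. Poly_Mapping.single k (Poly_Mapping.lookup f k)) \<in> R.span (monom ` S)"
  proof (rule R.span_sum)
    fix k assume "k \<in> Poly_Mapping.keys f"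
    then obtain s where s: "s \<in> S" "divides s k" using f by (auto simp: Mon_def upc_def)
    have "Poly_Mapping.single k (Poly_Mapping.lookup f k) =
        Poly_Mapping.single (k - s) (Poly_Mapping.lookup f k) * monom s"
      using add_minus_divides[OF s(2)] by (simp add: monom_def mult_single add.commute)
    also have "\<dots> \<in> R.span (monom ` S)"
      using s(1) by (intro R.span_scale R.span_base) auto
    finally show "Poly_Mapping.single k (Poly_Mapping.lookup f k) \<in> R.span (monom ` S)" .
  qed
  then show "f \<in> ideal_gen (monom ` S)"
    using poly_mapping_eq_sum_single[of f] by (simp add: ideal_gen_def)
qed

lemma monomial_ideal_iff: "monomial_ideal I \<longleftrightarrow> (\<exists>S. upset S \<and> I = Mon S)"
  unfolding monomial_ideal_def ideal_gen_monom
proof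
  assume "\<exists>S. I = Mon (upc S)"
  then show "\<exists>S. upset S \<and> I = Mon S" using upset_upc by blast
next
  assume "\<exists>S. upset S \<and> I = Mon S"
  then obtain S where "upset S" "I = Mon S" by blast
  then have "I = Mon (upc S)" by (simp add: upc_upset)
  then show "\<exists>S. I = Mon (upc S)" by blast
qed

lemma mingens_Mon: "mingens (Mon S :: ('v, 'k::field) mpoly set) = minel S"
  by (auto simp: mingens_def minel_def monom_in_Mon)

lemma total_deg_add: "total_deg (s + t) = total_deg s + total_deg t"
  by (simp add: total_deg_def lookup_add sum.distrib)

lemma total_deg_pow: "total_deg (pow v a) = a"
  by (simp add: total_deg_def lookup_single when_def)

lemma total_deg_eq_0: "total_deg s = 0 \<longleftrightarrow> s = 0"
  by (auto simp: total_deg_def intro: poly_mapping_eqI)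

lemma divides_eqI_total_deg: "divides s t \<Longrightarrow> total_deg t \<le> total_deg s \<Longrightarrow> s = t"
  using add_minus_divides[of s t] total_deg_add[of s "t - s"] by (simp add: total_deg_eq_0)

lemma ex_minel: "(s :: ('v::finite) expo) \<in> S \<Longrightarrow> \<exists>t\<in>minel S. divides t s"
proof (induction "total_deg s" arbitrary: s rule: less_induct)
  case less
  show ?case
  proof (cases "s \<in> minel S")
    case False
    then obtain t where t: "t \<in> S" "divides t s" "t \<noteq> s" using less.prems by (auto simp: minel_def)
    then have "total_deg t < total_deg s" using divides_eqI_total_deg[of t s] by force
    then show ?thesis using less.hyps[of t] t divides_trans by blast
  qed (auto intro: divides_refl)
qed

lemma upc_minel: "upset (S :: ('v::finite) expo set) \<Longrightarrow> upc (minel S) = S"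
  using ex_minel unfolding upc_def by (fastforce simp: minel_def intro: upsetD)

lemma minel_upc_subset: "minel (upc G) \<subseteq> G"
  unfolding minel_def upc_def by (auto intro: divides_refl)

lemma minel_principal: "minel {t. divides m t} = {m}"
  by (auto simp: minel_def dest: spec[of _ m] intro: divides_antisym)

lemma ideal_sum_Mon: "ideal_sum (Mon S) (Mon T) = (Mon (S \<union> T) :: ('v, 'k::field) mpoly set)"
proof (intro equalityI subsetI)
  fix f :: "('v, 'k) mpoly" assume "f \<in> ideal_sum (Mon S) (Mon T)"
  then obtain a b where "f = a + b" "a \<in> Mon S" "b \<in> Mon T" by (auto simp: ideal_sum_def)
  moreover from this have "a \<in> Mon (S \<union> T)" "b \<in> Mon (S \<union> T)" by (auto simp: Mon_def)
  ultimately show "f \<in> Mon (S \<union> T)" by (simp add: Mon_add)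
next
  fix f :: "('v, 'k) mpoly" assume f: "f \<in> Mon (S \<union> T)"
  let ?t = "\<lambda>k. Poly_Mapping.single k (Poly_Mapping.lookup f k)"
  let ?a = "sum ?t (Poly_Mapping.keys f \<inter> S)" and ?b = "sum ?t (Poly_Mapping.keys f - S)"
  have "sum ?t (Poly_Mapping.keys f) = ?a + ?b" by (rule sum.Int_Diff) simp
  then have "f = ?a + ?b" by (rule trans[OF poly_mapping_eq_sum_single])
  moreover have "?a \<in> Mon S" by (rule Mon_sum) (auto simp: Mon_iff lookup_single when_def)
  moreover have "?b \<in> Mon T" using f by (intro Mon_sum) (auto simp: Mon_iff lookup_single when_def in_keys_iff)
  ultimately show "f \<in> ideal_sum (Mon S) (Mon T)" unfolding ideal_sum_def by blast
qed

lemma monom_mult_Mon: "(*) (monom n) ` Mon S = (Mon ((+) n ` S) :: ('v, 'k::field) mpoly set)"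
proof (intro equalityI subsetI)
  fix f :: "('v, 'k) mpoly" assume "f \<in> (*) (monom n) ` Mon S"
  then obtain h where h: "h \<in> Mon S" "f = monom n * h" by blast
  show "f \<in> Mon ((+) n ` S)"
    unfolding Mon_iff
  proof (intro allI impI)
    fix t assume "Poly_Mapping.lookup f t \<noteq> 0"
    then have "divides n t" "Poly_Mapping.lookup h (t - n) \<noteq> 0"
      unfolding h(2) monom_def by (auto simp: lookup_single_mult split: if_splits)
    then have "t - n \<in> S" "t = n + (t - n)" using h(1) add_minus_divides[of n t] by (simp_all add: Mon_iff)
    then show "t \<in> (+) n ` S" by (rule rev_image_eqI)
  qed
next
  fix f :: "('v, 'k) mpoly" assume f: "f \<in> Mon ((+) n ` S)"
  let ?h = "\<Sum>k\<in>Poly_Mapping.keys f. Poly_Mapping.single (k - n) (Poly_Mapping.lookup f k)"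
  have "?h \<in> Mon S"
  proof (rule Mon_sum)
    fix k assume "k \<in> Poly_Mapping.keys f"
    then show "Poly_Mapping.single (k - n) (Poly_Mapping.lookup f k) \<in> Mon S"
      using f by (auto simp: Mon_def)
  qed
  moreover have "monom n * ?h = f"
  proof -
    have "monom n * ?h = (\<Sum>k\<in>Poly_Mapping.keys f. Poly_Mapping.single k (Poly_Mapping.lookup f k))"
      unfolding sum_distrib_left monom_def mult_single
      using f by (intro sum.cong) (auto simp: Mon_def)
    then show ?thesis using poly_mapping_eq_sum_single[of f] by simp
  qed
  ultimately show "f \<in> (*) (monom n) ` Mon S" by (intro rev_image_eqI[of ?h]) simp_all
qed

lemma colon_Mon: "colon (Mon S) (monom m) = (Mon {t. m + t \<in> S} :: ('v, 'k::field) mpoly set)"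
proof -
  have "f * monom m \<in> Mon S \<longleftrightarrow> f \<in> Mon {t. m + t \<in> S}" for f :: "('v, 'k) mpoly"
  proof
    assume "f * monom m \<in> Mon S"
    then have h: "m + t \<in> S" if "Poly_Mapping.lookup (f * monom m) (m + t) \<noteq> 0" for t
      using that by (simp add: Mon_iff)
    have "Poly_Mapping.lookup (f * monom m) (m + t) = Poly_Mapping.lookup f t" for t
      unfolding monom_def mult.commute[of f] by (simp add: lookup_single_add_mult)
    then show "f \<in> Mon {t. m + t \<in> S}" using h by (simp add: Mon_iff)
  next
    assume f: "f \<in> Mon {t. m + t \<in> S}"
    show "f * monom m \<in> Mon S"
      unfolding Mon_iff
    proof (intro allI impI)
      fix t assume "Poly_Mapping.lookup (f * monom m) t \<noteq> 0"
      then have "divides m t" "Poly_Mapping.lookup f (t - m) \<noteq> 0"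
        unfolding monom_def mult.commute[of f] by (simp_all add: lookup_single_mult split: if_splits)
      then show "t \<in> S" using f add_minus_divides[of m t] by (auto simp: Mon_iff)
    qed
  qed
  then show ?thesis unfolding colon_def by blast
qed

section \<open>Betti splittings\<close>

text \<open>Sufficient for the inclusion of \<open>A\<close> in \<open>J\<close> to induce the zero
  map on Tor in multidegree \<alpha>. Monomials of \<open>A\<close> with a smaller exponent of
  \<open>z\<close> carry no condition, because they lie strictly below \<alpha> anyway.\<close>

definition vanish :: "'v expo set \<Rightarrow> 'v expo set \<Rightarrow> 'v expo \<Rightarrow> bool" where
  "vanish A J \<alpha> \<longleftrightarrow> (\<exists>z. expo_at \<alpha> z > 0 \<and>
    (\<forall>y\<in>A. divides y \<alpha> \<longrightarrow> expo_at y z = expo_at \<alpha> z \<longrightarrow> y - pow z 1 \<in> J))"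

text \<open>The map of resolutions over \<open>A \<subseteq> J\<close> can be chosen to lower the exponent of \<open>z\<close> in the
  multidegree \<open>\<alpha>\<close>. By uniqueness up to homotopy no choice has a unit entry there.\<close>

lemma chain_map_no_unit:
  fixes dA dJ :: "nat \<Rightarrow> nat \<Rightarrow> nat \<Rightarrow> 'k::field"
  assumes A: "gcx A XA gA dA" and J: "gcx J XJ gJ dJ"
    and "A \<subseteq> J" and sup: "\<And>i c. c \<in> XA (Suc i) \<Longrightarrow> gA (Suc i) c \<in> A"
    and \<phi>: "chain_map A XA gA dA XJ gJ dJ (\<lambda>\<gamma>. \<gamma>) \<phi>"
    and van: "vanish A J (gA (Suc i) c)" and eq: "gJ (Suc i) r = gA (Suc i) c"
  shows "\<phi> (Suc i) r c = 0"
proof (rule ccontr)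
  assume nz: "\<phi> (Suc i) r c \<noteq> 0"
  let ?\<alpha> = "gA (Suc i) c"
  obtain z where z: "expo_at ?\<alpha> z > 0"
    and zJ: "\<And>y. y \<in> A \<Longrightarrow> divides y ?\<alpha> \<Longrightarrow> expo_at y z = expo_at ?\<alpha> z \<Longrightarrow> y - pow z 1 \<in> J"
    using van unfolding vanish_def by blast
  \<comment> \<open>Among the divisors of \<alpha>, labels with the full exponent of
    \<open>z\<close> are lowered and all others are kept. This is monotone: a label below a lowered
    one is itself lowered or already has a smaller exponent of \<open>z\<close>.\<close>
  define \<rho> where "\<rho> \<gamma> = (if divides \<gamma> ?\<alpha> \<and> expo_at \<gamma> z = expo_at ?\<alpha> z then \<gamma> - pow z 1 else \<gamma>)" for \<gamma>
  have \<rho>_le: "divides (\<rho> \<gamma>) \<gamma>" for \<gamma>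
    by (simp add: \<rho>_def) (simp add: divides_iff lookup_minus)
  have "divides (\<rho> \<beta>) (\<rho> \<gamma>)" if le: "divides \<beta> \<gamma>" for \<beta> \<gamma>
  proof (cases "divides \<gamma> ?\<alpha> \<and> expo_at \<gamma> z = expo_at ?\<alpha> z")
    case True
    have "expo_at (\<rho> \<beta>) v \<le> expo_at (\<gamma> - pow z 1) v" for v
    proof -
      have "expo_at \<beta> v \<le> expo_at \<gamma> v" using le by (simp add: divides_iff)
      moreover have "divides \<beta> ?\<alpha>" using le True divides_trans by blast
      ultimately show ?thesis
        using True unfolding \<rho>_def by (auto simp: lookup_minus lookup_single when_def)
    qed
    then show ?thesis using True by (simp add: \<rho>_def divides_iff)
  next
    case False
    then have "\<rho> \<gamma> = \<gamma>" by (auto simp: \<rho>_def)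
    then show ?thesis using \<rho>_le[of \<beta>] le divides_trans by metis
  qed
  moreover have "gA (Suc i) c \<in> A \<longleftrightarrow> \<rho> (gA (Suc i) c) \<in> J" if "c \<in> XA (Suc i)" for i c
    using sup[OF that] zJ \<open>A \<subseteq> J\<close> by (auto simp: \<rho>_def)
  ultimately have "\<exists>\<psi>. chain_map A XA gA dA XJ gJ dJ \<rho> \<psi>"
    by (intro chain_map_exists[OF A J])
  then obtain \<psi> where \<psi>: "chain_map A XA gA dA XJ gJ dJ \<rho> \<psi>" by (elim exE)
  have \<psi>nz: "c \<in> XA (Suc i) \<and> r \<in> XJ (Suc i) \<and> divides (gJ (Suc i) r) (\<rho> (gA (Suc i) c))"
    if "\<psi> (Suc i) r c \<noteq> 0" for i r c
    using \<psi> that unfolding chain_map_def by blast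
  note \<psi>' = \<psi>[unfolded chain_map_def]
  have mid: "\<forall>i r c. \<psi> (Suc i) r c \<noteq> 0 \<longrightarrow>
      c \<in> XA (Suc i) \<and> r \<in> XJ (Suc i) \<and> divides (gJ (Suc i) r) (gA (Suc i) c)"
    using divides_trans[OF _ \<rho>_le] \<psi>nz by blast
  have \<psi>id: "chain_map A XA gA dA XJ gJ dJ (\<lambda>\<gamma>. \<gamma>) \<psi>"
    unfolding chain_map_def by (rule conjI[OF conjunct1[OF \<psi>'] conjI[OF mid conjunct2[OF conjunct2[OF \<psi>']]]])
  have "\<phi> (Suc i) r c = \<psi> (Suc i) r c"
    by (rule chain_map_unique[OF A J _ \<phi> \<psi>id eq]) (use sup \<open>A \<subseteq> J\<close> in blast)
  then have "divides ?\<alpha> (\<rho> ?\<alpha>)" using \<psi>nz[of i r c] nz eq by simp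
  then have "divides ?\<alpha> (?\<alpha> - pow z 1)" by (simp add: \<rho>_def)
  then have "expo_at ?\<alpha> z \<le> expo_at ?\<alpha> z - 1" by (auto simp: divides_iff lookup_minus dest: spec[of _ z])
  then show False using z by simp
qed

text \<open>The field occurs in no other argument, hence the \<open>itself\<close> argument. That
  all labels lie in \<open>S\<close> is carried along because the cone construction asks for
  it.\<close>

definition has_res :: "'k::field itself \<Rightarrow> 'v expo set \<Rightarrow> (nat \<Rightarrow> 'v expo \<Rightarrow> nat) \<Rightarrow> bool" where
  "has_res T S b \<longleftrightarrow> (\<exists>X g. \<exists>d :: nat \<Rightarrow> nat \<Rightarrow> nat \<Rightarrow> 'k. gcx S X g d \<and>
    (\<forall>i c. c \<in> X (Suc i) \<longrightarrow> g (Suc i) c \<in> S) \<and>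
    (\<forall>i \<alpha>. card {c \<in> X (Suc i). g (Suc i) c = \<alpha>} = b i \<alpha>))"

lemma betti_ideal_eq:
  assumes "upset S" "has_res TYPE('k::field) S b"
  shows "betti_ideal (Mon S :: ('v, 'k) mpoly set) i \<alpha> = b i \<alpha>"
proof -
  obtain X g and d :: "nat \<Rightarrow> nat \<Rightarrow> nat \<Rightarrow> 'k" where C: "gcx S X g d"
    and b: "\<forall>i \<alpha>. card {c \<in> X (Suc i). g (Suc i) c = \<alpha>} = b i \<alpha>"
    using assms(2) unfolding has_res_def by (elim exE conjE)
  have "gcx (S - {}) X g d" using C by simp
  from betti_eq_card[OF this assms(1) upset_empty empty_subsetI] b show ?thesis
    by (simp add: Mon_empty)
qed

text \<open>\<open>vanish\<close> is asked only where both Betti numbers are nonzero in the same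
  homological degree, since only there can an entry of a comparison map join equal labels.\<close>

lemma has_res_split:
  fixes J K :: "'v expo set"
  assumes J: "has_res TYPE('k::field) J bJ" and K: "has_res TYPE('k) K bK"
    and A: "has_res TYPE('k) (J \<inter> K) bA" and up: "upset J" "upset K"
    and van: "\<And>i \<alpha>. bA i \<alpha> \<noteq> 0 \<Longrightarrow>
      (bJ i \<alpha> = 0 \<or> vanish (J \<inter> K) J \<alpha>) \<and> (bK i \<alpha> = 0 \<or> vanish (J \<inter> K) K \<alpha>)"
  shows "has_res TYPE('k) (J \<union> K) (\<lambda>i \<alpha>. bJ i \<alpha> + bK i \<alpha> + (if i = 0 then 0 else bA (i - 1) \<alpha>))"
proof -
  obtain XJ gJ and dJ :: "nat \<Rightarrow> nat \<Rightarrow> nat \<Rightarrow> 'k" where CJ: "gcx J XJ gJ dJ"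
    and sJ: "\<forall>i c. c \<in> XJ (Suc i) \<longrightarrow> gJ (Suc i) c \<in> J"
    and bJ: "\<forall>i \<alpha>. card {c \<in> XJ (Suc i). gJ (Suc i) c = \<alpha>} = bJ i \<alpha>"
    using J unfolding has_res_def by (elim exE conjE)
  obtain XK gK and dK :: "nat \<Rightarrow> nat \<Rightarrow> nat \<Rightarrow> 'k" where CK: "gcx K XK gK dK"
    and sK: "\<forall>i c. c \<in> XK (Suc i) \<longrightarrow> gK (Suc i) c \<in> K"
    and bK: "\<forall>i \<alpha>. card {c \<in> XK (Suc i). gK (Suc i) c = \<alpha>} = bK i \<alpha>"
    using K unfolding has_res_def by (elim exE conjE)
  obtain XA gA and dA :: "nat \<Rightarrow> nat \<Rightarrow> nat \<Rightarrow> 'k" where CA: "gcx (J \<inter> K) XA gA dA"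
    and sA: "\<forall>i c. c \<in> XA (Suc i) \<longrightarrow> gA (Suc i) c \<in> J \<inter> K"
    and bA: "\<forall>i \<alpha>. card {c \<in> XA (Suc i). gA (Suc i) c = \<alpha>} = bA i \<alpha>"
    using A unfolding has_res_def by (elim exE conjE)
  have "\<exists>\<phi>. chain_map (J \<inter> K) XA gA dA XJ gJ dJ (\<lambda>\<gamma>. \<gamma>) \<phi>"
    by (rule chain_map_exists[OF CA CJ]) (use sA in blast)+
  then obtain \<phi> where \<phi>: "chain_map (J \<inter> K) XA gA dA XJ gJ dJ (\<lambda>\<gamma>. \<gamma>) \<phi>" by (elim exE)
  have "\<exists>\<psi>. chain_map (J \<inter> K) XA gA dA XK gK dK (\<lambda>\<gamma>. \<gamma>) \<psi>"
    by (rule chain_map_exists[OF CA CK]) (use sA in blast)+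
  then obtain \<psi> where \<psi>: "chain_map (J \<inter> K) XA gA dA XK gK dK (\<lambda>\<gamma>. \<gamma>) \<psi>" by (elim exE)
  have bpos: "b i \<alpha> \<noteq> 0" if "gcx P X g (d :: nat \<Rightarrow> nat \<Rightarrow> nat \<Rightarrow> 'k)"
    "\<forall>i \<alpha>. card {c \<in> X (Suc i). g (Suc i) c = \<alpha>} = b i \<alpha>" "c \<in> X (Suc i)" "g (Suc i) c = \<alpha>"
    for P :: "'v expo set" and X g d b i c \<alpha>
  proof -
    have "finite {c \<in> X (Suc i). g (Suc i) c = \<alpha>}" using gcx.fin[OF that(1)] by simp
    then have "card {c \<in> X (Suc i). g (Suc i) c = \<alpha>} \<noteq> 0" using that(3,4) by auto
    then show ?thesis using that(2) by simp
  qed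
  have \<phi>min: "gJ (Suc i) r \<noteq> gA (Suc i) c" if nz: "\<phi> (Suc i) r c \<noteq> 0" for i r c
  proof
    assume eq: "gJ (Suc i) r = gA (Suc i) c"
    have "c \<in> XA (Suc i)" "r \<in> XJ (Suc i)" using \<phi> nz unfolding chain_map_def by blast+
    then have "vanish (J \<inter> K) J (gA (Suc i) c)"
      using van[of i "gA (Suc i) c"] bpos[OF CA bA, of c i] bpos[OF CJ bJ, of r i] eq by simp
    then have "\<phi> (Suc i) r c = 0"
      by (intro chain_map_no_unit[OF CA CJ _ _ \<phi> _ eq]) (use sA in auto)
    then show False using nz by simp
  qed
  have \<psi>min: "gK (Suc i) r \<noteq> gA (Suc i) c" if nz: "\<psi> (Suc i) r c \<noteq> 0" for i r c
  proof
    assume eq: "gK (Suc i) r = gA (Suc i) c"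
    have "c \<in> XA (Suc i)" "r \<in> XK (Suc i)" using \<psi> nz unfolding chain_map_def by blast+
    then have "vanish (J \<inter> K) K (gA (Suc i) c)"
      using van[of i "gA (Suc i) c"] bpos[OF CA bA, of c i] bpos[OF CK bK, of r i] eq by simp
    then have "\<psi> (Suc i) r c = 0"
      by (intro chain_map_no_unit[OF CA CK _ _ \<psi> _ eq]) (use sA in auto)
    then show False using nz by simp
  qed
  interpret J: gcx J XJ gJ dJ by (rule CJ)
  interpret K: gcx K XK gK dK by (rule CK)
  interpret A: gcx "J \<inter> K" XA gA dA by (rule CA)
  interpret cone J XJ gJ dJ K XK gK dK XA gA dA \<phi> \<psi>
    by unfold_locales (rule up \<phi> \<psi> | erule sJ[rule_format] sK[rule_format] sA[rule_format] \<phi>min \<psi>min)+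
  have eq: "card {c \<in> X (Suc i). g (Suc i) c = \<alpha>} = bJ i \<alpha> + bK i \<alpha> + (if i = 0 then 0 else bA (i - 1) \<alpha>)" for i \<alpha>
    unfolding card_cone using bJ bK bA by (cases i) simp_all
  show ?thesis
    unfolding has_res_def by (intro exI conjI allI impI, rule gcx_cone, erule sup_cone, rule eq)
qed

section \<open>Principal ideals and their prunings\<close>

lemma gcx_zero: "gcx {} (\<lambda>i. if i = 0 then {0} else {}) g (\<lambda>i r c. 0)"
proof
  fix i \<gamma> and v :: "nat \<Rightarrow> 'k::field"
  assume "cyc {} (\<lambda>i. if i = 0 then {0} else {}) g (\<lambda>i r c. 0) i \<gamma> v"
  then have "v c = 0" for c by (auto simp: cyc_def chain_def pres_def split: if_splits)
  then show "\<exists>w. chain {} (\<lambda>i. if i = 0 then {0} else {}) g (Suc i) \<gamma> w \<and>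
      (\<forall>r. pres {} g i r \<gamma> \<longrightarrow> bd (\<lambda>i. if i = 0 then {0} else {}) (\<lambda>i r c. 0) i w r = v r)"
    by (intro exI[of _ "\<lambda>_. 0"]) (simp add: chain_def bd_def)
qed auto

text \<open>The complex \<open>0 \<rightarrow> R(-m) \<rightarrow> (m) \<rightarrow> 0\<close>, and below its analogue for \<open>R / (m)\<close>.\<close>

lemma gcx_principal:
  "gcx {t. divides m t} (\<lambda>i. if i \<le> 1 then {0} else {}) (\<lambda>i c. m)
    (\<lambda>i r c. if i = 0 \<and> r = 0 \<and> c = 0 then 1 else (0 :: 'k::field))"
  (is "gcx ?P ?X ?g ?d")
proof
  show "\<And>\<alpha> \<beta> \<gamma>. \<alpha> \<in> ?P \<Longrightarrow> \<beta> \<in> ?P \<Longrightarrow> divides \<alpha> \<gamma> \<Longrightarrow> divides \<gamma> \<beta> \<Longrightarrow> \<gamma> \<in> ?P"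
    using divides_trans by auto
  fix i \<gamma> and v :: "nat \<Rightarrow> 'k" assume v: "cyc ?P ?X ?g ?d i \<gamma> v"
  have ch: "chain ?P ?X ?g i \<gamma> v" using v by (simp add: cyc_def)
  show "\<exists>w. chain ?P ?X ?g (Suc i) \<gamma> w \<and> (\<forall>r. pres ?P ?g i r \<gamma> \<longrightarrow> bd ?X ?d i w r = v r)"
  proof (cases i)
    case 0
    then have "v c = 0" if "c \<noteq> 0 \<or> \<not> divides m \<gamma>" for c
      using ch that unfolding chain_def by (auto simp: pres_def split: if_splits)
    then show ?thesis using 0
      by (intro exI[of _ "\<lambda>c. if c = 0 then v 0 else 0"]) (auto simp: chain_def pres_def bd_def)
  next
    case (Suc j)
    have "v c = 0" for c
    proof (cases "i = 1 \<and> c = 0 \<and> divides m \<gamma>")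
      case True
      then have "bd ?X ?d 0 v 0 = 0" using v unfolding cyc_def by (simp add: pres_def)
      then show ?thesis using True by (simp add: bd_def)
    next
      case False
      then show ?thesis using ch Suc unfolding chain_def by (auto simp: pres_def split: if_splits)
    qed
    then show ?thesis by (intro exI[of _ "\<lambda>_. 0"]) (simp add: chain_def bd_def)
  qed
qed (auto simp: pres_def split: if_splits)

lemma gcx_quotient_principal:
  assumes "m \<noteq> 0"
  shows "gcx (UNIV - {t. divides m t}) (\<lambda>i. if i \<le> 2 then {0} else {}) (\<lambda>i c. if i = 2 then m else 0)
    (\<lambda>i r c. if i \<le> 1 \<and> r = 0 \<and> c = 0 then 1 else (0 :: 'k::field))"
  (is "gcx ?P ?X ?g ?d")
proof
  show "\<And>\<alpha> \<beta> \<gamma>. \<alpha> \<in> ?P \<Longrightarrow> \<beta> \<in> ?P \<Longrightarrow> divides \<alpha> \<gamma> \<Longrightarrow> divides \<gamma> \<beta> \<Longrightarrow> \<gamma> \<in> ?P"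
    using divides_trans by blast
  show "r \<in> ?X i \<and> c \<in> ?X (Suc i) \<and> pres ?P ?g i r (?g (Suc i) c)" if "?d i r c \<noteq> 0" for i r c
  proof -
    have "i = 0 \<or> i = 1" "r = 0" "c = 0" using that by (auto split: if_splits)
    then show ?thesis using assms by (auto simp: pres_def)
  qed
  show "?g (Suc i) r \<noteq> ?g (Suc (Suc i)) c" if "?d (Suc i) r c \<noteq> 0" for i r c
    using that assms by (auto split: if_splits)
  show "(\<Sum>s\<in>?X (Suc i). ?d i r s * ?d (Suc i) s c) = 0"
    if "c \<in> ?X (Suc (Suc i))" "i = 0 \<Longrightarrow> ?g (Suc (Suc i)) c \<in> ?P" for i r c
    using that by (auto split: if_splits)
  fix i \<gamma> and v :: "nat \<Rightarrow> 'k" assume v: "cyc ?P ?X ?g ?d i \<gamma> v"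
  have ch: "chain ?P ?X ?g i \<gamma> v" using v by (simp add: cyc_def)
  consider "i = 0" | "i = 1" | "i = 2" | "2 < i" by linarith
  then show "\<exists>w. chain ?P ?X ?g (Suc i) \<gamma> w \<and> (\<forall>r. pres ?P ?g i r \<gamma> \<longrightarrow> bd ?X ?d i w r = v r)"
  proof cases
    case 1
    then have "v c = 0" if "c \<noteq> 0" for c
      using ch that unfolding chain_def by (auto split: if_splits)
    then show ?thesis using 1
      by (intro exI[of _ "\<lambda>c. if c = 0 then v 0 else 0"]) (auto simp: chain_def pres_def bd_def)
  next
    case 2
    then have vc: "v c = 0" if "c \<noteq> 0" for c
      using ch that unfolding chain_def by (auto split: if_splits)
    show ?thesis
    proof (cases "divides m \<gamma>")
      case True
      then show ?thesis using 2 vc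
        by (intro exI[of _ "\<lambda>c. if c = 0 then v 0 else 0"]) (auto simp: chain_def pres_def bd_def)
    next
      case False
      then have "bd ?X ?d 0 v 0 = 0" using v 2 unfolding cyc_def by (simp add: pres_def)
      then have "v 0 = 0" by (simp add: bd_def)
      then have "v c = 0" for c using vc by (cases "c = 0") auto
      then show ?thesis by (intro exI[of _ "\<lambda>_. 0"]) (simp add: chain_def bd_def)
    qed
  next
    case 3
    then have vc: "v c = 0" if "c \<noteq> 0" for c
      using ch that unfolding chain_def by (auto split: if_splits)
    have "bd ?X ?d 1 v 0 = 0" using v 3 unfolding cyc_def by (simp add: pres_def)
    then have "v 0 = 0" by (simp add: bd_def)
    then have "v c = 0" for c using vc by (cases "c = 0") auto
    then show ?thesis by (intro exI[of _ "\<lambda>_. 0"]) (simp add: chain_def bd_def)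
  next
    case 4
    then have "v c = 0" for c using ch unfolding chain_def by (auto split: if_splits)
    then show ?thesis by (intro exI[of _ "\<lambda>_. 0"]) (simp add: chain_def bd_def)
  qed
qed auto

lemma has_res_empty: "has_res TYPE('k::field) {} (\<lambda>i \<alpha>. 0)"
  unfolding has_res_def by (intro exI conjI, rule gcx_zero) simp_all

lemma has_res_principal:
  "has_res TYPE('k::field) {t. divides m t} (\<lambda>i \<alpha>. if i = 0 \<and> \<alpha> = m then 1 else 0)"
  unfolding has_res_def
proof (intro exI conjI, rule gcx_principal)
  have "{c \<in> if Suc i \<le> 1 then {0} else {}. m = \<alpha>} = (if i = 0 \<and> \<alpha> = m then {0::nat} else {})" for i \<alpha>
    by auto
  then show "\<forall>i \<alpha>. card {c \<in> if Suc i \<le> 1 then {0} else {}. m = \<alpha>} = (if i = 0 \<and> \<alpha> = m then 1 else 0)"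
    by simp
qed (simp split: if_splits)

lemma lcm_expo_empty: "lcm_expo {} = 0"
  unfolding lcm_expo_def zero_poly_mapping_def by simp

lemma lcm_expo_singleton: "lcm_expo {m} = m"
proof -
  have "(\<lambda>v. Max (insert 0 ((\<lambda>s. expo_at s v) ` {m}))) = expo_at m" by (rule ext) simp
  then show ?thesis unfolding lcm_expo_def by (simp only: lookup_inverse)
qed

lemma critical_faces_Nil: "critical_faces [] = {{}}"
  unfolding critical_faces_def by simp

text \<open>For \<open>m = 0\<close> the ideal is the whole ring: the empty face and the vertex have
  the same lcm and are matched with each other, in accordance with the quotient being zero.\<close>

lemma critical_faces_singleton: "critical_faces [m] = (if m = 0 then {} else {{}, {0}})"
proof -
  have faces: "Pow {..<Suc 0} = {{}, {0}}" by (simp add: lessThan_Suc Pow_insert insert_commute)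
  have eq: "face_lcm [m] {} = 0" "face_lcm [m] {0} = m"
    by (simp_all add: face_lcm_def lcm_expo_empty lcm_expo_singleton)
  have edges: "pruned_edges [m] (length [m]) = (if m = 0 then {{{}, {0}}} else {})" (is "_ = ?E")
  proof (intro equalityI subsetI)
    fix e assume "e \<in> pruned_edges [m] (length [m])"
    then obtain \<sigma> where \<sigma>: "e = {\<sigma>, insert 0 \<sigma>}" "\<sigma> \<subseteq> {..<Suc 0}" "0 \<notin> \<sigma>"
      "face_lcm [m] \<sigma> = face_lcm [m] (insert 0 \<sigma>)" by auto
    then have "\<sigma> = {}" by auto
    then show "e \<in> ?E" using \<sigma>(1,4) eq by simp
  next
    fix e assume e: "e \<in> ?E"
    then have "m = 0" by (simp split: if_splits)
    then have "{} \<subseteq> {..<length [m]} \<and> 0 \<notin> {} \<and> face_lcm [m] {} = face_lcm [m] (insert 0 {}) \<and>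
        {} \<notin> \<Union> (pruned_edges [m] 0) \<and> insert 0 {} \<notin> \<Union> (pruned_edges [m] 0)"
      using eq by simp
    moreover have "e = {{}, insert 0 {}}" using e \<open>m = 0\<close> by simp
    ultimately have "e \<in> pruned_edges [m] (Suc 0)"
      unfolding pruned_edges.simps(2) by blast
    then show "e \<in> pruned_edges [m] (length [m])" by simp
  qed
  show ?thesis unfolding critical_faces_def edges using faces by (cases "m = 0") simp_all
qed

lemma minimal_pruned_empty: "minimal_pruned (Mon {} :: ('v::finite, 'k::field) mpoly set) []"
  unfolding minimal_pruned_def
proof (intro conjI allI)
  fix i and \<alpha> :: "'v expo"
  have U: "{t. divides 0 t} - {} = (UNIV - {} :: 'v expo set)" by auto
  \<comment> \<open>The quotient by the zero ideal is the ring, which is also the principal ideal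
    generated by 1.\<close>
  have "gcx (UNIV - {} :: 'v expo set) (\<lambda>i. if i \<le> 1 then {0} else {}) (\<lambda>i c. 0)
      (\<lambda>i r c. if i = 0 \<and> r = 0 \<and> c = 0 then 1 else (0 :: 'k))"
    using gcx_principal[of "0 :: 'v expo"] by simp
  from betti_eq_card[OF this upset_UNIV upset_empty empty_subsetI, of i \<alpha>]
  have "betti_quotient (Mon {} :: ('v, 'k) mpoly set) i \<alpha> =
      card {c \<in> if Suc i \<le> 1 then {0::nat} else {}. 0 = \<alpha>}"
    by (simp add: Mon_UNIV)
  also have "{c \<in> if Suc i \<le> 1 then {0::nat} else {}. 0 = \<alpha>} = (if i = 0 \<and> \<alpha> = 0 then {0} else {})" by auto
  also have "card \<dots> = card (if i = 0 \<and> \<alpha> = 0 then {{} :: nat set} else {})" by simp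
  also have "(if i = 0 \<and> \<alpha> = 0 then {{} :: nat set} else {}) =
      {\<sigma> \<in> critical_faces ([] :: 'v expo list). card \<sigma> = i \<and> face_lcm [] \<sigma> = \<alpha>}"
    by (auto simp: critical_faces_Nil face_lcm_def lcm_expo_empty)
  finally show "pruned_rank [] i \<alpha> = betti_quotient (Mon {} :: ('v, 'k) mpoly set) i \<alpha>"
    by (simp add: pruned_rank_def)
qed (simp_all add: mingens_Mon minel_def)

lemma minimal_pruned_principal:
  "minimal_pruned (Mon {t. divides m t} :: ('v::finite, 'k::field) mpoly set) [m]"
  unfolding minimal_pruned_def
proof (intro conjI allI)
  fix i and \<alpha> :: "'v expo"
  show "pruned_rank [m] i \<alpha> = betti_quotient (Mon {t. divides m t} :: ('v, 'k) mpoly set) i \<alpha>"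
  proof (cases "m = 0")
    case True
    have "gcx (UNIV - {t :: 'v expo. divides m t}) (\<lambda>i. if i = 0 then {0} else {}) (\<lambda>i c. 0) (\<lambda>i r c. 0 :: 'k)"
      using gcx_zero True by simp
    from betti_eq_card[OF this upset_UNIV upset_principal subset_UNIV, of i \<alpha>]
    show ?thesis using True by (simp add: Mon_UNIV pruned_rank_def critical_faces_singleton)
  next
    case False
    from betti_eq_card[OF gcx_quotient_principal[OF False, where 'k = 'k] upset_UNIV upset_principal subset_UNIV, of i \<alpha>]
    have "betti_quotient (Mon {t. divides m t} :: ('v, 'k) mpoly set) i \<alpha> =
        card {c \<in> if Suc i \<le> 2 then {0::nat} else {}. (if Suc i = 2 then m else 0) = \<alpha>}"
      by (simp add: Mon_UNIV)
    also have "{c \<in> if Suc i \<le> 2 then {0::nat} else {}. (if Suc i = 2 then m else 0) = \<alpha>} =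
        (if i = 0 \<and> \<alpha> = 0 \<or> i = 1 \<and> \<alpha> = m then {0} else {})" by auto
    also have "card \<dots> = card (if i = 0 \<and> \<alpha> = 0 then {{}} else if i = 1 \<and> \<alpha> = m then {{0::nat}} else {})"
      by simp
    also have "(if i = 0 \<and> \<alpha> = 0 then {{}} else if i = 1 \<and> \<alpha> = m then {{0::nat}} else {}) =
        {\<sigma> \<in> critical_faces [m]. card \<sigma> = i \<and> face_lcm [m] \<sigma> = \<alpha>}"
      using False by (auto simp: critical_faces_singleton face_lcm_def lcm_expo_empty lcm_expo_singleton)
    finally show ?thesis by (simp add: pruned_rank_def)
  qed
qed (simp_all add: mingens_Mon minel_principal)

text \<open>Up-closed sets that are built from principal ones by splittings \<open>J \<union> K\<close> for which the map of
  resolutions over \<open>J \<inter> K\<close> has no unit entry, together with their multigraded Betti numbers.\<close>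

inductive spl :: "'v expo set \<Rightarrow> (nat \<Rightarrow> 'v expo \<Rightarrow> nat) \<Rightarrow> bool" where
  empty: "spl {} (\<lambda>i \<alpha>. 0)"
| principal: "spl {t. divides m t} (\<lambda>i \<alpha>. if i = 0 \<and> \<alpha> = m then 1 else 0)"
| split: "\<lbrakk> spl J bJ; spl K bK; spl (J \<inter> K) bA;
    \<And>y. y \<in> J \<inter> K \<Longrightarrow> y \<notin> minel J \<and> y \<notin> minel K;
    \<And>i \<alpha>. bA i \<alpha> \<noteq> 0 \<Longrightarrow>
      (bJ i \<alpha> = 0 \<or> vanish (J \<inter> K) J \<alpha>) \<and> (bK i \<alpha> = 0 \<or> vanish (J \<inter> K) K \<alpha>) \<rbrakk>
  \<Longrightarrow> spl (J \<union> K) (\<lambda>i \<alpha>. bJ i \<alpha> + bK i \<alpha> + (if i = 0 then 0 else bA (i - 1) \<alpha>))"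

lemma spl_upset: "spl S b \<Longrightarrow> upset S"
  by (induction rule: spl.induct) (auto intro: upset_empty upset_principal upset_Un)

text \<open>The two conclusions go together because a Betti splitting refers to the Betti numbers of
  all parts. The clause of \<open>spl\<close> on minimal generators makes those of the union a
  disjoint union: a minimal generator of one part lies outside the other part, so nothing in the
  latter divides it.\<close>

lemma spl_admits:
  "spl S b \<Longrightarrow> has_res TYPE('k::field) S b \<and> admits_minimal_pruned (Mon S :: ('v::finite, 'k) mpoly set)"
proof (induction rule: spl.induct)
  case empty
  have "monomial_ideal (Mon {} :: ('v, 'k) mpoly set)" using monomial_ideal_iff upset_empty by blast
  then show ?case by (intro conjI has_res_empty admits_minimal_pruned.pruned[OF _ minimal_pruned_empty])
next
  case (principal m)
  have "monomial_ideal (Mon {t. divides m t} :: ('v, 'k) mpoly set)"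
    using monomial_ideal_iff upset_principal by blast
  then show ?case by (intro conjI has_res_principal admits_minimal_pruned.pruned[OF _ minimal_pruned_principal])
next
  case (split J bJ K bK bA)
  have up: "upset J" "upset K" using spl_upset split.hyps by blast+
  have res: "has_res TYPE('k) (J \<union> K) (\<lambda>i \<alpha>. bJ i \<alpha> + bK i \<alpha> + (if i = 0 then 0 else bA (i - 1) \<alpha>))"
    by (rule has_res_split[OF split.IH(1)[THEN conjunct1] split.IH(2)[THEN conjunct1]
          split.IH(3)[THEN conjunct1] up split.hyps(5)])
  have min: "minel (J \<union> K) = minel J \<union> minel K" "minel J \<inter> minel K = {}"
  proof -
    have not_min: "y \<notin> minel J" "y \<notin> minel K" if "y \<in> J" "y \<in> K" for y
      using split.hyps(4)[of y] that by simp_all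
    have mJ: "y \<in> J" if "y \<in> minel J" for y using that by (simp add: minel_def)
    have mK: "y \<in> K" if "y \<in> minel K" for y using that by (simp add: minel_def)
    show "minel J \<inter> minel K = {}" using not_min mJ mK by blast
    show "minel (J \<union> K) = minel J \<union> minel K"
    proof (intro equalityI subsetI)
      fix y assume "y \<in> minel (J \<union> K)"
      then show "y \<in> minel J \<union> minel K" by (auto simp: minel_def)
    next
      fix y assume "y \<in> minel J \<union> minel K"
      then consider "y \<in> minel J" "y \<notin> K" | "y \<in> minel K" "y \<notin> J" using not_min mJ mK by blast
      then show "y \<in> minel (J \<union> K)"
      proof cases
        case 1
        then have "t \<notin> K" if "divides t y" for t using upsetD[OF up(2) _ that] by blast
        then show ?thesis using 1 by (auto simp: minel_def)
      next
        case 2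
        then have "t \<notin> J" if "divides t y" for t using upsetD[OF up(1) _ that] by blast
        then show ?thesis using 2 by (auto simp: minel_def)
      qed
    qed
  qed
  have "betti_splitting (Mon (J \<union> K)) (Mon J :: ('v, 'k) mpoly set) (Mon K)"
    unfolding betti_splitting_def
  proof (intro conjI allI)
    show "monomial_ideal (Mon J :: ('v, 'k) mpoly set)" "monomial_ideal (Mon K :: ('v, 'k) mpoly set)"
      using up monomial_ideal_iff by blast+
    show "Mon (J \<union> K) = ideal_sum (Mon J :: ('v, 'k) mpoly set) (Mon K)" by (simp add: ideal_sum_Mon)
    show "mingens (Mon (J \<union> K) :: ('v, 'k) mpoly set) = mingens (Mon J :: ('v, 'k) mpoly set) \<union> mingens (Mon K :: ('v, 'k) mpoly set)"
      "mingens (Mon J :: ('v, 'k) mpoly set) \<inter> mingens (Mon K :: ('v, 'k) mpoly set) = {}"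
      using min by (simp_all add: mingens_Mon)
    show "betti_ideal (Mon (J \<union> K) :: ('v, 'k) mpoly set) i \<alpha> =
        betti_ideal (Mon J :: ('v, 'k) mpoly set) i \<alpha> + betti_ideal (Mon K :: ('v, 'k) mpoly set) i \<alpha> +
        (if i = 0 then 0 else betti_ideal (Mon J \<inter> Mon K :: ('v, 'k) mpoly set) (i - 1) \<alpha>)" for i \<alpha>
      unfolding Mon_Int
        betti_ideal_eq[OF upset_Un[OF up] res] betti_ideal_eq[OF up(1) split.IH(1)[THEN conjunct1]]
        betti_ideal_eq[OF up(2) split.IH(2)[THEN conjunct1]]
        betti_ideal_eq[OF upset_Int[OF up] split.IH(3)[THEN conjunct1]] by (rule refl)
  qed
  then have "admits_minimal_pruned (Mon (J \<union> K) :: ('v, 'k) mpoly set)"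
    by (rule admits_minimal_pruned.splitting[OF _ split.IH(1)[THEN conjunct2] split.IH(2)[THEN conjunct2]
          split.IH(3)[THEN conjunct2, folded Mon_Int]])
  with res show ?case by (rule conjI)
qed

lemma vanish_shift:
  assumes "vanish A J \<beta>"
  shows "vanish ((+) n ` A) ((+) n ` J) (n + \<beta>)"
proof -
  obtain z where z: "expo_at \<beta> z > 0"
    and zJ: "\<And>y. y \<in> A \<Longrightarrow> divides y \<beta> \<Longrightarrow> expo_at y z = expo_at \<beta> z \<Longrightarrow> y - pow z 1 \<in> J"
    using assms unfolding vanish_def by blast
  have "n + y - pow z 1 \<in> (+) n ` J"
    if y: "y \<in> A" "divides (n + y) (n + \<beta>)" "expo_at (n + y) z = expo_at (n + \<beta>) z" for y
  proof -
    have yz: "expo_at y z = expo_at \<beta> z" using y(3) by (simp add: lookup_add)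
    have "divides y \<beta>" using y(2) by (simp add: divides_iff lookup_add)
    then have "y - pow z 1 \<in> J" using zJ y(1) yz by blast
    moreover have "n + y - pow z 1 = n + (y - pow z 1)"
      using yz z by (intro poly_mapping_eqI) (auto simp: lookup_add lookup_minus lookup_single when_def)
    ultimately show ?thesis by blast
  qed
  moreover have "expo_at (n + \<beta>) z > 0" using z by (simp add: lookup_add)
  ultimately show ?thesis unfolding vanish_def by (intro exI[of _ z]) auto
qed

lemma minel_shift: "n + y \<in> minel ((+) n ` J) \<Longrightarrow> y \<in> minel J"
  unfolding minel_def by (auto simp: divides_iff lookup_add)

text \<open>Multiplication by a monomial translates all labels and leaves the tree of splittings
  unchanged, \<open>vanish\<close> being invariant under translation.\<close>

lemma spl_shift: "spl S b \<Longrightarrow> spl ((+) n ` S) (\<lambda>i \<alpha>. if divides n \<alpha> then b i (\<alpha> - n) else 0)"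
proof (induction rule: spl.induct)
  case empty
  have "(\<lambda>i \<alpha>. if divides n \<alpha> then 0 else 0) = (\<lambda>(i::nat) \<alpha>. 0::nat)" by (intro ext) simp
  then show ?case using spl.empty by simp
next
  case (principal m)
  have 1: "(+) n ` {t. divides m t} = {t. divides (n + m) t}"
  proof (intro equalityI subsetI)
    fix t assume "t \<in> {t. divides (n + m) t}"
    then obtain u where "t = n + (m + u)" by (auto simp: divides_def add.assoc)
    then show "t \<in> (+) n ` {t. divides m t}" by simp
  qed (auto simp: divides_iff lookup_add)
  have "(if divides n \<alpha> then if i = 0 \<and> \<alpha> - n = m then 1 else 0 else 0) = (if i = 0 \<and> \<alpha> = n + m then 1 else 0 :: nat)"
    for i :: nat and \<alpha>
    using add_minus_divides[of n \<alpha>] by auto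
  then show ?case unfolding 1 using spl.principal[of "n + m"] by simp
next
  case (split J bJ K bK bA)
  let ?s = "\<lambda>b i \<alpha>. if divides n \<alpha> then b i (\<alpha> - n) else (0::nat)"
  have Int: "(+) n ` J \<inter> (+) n ` K = (+) n ` (J \<inter> K)" by auto
  have "spl ((+) n ` J \<union> (+) n ` K)
      (\<lambda>i \<alpha>. ?s bJ i \<alpha> + ?s bK i \<alpha> + (if i = 0 then 0 else ?s bA (i - 1) \<alpha>))"
  proof (rule spl.split)
    show "spl ((+) n ` J) (?s bJ)" "spl ((+) n ` K) (?s bK)" "spl ((+) n ` J \<inter> (+) n ` K) (?s bA)"
      using split.IH Int by simp_all
    show "y \<notin> minel ((+) n ` J) \<and> y \<notin> minel ((+) n ` K)" if "y \<in> (+) n ` J \<inter> (+) n ` K" for y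
      using that split.hyps(4) minel_shift unfolding Int by blast
    show "(?s bJ i \<alpha> = 0 \<or> vanish ((+) n ` J \<inter> (+) n ` K) ((+) n ` J) \<alpha>) \<and>
        (?s bK i \<alpha> = 0 \<or> vanish ((+) n ` J \<inter> (+) n ` K) ((+) n ` K) \<alpha>)"
      if nz: "?s bA i \<alpha> \<noteq> 0" for i \<alpha>
    proof -
      have n: "divides n \<alpha>" "bA i (\<alpha> - n) \<noteq> 0" using nz by (auto split: if_splits)
      show ?thesis using split.hyps(5)[OF n(2)] vanish_shift[of "J \<inter> K" _ "\<alpha> - n" n] n(1)
        unfolding Int by (auto simp: add_minus_divides)
    qed
  qed
  moreover have "(\<lambda>i \<alpha>. ?s bJ i \<alpha> + ?s bK i \<alpha> + (if i = 0 then 0 else ?s bA (i - 1) \<alpha>)) =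
      (\<lambda>i \<alpha>. if divides n \<alpha> then bJ i (\<alpha> - n) + bK i (\<alpha> - n) + (if i = 0 then 0 else bA (i - 1) (\<alpha> - n)) else 0)"
    by (intro ext) simp
  ultimately show ?case by (simp add: image_Un)
qed

lemma spl_support: "spl S b \<Longrightarrow> b i \<alpha> \<noteq> 0 \<Longrightarrow> \<alpha> \<in> S"
  by (induction arbitrary: i \<alpha> rule: spl.induct) (auto split: if_splits)

section \<open>Linear quotients\<close>

lemma divides_add_pow: "divides (m + pow x 1) t \<longleftrightarrow> divides m t \<and> expo_at m x < expo_at t x"
proof -
  have "(\<forall>v. expo_at m v + (if x = v then 1 else 0) \<le> expo_at t v) \<longleftrightarrow>
      (\<forall>v. expo_at m v \<le> expo_at t v) \<and> expo_at m x < expo_at t x"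
    by (metis (full_types) add.right_neutral add_leD1 add_lessD1 less_eq_Suc_le Suc_eq_plus1)
  then show ?thesis unfolding divides_iff lookup_add lookup_single when_def .
qed

lemmas divides_add_pow' = divides_add_pow[unfolded One_nat_def]

lemma sum3_neq_0: "(a::nat) + (if P then 1 else 0) + (if i = 0 then 0 else b) \<noteq> 0 \<Longrightarrow>
    a \<noteq> 0 \<or> P \<or> i \<noteq> (0::nat) \<and> b \<noteq> 0"
  by (auto split: if_splits)

lemma upc_empty: "upc {} = {}"
  by (simp add: upc_def)

text \<open>When \<open>x\<close> is added, the intersection is of the same kind with
  \<open>m\<close> replaced by \<open>m + pow x 1\<close>. In each homological degree its labels
  have total degree one more than those of the two parts, so no multidegree is shared and
  \<open>vanish\<close> is not called upon.\<close>

lemma spl_variables: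
  fixes m :: "('v::finite) expo"
  shows "\<exists>b. spl {t. \<exists>x\<in>V. divides (m + pow x 1) t} b \<and>
    (\<forall>i \<alpha>. b i \<alpha> \<noteq> 0 \<longrightarrow> total_deg \<alpha> = total_deg m + i + 1)"
proof -
  have "finite V" by simp
  then show ?thesis
  proof (induction V arbitrary: m rule: finite_induct)
    case empty
    have "{t. \<exists>x\<in>{}. divides (m + pow x 1) t} = {}" by simp
    then show ?case using spl.empty by (intro exI[of _ "\<lambda>i \<alpha>. 0"]) simp
  next
    case (insert x V)
    let ?J = "{t. \<exists>y\<in>V. divides (m + pow y 1) t}" and ?K = "{t. divides (m + pow x 1) t}"
    let ?bK = "\<lambda>i \<alpha>. if i = 0 \<and> \<alpha> = m + pow x 1 then 1 else (0::nat)"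
    obtain bJ where bJ: "spl ?J bJ" "\<And>i \<alpha>. bJ i \<alpha> \<noteq> 0 \<Longrightarrow> total_deg \<alpha> = total_deg m + i + 1"
      using insert.IH[of m] by blast
    have IntA: "{t. \<exists>y\<in>V. divides (m + pow x 1 + pow y 1) t} = ?J \<inter> ?K"
      using insert.hyps(2) by (auto simp: divides_add_pow' lookup_add lookup_single when_def)
    obtain bA where bA: "spl (?J \<inter> ?K) bA"
      "\<And>i \<alpha>. bA i \<alpha> \<noteq> 0 \<Longrightarrow> total_deg \<alpha> = total_deg (m + pow x 1) + i + 1"
      using insert.IH[of "m + pow x 1"] unfolding IntA by blast
    have "spl (?J \<union> ?K) (\<lambda>i \<alpha>. bJ i \<alpha> + ?bK i \<alpha> + (if i = 0 then 0 else bA (i - 1) \<alpha>))"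
    proof (rule spl.split[OF bJ(1) spl.principal bA(1)])
      fix y assume y: "y \<in> ?J \<inter> ?K"
      have "y \<notin> minel ?J"
      proof
        assume "y \<in> minel ?J"
        then obtain z where z: "z \<in> V" "y = m + pow z 1"
          using minel_upc_subset[of "(\<lambda>z. m + pow z 1) ` V"] by (auto simp: upc_def)
        have "expo_at m x < expo_at (m + pow z 1) x" using y z(2) by (simp add: divides_add_pow')
        then show False using z(1) insert.hyps(2) by (auto simp: lookup_add lookup_single when_def split: if_splits)
      qed
      moreover have "y \<notin> minel ?K"
        using y insert.hyps(2) unfolding minel_principal
        by (auto simp: divides_add_pow' lookup_add lookup_single when_def split: if_splits)
      ultimately show "y \<notin> minel ?J \<and> y \<notin> minel ?K" ..
    next
      fix i \<alpha> assume "bA i \<alpha> \<noteq> 0"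
      then have "total_deg \<alpha> = total_deg m + i + 2" using bA(2) by (simp add: total_deg_add total_deg_pow)
      then have "bJ i \<alpha> = 0 \<and> ?bK i \<alpha> = 0"
        using bJ(2)[of i \<alpha>] by (auto simp: total_deg_add total_deg_pow)
      then show "(bJ i \<alpha> = 0 \<or> vanish (?J \<inter> ?K) ?J \<alpha>) \<and> (?bK i \<alpha> = 0 \<or> vanish (?J \<inter> ?K) ?K \<alpha>)" by simp
    qed
    moreover have "?J \<union> ?K = {t. \<exists>y\<in>insert x V. divides (m + pow y 1) t}" by auto
    moreover have "total_deg \<alpha> = total_deg m + i + 1"
      if nz: "bJ i \<alpha> + ?bK i \<alpha> + (if i = 0 then 0 else bA (i - 1) \<alpha>) \<noteq> 0" for i \<alpha>
    proof -
      consider "bJ i \<alpha> \<noteq> 0" | "i = 0" "\<alpha> = m + pow x 1" | "i \<noteq> 0" "bA (i - 1) \<alpha> \<noteq> 0"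
        using sum3_neq_0[OF nz] by blast
      then show ?thesis
        using bJ(2)[of i \<alpha>] bA(2)[of "i - 1" \<alpha>] by cases (auto simp: total_deg_add total_deg_pow)
    qed
    ultimately show ?case by (intro exI) auto
  qed
qed

text \<open>The colon of the ideal of \<open>A\<close> by \<open>m\<close> is generated by
  variables, said on exponents: \<open>x\<close> lies in the colon, and it divides \<open>m'\<close>
  after division by the gcd of \<open>m'\<close> and \<open>m\<close>.\<close>

definition lin_quot :: "'v expo set \<Rightarrow> 'v expo \<Rightarrow> bool" where
  "lin_quot A m \<longleftrightarrow> (\<forall>m'\<in>A. \<exists>m''\<in>A. \<exists>x. divides m'' (m + pow x 1) \<and> expo_at m x < expo_at m' x)"

text \<open>Degrees do not decrease along \<open>f\<close>. Hence in homological degree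
  \<open>i\<close> the earlier generators give labels of total degree at most
  \<open>total_deg m + i\<close>, whereas the intersection with the new principal ideal sits in
  total degree \<open>total_deg m + i + 1\<close>. The degree bound is part of the conclusion so
  that the induction can use it.\<close>

lemma spl_lin_quot_sorted:
  fixes f :: "('v::finite) expo \<Rightarrow> nat"
  assumes "finite G" "inj_on f G"
    and "\<And>m m'. m \<in> G \<Longrightarrow> m' \<in> G \<Longrightarrow> divides m m' \<Longrightarrow> m = m'"
    and "\<And>m. m \<in> G \<Longrightarrow> lin_quot {m' \<in> G. f m' < f m} m"
    and "\<And>m m'. m \<in> G \<Longrightarrow> m' \<in> G \<Longrightarrow> f m' < f m \<Longrightarrow> total_deg m' \<le> total_deg m"
  shows "\<exists>b. spl (upc G) b \<and> (\<forall>i \<alpha>. b i \<alpha> \<noteq> 0 \<longrightarrow> (\<exists>m\<in>G. total_deg \<alpha> \<le> total_deg m + i))"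
  using assms
proof (induction rule: finite_ranking_induct[where f = f])
  case empty
  show ?case by (intro exI[of _ "\<lambda>i \<alpha>. 0"]) (simp add: upc_empty spl.empty)
next
  case (insert m G)
  show ?case
  proof (cases "m \<in> G")
    case True
    then have "insert m G = G" by (rule insert_absorb)
    then show ?thesis using insert.IH insert.prems by simp
  next
    case m: False
    have lt: "f m' < f m" if "m' \<in> G" for m'
    proof -
      have "f m' \<noteq> f m" using inj_onD[OF insert.prems(1), of m' m] that m by blast
      then show ?thesis using insert.hyps(2)[OF that] by simp
    qed
    have G: "{m' \<in> insert m G. f m' < f m} = G" using lt by auto
    have before: "{m' \<in> insert m G. f m' < f n} = {m' \<in> G. f m' < f n}" if "n \<in> G" for n
      using lt[OF that] by auto
    have "\<exists>b. spl (upc G) b \<and> (\<forall>i \<alpha>. b i \<alpha> \<noteq> 0 \<longrightarrow> (\<exists>m\<in>G. total_deg \<alpha> \<le> total_deg m + i))"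
    proof (rule insert.IH)
      show "inj_on f G" using insert.prems(1) by (simp add: inj_on_insert)
      show "n = n'" if "n \<in> G" "n' \<in> G" "divides n n'" for n n' using insert.prems(2) that by blast
      show "lin_quot {m' \<in> G. f m' < f n} n" if "n \<in> G" for n
        using insert.prems(3)[of n] before[OF that] that by simp
      show "total_deg n' \<le> total_deg n" if "n \<in> G" "n' \<in> G" "f n' < f n" for n n'
        using insert.prems(4) that by blast
    qed
    then obtain bJ where bJ: "spl (upc G) bJ"
      "\<And>i \<alpha>. bJ i \<alpha> \<noteq> 0 \<Longrightarrow> \<exists>m\<in>G. total_deg \<alpha> \<le> total_deg m + i" by blast
    have le: "total_deg n \<le> total_deg m" if "n \<in> G" for n
      using insert.prems(4)[of m n] lt[OF that] that by blast
    let ?K = "{t. divides m t}"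
    let ?bK = "\<lambda>i \<alpha>. if i = 0 \<and> \<alpha> = m then 1 else (0::nat)"
    define V where "V = {x. \<exists>n\<in>G. divides n (m + pow x 1)}"
    have lq: "lin_quot G m" using insert.prems(3)[of m] G by simp
    \<comment> \<open>The condition \<open>lin_quot\<close> is what makes the intersection equal to
      \<open>m\<close> times an ideal generated by variables.\<close>
    have A: "{t. \<exists>x\<in>V. divides (m + pow x 1) t} = upc G \<inter> ?K"
    proof (intro equalityI subsetI)
      fix t assume "t \<in> {t. \<exists>x\<in>V. divides (m + pow x 1) t}"
      then obtain x n where "divides (m + pow x 1) t" "n \<in> G" "divides n (m + pow x 1)"
        unfolding V_def by blast
      then have "divides n t" "divides m t"
        using divides_trans[of n _ t] divides_trans[OF divides_add(1), of m "pow x 1" t] by blast+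
      then show "t \<in> upc G \<inter> ?K" using \<open>n \<in> G\<close> unfolding upc_def by blast
    next
      fix t assume "t \<in> upc G \<inter> ?K"
      then obtain n where n: "n \<in> G" "divides n t" "divides m t" by (auto simp: upc_def)
      obtain n' x where x: "n' \<in> G" "divides n' (m + pow x 1)" "expo_at m x < expo_at n x"
        using lq n(1) unfolding lin_quot_def by blast
      have "expo_at n x \<le> expo_at t x" using n(2) by (simp add: divides_iff)
      then have "divides (m + pow x 1) t" using n(3) x(3) by (simp add: divides_add_pow')
      then show "t \<in> {t. \<exists>x\<in>V. divides (m + pow x 1) t}" using x(1,2) unfolding V_def by blast
    qed
    obtain bA where bA: "spl (upc G \<inter> ?K) bA"
      "\<And>i \<alpha>. bA i \<alpha> \<noteq> 0 \<Longrightarrow> total_deg \<alpha> = total_deg m + i + 1"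
      using spl_variables[of V m] unfolding A by blast
    have "spl (upc G \<union> ?K) (\<lambda>i \<alpha>. bJ i \<alpha> + ?bK i \<alpha> + (if i = 0 then 0 else bA (i - 1) \<alpha>))"
    proof (rule spl.split[OF bJ(1) spl.principal bA(1)])
      fix y assume y: "y \<in> upc G \<inter> ?K"
      then obtain n where n: "n \<in> G" "divides n y" by (auto simp: upc_def)
      have "y \<notin> G" using y insert.prems(2)[of m y] m by blast
      then have "y \<notin> minel (upc G)" using minel_upc_subset by blast
      moreover have "y \<noteq> m" using n insert.prems(2)[of n m] m by blast
      ultimately show "y \<notin> minel (upc G) \<and> y \<notin> minel ?K" by (simp add: minel_principal)
    next
      fix i \<alpha> assume "bA i \<alpha> \<noteq> 0"
      then have deg: "total_deg \<alpha> = total_deg m + i + 1" by (rule bA(2))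
      have "bJ i \<alpha> = 0"
      proof (rule ccontr)
        assume "bJ i \<alpha> \<noteq> 0"
        then obtain n where "n \<in> G" "total_deg \<alpha> \<le> total_deg n + i" using bJ(2) by blast
        then show False using le[of n] deg by simp
      qed
      moreover have "?bK i \<alpha> = 0" using deg by auto
      ultimately show "(bJ i \<alpha> = 0 \<or> vanish (upc G \<inter> ?K) (upc G) \<alpha>) \<and> (?bK i \<alpha> = 0 \<or> vanish (upc G \<inter> ?K) ?K \<alpha>)"
        by simp
    qed
    moreover have "upc G \<union> ?K = upc (insert m G)" by (auto simp: upc_def)
    moreover have "\<exists>n\<in>insert m G. total_deg \<alpha> \<le> total_deg n + i"
      if nz: "bJ i \<alpha> + ?bK i \<alpha> + (if i = 0 then 0 else bA (i - 1) \<alpha>) \<noteq> 0" for i \<alpha>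
    proof -
      consider "bJ i \<alpha> \<noteq> 0" | "i = 0" "\<alpha> = m" | "i \<noteq> 0" "bA (i - 1) \<alpha> \<noteq> 0"
        using sum3_neq_0[OF nz] by blast
      then show ?thesis
        using bJ(2)[of i \<alpha>] bA(2)[of "i - 1" \<alpha>] by cases auto
    qed
    ultimately show ?thesis by (intro exI) auto
  qed
qed

definition lin_quot_list :: "'v expo list \<Rightarrow> bool" where
  "lin_quot_list ms \<longleftrightarrow> (\<forall>i<length ms. lin_quot (set (take i ms)) (ms ! i))"

lemma lin_quot_list_Nil: "lin_quot_list []"
  by (simp add: lin_quot_list_def)

lemma lin_quot_list_snoc: "lin_quot_list (ms @ [m]) \<longleftrightarrow> lin_quot_list ms \<and> lin_quot (set ms) m"
  by (auto simp: lin_quot_list_def nth_append less_Suc_eq)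

text \<open>Ordering the generators by degree first preserves linear quotients. The proof follows
  Jahan and Zheng: a generator of smaller degree that comes later imposes no new condition.\<close>

lemma spl_lin_quot_list:
  fixes ms :: "('v::finite) expo list"
  assumes "distinct ms" and anti: "\<And>m m'. m \<in> set ms \<Longrightarrow> m' \<in> set ms \<Longrightarrow> divides m m' \<Longrightarrow> m = m'"
    and lq: "lin_quot_list ms"
  shows "\<exists>b. spl (upc (set ms)) b"
proof -
  let ?n = "length ms" and ?m = "\<lambda>i. ms ! i"
  have inj: "i = j" if "i < ?n" "j < ?n" "divides (?m i) (?m j)" for i j
    using anti[of "?m i" "?m j"] that nth_eq_iff_index_eq[OF assms(1), of i j] by simp
  have R: "\<exists>k<i. \<exists>x. divides (?m k) (?m i + pow x 1) \<and> expo_at (?m i) x < expo_at (?m j) x"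
    if ij: "j < i" "i < ?n" for i j
  proof -
    have "?m j \<in> set (take i ms)" using ij by (auto simp: in_set_conv_nth)
    then obtain m'' x where "m'' \<in> set (take i ms)" "divides m'' (?m i + pow x 1)"
      "expo_at (?m i) x < expo_at (?m j) x"
      using lq[unfolded lin_quot_list_def lin_quot_def, rule_format, OF ij(2)] by metis
    moreover from this(1) obtain k where "k < i" "m'' = ?m k" using ij by (auto simp: in_set_conv_nth)
    ultimately show ?thesis by blast
  qed
  \<comment> \<open>If the degree of \<open>?m k\<close> were larger, \<open>?m k\<close> would be
    \<open>?m i\<close> times \<open>x\<close>, against minimality of the generators.\<close>
  have deg: "total_deg (?m k) \<le> total_deg (?m i)"
    if "divides (?m k) (?m i + pow x 1)" "k < ?n" "i < ?n" "k \<noteq> i" for k i x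
  proof (rule ccontr)
    assume "\<not> ?thesis"
    then have "total_deg (?m i + pow x 1) \<le> total_deg (?m k)" by (simp add: total_deg_add total_deg_pow)
    then have "?m k = ?m i + pow x 1" using divides_eqI_total_deg that(1) by blast
    then show False using inj[of i k] that divides_add(1)[of "?m i" "pow x 1"] by auto
  qed
  have C: "\<exists>k<i. \<exists>x. divides (?m k) (?m i + pow x 1) \<and> expo_at (?m i) x < expo_at (?m j) x"
    if "j < ?n" "i < ?n" "j < i \<or> i < j \<and> total_deg (?m j) < total_deg (?m i)" for i j
    using that
  proof (induction j rule: less_induct)
    case (less j)
    show ?case
    proof (cases "j < i")
      case True
      then show ?thesis using R less.prems by blast
    next
      case False
      then have j: "i < j" "total_deg (?m j) < total_deg (?m i)" using less.prems by auto
      obtain k x where k: "k < j" "divides (?m k) (?m j + pow x 1)" "expo_at (?m j) x < expo_at (?m i) x"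
        using R[OF j(1) less.prems(1)] by blast
      have dk: "total_deg (?m k) \<le> total_deg (?m j)" using deg[OF k(2)] k(1) less.prems by simp
      then have "k \<noteq> i" using j by auto
      then have "k < i \<or> i < k \<and> total_deg (?m k) < total_deg (?m i)" using j dk by linarith
      then have "\<exists>k'<i. \<exists>x'. divides (?m k') (?m i + pow x' 1) \<and> expo_at (?m i) x' < expo_at (?m k) x'"
        using less.IH[OF k(1) _ less.prems(2)] k(1) less.prems(1) by simp
      then obtain k' x' where k': "k' < i" "divides (?m k') (?m i + pow x' 1)"
        "expo_at (?m i) x' < expo_at (?m k) x'" by blast
      \<comment> \<open>The variable \<open>x'\<close> differs from \<open>x\<close>: otherwise its
        exponent would grow by at least two from \<open>?m j\<close> to \<open>?m k\<close>,
        although \<open>?m k\<close> divides \<open>?m j\<close> times \<open>x\<close>. So the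
        inequality for \<open>?m k\<close> passes to \<open>?m j\<close>.\<close>
      have "expo_at (?m k) x' \<le> expo_at (?m j) x' + (if x = x' then 1 else 0)"
        using k(2) by (auto simp: divides_iff lookup_add lookup_single when_def dest: spec[of _ x'])
      then have "expo_at (?m i) x' < expo_at (?m j) x'" using k'(3) k(3) by (auto split: if_splits)
      then show ?thesis using k' by blast
    qed
  qed
  have "\<forall>m\<in>set ms. \<exists>i<?n. ?m i = m" by (auto simp: in_set_conv_nth)
  then have "\<exists>idx. \<forall>m\<in>set ms. idx m < ?n \<and> ?m (idx m) = m" by (intro bchoice) blast
  then obtain idx where idx: "\<And>m. m \<in> set ms \<Longrightarrow> idx m < ?n \<and> ?m (idx m) = m" by blast
  \<comment> \<open>Sorts by total degree and then by the old position; the two do not interfere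
    because \<open>idx m < ?n\<close>.\<close>
  define f where "f m = total_deg m * ?n + idx m" for m
  have f_less: "total_deg m' < total_deg m \<or> total_deg m' = total_deg m \<and> idx m' < idx m"
    if "f m' < f m" "m \<in> set ms" "m' \<in> set ms" for m m'
  proof (rule ccontr)
    assume *: "\<not> ?thesis"
    show False
    proof (cases "total_deg m < total_deg m'")
      case True
      then have "Suc (total_deg m) * ?n \<le> total_deg m' * ?n" by (intro mult_le_mono1) simp
      then show False using that(1) idx[OF that(2)] by (simp add: f_def)
    next
      case False
      then show False using * that(1) by (simp add: f_def)
    qed
  qed
  have "\<exists>b. spl (upc (set ms)) b \<and> (\<forall>i \<alpha>. b i \<alpha> \<noteq> 0 \<longrightarrow> (\<exists>m\<in>set ms. total_deg \<alpha> \<le> total_deg m + i))"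
  proof (rule spl_lin_quot_sorted[where f = f])
    show "inj_on f (set ms)"
    proof
      fix m m' assume m: "m \<in> set ms" "m' \<in> set ms" "f m = f m'"
      have "idx m = f m mod ?n" "idx m' = f m' mod ?n" using idx m(1,2) by (simp_all add: f_def)
      then have "idx m = idx m'" unfolding m(3) by (rule trans[OF _ sym])
      then have "?m (idx m) = ?m (idx m')" by (rule arg_cong)
      moreover have "?m (idx m) = m" "?m (idx m') = m'" using idx[OF m(1)] idx[OF m(2)] by blast+
      ultimately show "m = m'" by (rule box_equals)
    qed
    show "total_deg m' \<le> total_deg m" if "m \<in> set ms" "m' \<in> set ms" "f m' < f m" for m m'
      using f_less[of m' m] that by auto
    show "lin_quot {m' \<in> set ms. f m' < f m} m" if m: "m \<in> set ms" for m
      unfolding lin_quot_def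
    proof
      fix m' assume "m' \<in> {m' \<in> set ms. f m' < f m}"
      then have m': "m' \<in> set ms" "f m' < f m" by auto
      have i: "idx m < ?n" "?m (idx m) = m" "idx m' < ?n" "?m (idx m') = m'"
        using idx[OF m] idx[OF m'(1)] by simp_all
      have "idx m' \<noteq> idx m" using i m' by auto
      then have "idx m' < idx m \<or> idx m < idx m' \<and> total_deg m' < total_deg m"
        using f_less[OF m'(2) m m'(1)] by auto
      then have "idx m' < idx m \<or> idx m < idx m' \<and> total_deg (?m (idx m')) < total_deg (?m (idx m))"
        unfolding i(2,4) .
      from C[OF i(3,1) this] obtain k x where k: "k < idx m" "divides (?m k) (m + pow x 1)"
        "expo_at m x < expo_at m' x" unfolding i(2,4) by blast
      have "total_deg (?m k) \<le> total_deg m" using deg[of k "idx m" x] k i by simp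
      moreover have "idx (?m k) = k"
        using idx[of "?m k"] k(1) i(1) nth_eq_iff_index_eq[OF assms(1), of "idx (?m k)" k] by simp
      moreover from calculation(1) have "total_deg (?m k) * ?n \<le> total_deg m * ?n" by (rule mult_le_mono1)
      ultimately have "f (?m k) < f m" using k(1) unfolding f_def by linarith
      then show "\<exists>m''\<in>{m' \<in> set ms. f m' < f m}. \<exists>x. divides m'' (m + pow x 1) \<and> expo_at m x < expo_at m' x"
        using k i by (intro bexI[of _ "?m k"]) auto
    qed
    show "m = m'" if "m \<in> set ms" "m' \<in> set ms" "divides m m'" for m m'
      using that by (rule anti)
  qed simp
  then show ?thesis by blast
qed

lemma linear_quotients_spl:
  assumes "linear_quotients (I :: ('v::finite, 'k::field) mpoly set)"
  shows "\<exists>S b. I = Mon S \<and> spl S b"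
proof -
  obtain S where S: "upset S" "I = Mon S"
    using assms unfolding linear_quotients_def monomial_ideal_iff by blast
  obtain ms where ms: "distinct ms" "set ms = minel S" and colon:
    "\<And>i. 1 \<le> i \<Longrightarrow> i < length ms \<Longrightarrow> \<exists>V. colon (ideal_gen (monom ` set (take i ms)) :: ('v, 'k) mpoly set)
      (monom (ms ! i)) = ideal_gen (var ` V)"
    using assms unfolding linear_quotients_def S(2) mingens_Mon by blast
  have "lin_quot (set (take i ms)) (ms ! i)" if i: "i < length ms" for i
  proof (cases "i = 0")
    case False
    then obtain V where "colon (ideal_gen (monom ` set (take i ms)) :: ('v, 'k) mpoly set)
      (monom (ms ! i)) = ideal_gen (var ` V)" using colon[of i] i by auto
    moreover have "(var ` V :: ('v, 'k) mpoly set) = monom ` (\<lambda>x. pow x 1) ` V" by (auto simp: var_def)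
    ultimately have "{t. ms ! i + t \<in> upc (set (take i ms))} = upc ((\<lambda>x. pow x 1) ` V)"
      unfolding ideal_gen_monom colon_Mon by (simp add: ideal_gen_monom Mon_cancel)
    then have V: "ms ! i + t \<in> upc (set (take i ms)) \<longleftrightarrow> (\<exists>x\<in>V. divides (pow x 1) t)" for t
      by (auto simp: upc_def set_eq_iff)
    show ?thesis
      unfolding lin_quot_def
    proof
      fix m' assume m': "m' \<in> set (take i ms)"
      \<comment> \<open>Truncated subtraction divides \<open>m'\<close> by its gcd with the
        generator. The result lies in the colon, so a variable of \<open>V\<close> divides
        it.\<close>
      have "divides m' (ms ! i + (m' - ms ! i))"
        unfolding divides_iff lookup_add lookup_minus by (intro allI) linarith
      then obtain x where x: "x \<in> V" "divides (pow x 1) (m' - ms ! i)"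
        using V[of "m' - ms ! i"] m' by (auto simp: upc_def)
      have "ms ! i + pow x 1 \<in> upc (set (take i ms))" using V x(1) divides_refl by blast
      then obtain m'' where "m'' \<in> set (take i ms)" "divides m'' (ms ! i + pow x 1)"
        by (auto simp: upc_def)
      moreover have "expo_at (ms ! i) x < expo_at m' x"
        using x(2) by (auto simp: divides_iff lookup_minus dest: spec[of _ x])
      ultimately show "\<exists>m''\<in>set (take i ms). \<exists>x. divides m'' (ms ! i + pow x 1) \<and> expo_at (ms ! i) x < expo_at m' x"
        by blast
    qed
  qed (simp add: lin_quot_def)
  then have "lin_quot_list ms" by (simp add: lin_quot_list_def)
  then have "\<exists>b. spl (upc (set ms)) b"
    using ms by (intro spl_lin_quot_list) (auto simp: minel_def)
  then show ?thesis using S ms(2) upc_minel by metis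
qed

section \<open>Vertex splittable ideals\<close>

lemma minel_image_add: "minel ((+) n ` S) = (+) n ` minel S"
  by (auto simp: minel_def divides_iff lookup_add)

text \<open>The generators divisible by the splitting variable \<open>i\<close> are listed before
  those of \<open>K\<close>. Since \<open>K\<close> is contained in \<open>J\<close>, a generator
  \<open>m\<close> of \<open>K\<close> is divisible by some generator \<open>n\<close> of
  \<open>J\<close>, so the shifted \<open>n\<close> divides \<open>m\<close> times \<open>i\<close>;
  as \<open>m\<close> is free of \<open>i\<close>, this one variable serves for all shifted
  generators. The clause on keys is carried along to know that \<open>m\<close> is free of
  \<open>i\<close>.\<close>

lemma vertex_splittable_lin_quot:
  "vertex_splittable V (I :: ('v::finite, 'k::field) mpoly set) \<Longrightarrow>
    \<exists>S ms. upset S \<and> I = Mon S \<and> (\<forall>m\<in>minel S. Poly_Mapping.keys m \<subseteq> V) \<and>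
      distinct ms \<and> set ms = minel S \<and> lin_quot_list ms"
proof (induction rule: vertex_splittable.induct)
  case (zero V)
  show ?case
    by (intro exI[of _ "{}"] exI[of _ "[]"]) (simp add: upset_empty Mon_empty minel_def lin_quot_list_Nil)
next
  case (whole V)
  have "minel UNIV = {0 :: 'v expo}" using minel_principal[of "0 :: 'v expo"] by simp
  moreover have "lin_quot_list [0 :: 'v expo]" using lin_quot_list_snoc[of "[]" 0]
    by (simp add: lin_quot_list_Nil lin_quot_def)
  ultimately show ?case
    by (intro exI[of _ UNIV] exI[of _ "[0]"]) (simp add: upset_UNIV Mon_UNIV)
next
  case (principal m V)
  have "lin_quot_list [m]" using lin_quot_list_snoc[of "[]" m]
    by (simp add: lin_quot_list_Nil lin_quot_def)
  moreover have "(ideal_gen {monom m} :: ('v, 'k) mpoly set) = Mon {t. divides m t}"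
    using ideal_gen_monom[where 'k = 'k, of "{m}"] by (simp add: upc_def)
  ultimately show ?case using principal
    by (intro exI[of _ "{t. divides m t}"] exI[of _ "[m]"]) (simp add: upset_principal minel_principal)
next
  case (split i V J K I)
  obtain SJ js where J: "upset SJ" "J = Mon SJ" "\<forall>m\<in>minel SJ. Poly_Mapping.keys m \<subseteq> V"
    "distinct js" "set js = minel SJ" "lin_quot_list js" using split.IH(1) by blast
  obtain SK ks where K: "upset SK" "K = Mon SK" "\<forall>m\<in>minel SK. Poly_Mapping.keys m \<subseteq> V - {i}"
    "distinct ks" "set ks = minel SK" "lin_quot_list ks" using split.IH(2) by blast
  let ?e = "pow i 1 :: 'v expo"
  let ?S = "(+) ?e ` SJ \<union> SK"
  have xJ: "(*) (var i) ` J = Mon ((+) ?e ` SJ)" unfolding J(2) var_def by (rule monom_mult_Mon)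
  have I: "I = Mon ?S" using split.hyps(4) unfolding xJ K(2) by (simp add: ideal_sum_Mon)
  have min: "minel ?S = (+) ?e ` minel SJ \<union> minel SK" "(+) ?e ` minel SJ \<inter> minel SK = {}"
    using split.hyps(6,7) unfolding I xJ K(2) mingens_Mon minel_image_add .
  have sub: "SK \<subseteq> SJ"
  proof
    fix s assume "s \<in> SK"
    then have "(monom s :: ('v, 'k) mpoly) \<in> J" using split.hyps(5) unfolding K(2) by (auto simp: monom_in_Mon)
    then show "s \<in> SJ" unfolding J(2) by (simp add: monom_in_Mon)
  qed
  have "upset ((+) ?e ` SJ)"
    unfolding upset_def
  proof (intro allI impI)
    fix s t assume "s \<in> (+) ?e ` SJ" "divides s t"
    then obtain s' u where "s' \<in> SJ" "t = ?e + (s' + u)" by (auto simp: divides_def add.assoc)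
    moreover from this have "s' + u \<in> SJ" using upsetD[OF J(1)] divides_add(1) by blast
    ultimately show "t \<in> (+) ?e ` SJ" by blast
  qed
  then have "upset ?S" using K(1) by (rule upset_Un)
  moreover have "\<forall>m\<in>minel ?S. Poly_Mapping.keys m \<subseteq> V"
  proof
    fix m assume "m \<in> minel ?S"
    then consider n where "n \<in> minel SJ" "m = ?e + n" | "m \<in> minel SK" unfolding min(1) by blast
    then show "Poly_Mapping.keys m \<subseteq> V"
    proof cases
      case 1
      then show ?thesis using J(3) split.hyps(1) keys_add[of ?e n] by fastforce
    next
      case 2
      then show ?thesis using K(3) by blast
    qed
  qed
  moreover have "distinct (map ((+) ?e) js @ ks)"
    using J(4,5) K(4,5) min(2) by (simp add: distinct_map inj_on_def)
  moreover have "set (map ((+) ?e) js @ ks) = minel ?S" using J(5) K(5) min(1) by simp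
  moreover have "lin_quot_list (map ((+) ?e) js @ ks)"
  proof -
    have js: "lin_quot_list (map ((+) ?e) js)"
      using J(6)
    proof (induction js rule: rev_induct)
      case (snoc m js)
      have "lin_quot (set js) m" using snoc.prems by (simp add: lin_quot_list_snoc)
      then have "lin_quot ((+) ?e ` set js) (?e + m)"
        unfolding lin_quot_def by (fastforce simp: divides_iff lookup_add add.assoc)
      then show ?case using snoc by (simp add: lin_quot_list_snoc)
    qed (simp add: lin_quot_list_Nil)
    have "lin_quot_list ks' \<Longrightarrow> set ks' \<subseteq> minel SK \<Longrightarrow> lin_quot_list (map ((+) ?e) js @ ks')" for ks'
    proof (induction ks' rule: rev_induct)
      case (snoc m ks')
      have lq: "lin_quot (set ks') m" and m: "m \<in> minel SK"
        using snoc.prems by (simp_all add: lin_quot_list_snoc)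
      have "m \<in> SJ" using m sub by (auto simp: minel_def)
      then obtain n where n: "n \<in> set js" "divides n m" using ex_minel J(5) by blast
      have mi: "expo_at m i = 0" using K(3) m by (force simp: in_keys_iff)
      have "lin_quot ((+) ?e ` set js \<union> set ks') m"
        unfolding lin_quot_def
      proof
        fix m' assume "m' \<in> (+) ?e ` set js \<union> set ks'"
        then consider "m' \<in> (+) ?e ` set js" | "m' \<in> set ks'" by blast
        then show "\<exists>m''\<in>(+) ?e ` set js \<union> set ks'. \<exists>x. divides m'' (m + pow x 1) \<and> expo_at m x < expo_at m' x"
        proof cases
          case 1
          then have "expo_at m i < expo_at m' i" using mi by (auto simp: lookup_add)
          moreover have "divides (?e + n) (m + pow i 1)" using n(2) by (simp add: divides_iff lookup_add)
          ultimately show ?thesis using n(1) by blast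
        next
          case 2
          then show ?thesis using lq unfolding lin_quot_def by blast
        qed
      qed
      then show ?case using snoc lin_quot_list_snoc[of "map ((+) ?e) js @ ks'" m] by (simp add: lin_quot_list_snoc)
    qed (use js in simp)
    then show ?thesis using K(5,6) by simp
  qed
  ultimately show ?case using I by blast
qed

lemma vertex_splittable_spl:
  assumes "vertex_splittable V (I :: ('v::finite, 'k::field) mpoly set)"
  shows "\<exists>S b. I = Mon S \<and> spl S b"
proof -
  obtain S ms where S: "upset S" "I = Mon S" "distinct ms" "set ms = minel S" "lin_quot_list ms"
    using vertex_splittable_lin_quot[OF assms] by blast
  then have "\<exists>b. spl (upc (set ms)) b"
    by (intro spl_lin_quot_list) (auto simp: minel_def)
  then show ?thesis using S(1,2,4) upc_minel by metis
qed

text \<open>If \<open>vanish\<close> holds throughout the intersection, the clause of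
  \<open>spl\<close> on minimal generators follows: at \<alpha> = \<open>y\<close> it exhibits a
  proper divisor of \<open>y\<close> inside the part.\<close>

lemma spl_split_vanish:
  assumes "spl J bJ" "spl K bK" "spl A bA" and A: "J \<inter> K = A"
    and van: "\<And>\<alpha>. \<alpha> \<in> A \<Longrightarrow> vanish A J \<alpha> \<and> vanish A K \<alpha>"
  shows "\<exists>b. spl (J \<union> K) b"
proof -
  have "y \<notin> minel S" if y: "y \<in> A" and S: "vanish A S y" for y S
  proof
    assume "y \<in> minel S"
    then have min: "\<And>t. t \<in> S \<Longrightarrow> divides t y \<Longrightarrow> t = y" by (simp add: minel_def)
    obtain z where "expo_at y z > 0" "y - pow z 1 \<in> S" using S y divides_refl unfolding vanish_def by blast
    moreover have "divides (y - pow z 1) y" by (simp add: divides_iff lookup_minus)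
    ultimately have "y - pow z 1 = y" using min by blast
    then have "expo_at (y - pow z 1) z = expo_at y z" by (rule arg_cong)
    then show False using \<open>expo_at y z > 0\<close> by (simp add: lookup_minus)
  qed
  then have nmin: "\<And>y. y \<in> J \<inter> K \<Longrightarrow> y \<notin> minel J \<and> y \<notin> minel K" using van A by blast
  have van': "\<And>i \<alpha>. bA i \<alpha> \<noteq> 0 \<Longrightarrow>
      (bJ i \<alpha> = 0 \<or> vanish (J \<inter> K) J \<alpha>) \<and> (bK i \<alpha> = 0 \<or> vanish (J \<inter> K) K \<alpha>)"
    using van spl_support[OF assms(3)] unfolding A by blast
  show ?thesis
    by (rule exI, rule spl.split[OF assms(1,2) assms(3)[folded A] nmin van'])
qed

section \<open>Operations on exponents\<close>

definition mk :: "('v::finite \<Rightarrow> nat) \<Rightarrow> 'v expo" where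
  "mk f = Abs_poly_mapping f"

lemma lookup_mk [simp]: "Poly_Mapping.lookup (mk f) = f"
  unfolding mk_def by (rule lookup_Abs_poly_mapping) simp

lemma lookup_pow: "Poly_Mapping.lookup (pow s k) v = (if v = s then k else 0)"
  by (simp add: lookup_single when_def)

text \<open>Additive notation for \<open>l\<close> times the \<open>q\<close>-th power of
  \<open>m\<close>.\<close>

definition comb :: "nat \<Rightarrow> ('v::finite) expo \<Rightarrow> 'v expo \<Rightarrow> 'v expo" where
  "comb q m l = mk (\<lambda>v. q * Poly_Mapping.lookup m v + Poly_Mapping.lookup l v)"

lemma lookup_comb: "Poly_Mapping.lookup (comb q m l) v = q * Poly_Mapping.lookup m v + Poly_Mapping.lookup l v"
  by (simp add: comb_def)

lemma comb_add: "comb q m (l + u) = comb q m l + u"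
  by (intro poly_mapping_eqI) (simp add: lookup_comb lookup_add)

lemma comb_zero: "comb q 0 l = l"
  by (intro poly_mapping_eqI) (simp add: lookup_comb)

text \<open>One factor \<open>s\<close> of the Frobenius part is worth \<open>q\<close> factors
  \<open>s\<close> of the ordinary part; the membership arguments below live on this trade.\<close>

lemma comb_add_pow: "comb q (m + pow s 1) l = comb q m (l + pow s q)"
  by (intro poly_mapping_eqI) (simp add: lookup_comb lookup_add lookup_pow distrib_left)

lemma minus_pow_add: "expo_at m s > 0 \<Longrightarrow> m - pow s 1 + pow s 1 = m"
  by (intro poly_mapping_eqI) (auto simp: lookup_add lookup_minus lookup_pow)

lemma comb_minus_pow: "expo_at m s > 0 \<Longrightarrow> comb q m l = comb q (m - pow s 1) (l + pow s q)"
  using comb_add_pow[of q "m - pow s 1" s l] minus_pow_add[of m s] by simp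

lemma comb_divides: "divides m0 m \<Longrightarrow> comb q m l = comb q m0 (l + comb q (m - m0) 0)"
proof (rule poly_mapping_eqI)
  fix v assume "divides m0 m"
  then have "expo_at m v = expo_at m0 v + expo_at (m - m0) v" by (simp add: divides_iff lookup_minus)
  then show "expo_at (comb q m l) v = expo_at (comb q m0 (l + comb q (m - m0) 0)) v"
    by (simp add: lookup_comb lookup_add distrib_left)
qed

lemma add_pow_minus_pow: "q > 0 \<Longrightarrow> y + pow s q - pow s 1 = y + pow s (q - 1)"
  by (intro poly_mapping_eqI) (auto simp: lookup_add lookup_minus lookup_pow)

lemma add_minus_pow: "expo_at l s > 0 \<Longrightarrow> y + l - pow s 1 = y + (l - pow s 1)"
  by (intro poly_mapping_eqI) (auto simp: lookup_add lookup_minus lookup_pow)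

lemma comb_minus: "expo_at l s > 0 \<Longrightarrow> comb q m (l - pow s 1) = comb q m l - pow s 1"
  by (intro poly_mapping_eqI) (auto simp: lookup_comb lookup_minus lookup_pow)

section \<open>Saturation and truncation\<close>

text \<open>For positive \<open>q\<close> and up-closed \<open>S\<close>: all minimal generators
  have exponents below \<open>q\<close>. In this form the property passes to saturations and
  products without mention of generators.\<close>

definition capd :: "nat \<Rightarrow> 'v expo set \<Rightarrow> bool" where
  "capd q S \<longleftrightarrow> (\<forall>y\<in>S. \<forall>s. q \<le> expo_at y s \<longrightarrow> y - pow s 1 \<in> S)"

text \<open>The colon by all powers of the variable \<open>s\<close>.\<close>

definition sat :: "'v \<Rightarrow> 'v expo set \<Rightarrow> 'v expo set" where
  "sat s S = {y. \<exists>k. y + pow s k \<in> S}"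

text \<open>A property of Borel type: it follows from the exchange property, but unlike the latter
  it is inherited by products with Frobenius powers.\<close>

definition sat_antimono :: "('v::linorder) expo set \<Rightarrow> bool" where
  "sat_antimono S \<longleftrightarrow> (\<forall>s t. t < s \<longrightarrow> sat s S \<subseteq> sat t S)"

definition good :: "nat \<Rightarrow> ('v::{finite,linorder}) expo set \<Rightarrow> bool" where
  "good q S \<longleftrightarrow> upset S \<and> capd q S \<and> sat_antimono S"

lemma goodD:
  "good q S \<Longrightarrow> upset S" "good q S \<Longrightarrow> capd q S"
  "good q S \<Longrightarrow> t \<le> s \<Longrightarrow> sat s S \<subseteq> sat t S"
  unfolding good_def sat_antimono_def by (auto simp: le_less)

lemma upset_sat: "upset S \<Longrightarrow> upset (sat s S)"
  unfolding upset_def sat_def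
proof (intro allI impI, clarify)
  fix y t k assume "\<forall>s t. s \<in> S \<longrightarrow> divides s t \<longrightarrow> t \<in> S" "divides y t" "y + pow s k \<in> S"
  moreover have "divides (y + pow s k) (t + pow s k)" using \<open>divides y t\<close> by (simp add: divides_iff lookup_add)
  ultimately show "\<exists>k. t + pow s k \<in> S" by blast
qed

lemma subset_sat: "S \<subseteq> sat s S"
proof
  fix y assume "y \<in> S"
  then have "y + pow s 0 \<in> S" by simp
  then show "y \<in> sat s S" unfolding sat_def by blast
qed

text \<open>Exponents above \<open>q - 1\<close> can be reduced one at a time, so membership depends
  only on the exponents truncated at \<open>q - 1\<close>.\<close>

lemma capd_lower:
  assumes "upset (S :: ('v::finite) expo set)" "capd q S" "y \<in> S"
    and "\<And>v. expo_at y v \<le> expo_at y' v \<or> q \<le> Suc (expo_at y' v)"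
  shows "y' \<in> S"
  using assms(3,4)
proof (induction "total_deg (y - y')" arbitrary: y rule: less_induct)
  case less
  show ?case
  proof (cases "divides y y'")
    case True
    then show ?thesis using upsetD[OF assms(1)] less.prems(1) by blast
  next
    case False
    then obtain v where v: "expo_at y' v < expo_at y v" by (auto simp: divides_iff not_le)
    then have "q \<le> expo_at y v" using less.prems(2)[of v] by auto
    then have y: "y - pow v 1 \<in> S" using assms(2) less.prems(1) unfolding capd_def by blast
    have "y - y' = (y - pow v 1 - y') + pow v 1"
      using v by (intro poly_mapping_eqI) (auto simp: lookup_add lookup_minus lookup_pow)
    then have "total_deg (y - pow v 1 - y') < total_deg (y - y')"
      using total_deg_add[of "y - pow v 1 - y'" "pow v 1"] by (simp add: total_deg_pow)
    moreover have "expo_at (y - pow v 1) u \<le> expo_at y' u \<or> q \<le> Suc (expo_at y' u)" for u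
      using less.prems(2)[of u] by (auto simp: lookup_minus)
    ultimately show ?thesis using less.hyps y by blast
  qed
qed

lemma capd_sat: "capd q S \<Longrightarrow> capd q (sat s S)"
  unfolding capd_def
proof (intro ballI allI impI)
  fix y t assume S: "\<forall>y\<in>S. \<forall>s. q \<le> expo_at y s \<longrightarrow> y - pow s 1 \<in> S"
    and y: "y \<in> sat s S" "q \<le> expo_at y t"
  then obtain k where k: "y + pow s k \<in> S" unfolding sat_def by blast
  show "y - pow t 1 \<in> sat s S"
  proof (cases "expo_at y t = 0")
    case True
    then have "y - pow t 1 = y" by (intro poly_mapping_eqI) (auto simp: lookup_minus lookup_pow)
    then show ?thesis using y(1) by simp
  next
    case False
    have "q \<le> expo_at (y + pow s k) t" using y(2) by (simp add: lookup_add)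
    then have "y + pow s k - pow t 1 \<in> S" using S k by blast
    moreover have "y + pow s k - pow t 1 = y - pow t 1 + pow s k"
      using False by (intro poly_mapping_eqI) (auto simp: lookup_add lookup_minus lookup_pow)
    ultimately show ?thesis unfolding sat_def by auto
  qed
qed

lemma sat_sat: "sat s (sat t S) = {y. \<exists>k l. y + pow s k + pow t l \<in> S}"
  unfolding sat_def by blast

lemma sat_commute: "sat s (sat t S) = sat t (sat s S)"
proof -
  have "sat s (sat t S) \<subseteq> sat t (sat s S)" for s t
  proof
    fix y assume "y \<in> sat s (sat t S)"
    then obtain k l where "y + pow s k + pow t l \<in> S" unfolding sat_sat by blast
    moreover have "y + pow s k + pow t l = y + pow t l + pow s k" by (simp add: add_ac)
    ultimately show "y \<in> sat t (sat s S)" unfolding sat_sat by auto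
  qed
  then show ?thesis by blast
qed

lemma sat_mono: "S \<subseteq> T \<Longrightarrow> sat s S \<subseteq> sat s T"
  unfolding sat_def by blast

lemma good_sat:
  assumes "good q S"
  shows "good q (sat s S)"
  unfolding good_def sat_antimono_def
proof (intro conjI allI impI)
  show "upset (sat s S)" by (rule upset_sat[OF goodD(1)[OF assms]])
  show "capd q (sat s S)" by (rule capd_sat[OF goodD(2)[OF assms]])
  fix t u :: 'a assume "u < t"
  then have "sat t S \<subseteq> sat u S" using goodD(3)[OF assms] by simp
  then show "sat t (sat s S) \<subseteq> sat u (sat s S)"
    unfolding sat_commute[of t s S] sat_commute[of u s S] by (rule sat_mono)
qed

lemma sat_idem: "sat s (sat s S) = sat s S"
proof (intro equalityI subsetI)
  fix y assume "y \<in> sat s (sat s S)"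
  then obtain k l where "y + pow s k + pow s l \<in> S" unfolding sat_sat by blast
  then have "y + pow s (k + l) \<in> S" by (simp add: single_add add.assoc)
  then show "y \<in> sat s S" unfolding sat_def by blast
qed (rule subsetD[OF subset_sat])

text \<open>A power of \<open>s\<close> witnessing membership in the saturation can be cut down to
  \<open>q - 1\<close>, by \<open>capd_lower\<close>.\<close>

lemma sat_add_pow:
  assumes "good q L" "y \<in> sat s L" "q \<le> Suc k"
  shows "y + pow s k \<in> L"
proof -
  obtain j where "y + pow s j \<in> L" using assms(2) unfolding sat_def by blast
  then show ?thesis
    by (rule capd_lower[OF goodD(1,2)[OF assms(1)]]) (use assms(3) in \<open>auto simp: lookup_add lookup_pow\<close>)
qed

text \<open>Saturations commute, and the one by \<open>t\<close> is contained in the one by the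
  smaller \<open>s\<close>, which is idempotent.\<close>

lemma sat_sat_absorb: "good q L \<Longrightarrow> s \<le> t \<Longrightarrow> sat t (sat s L) \<subseteq> sat s L"
  using sat_mono[OF goodD(3)[of q L s t], of s] unfolding sat_commute[of t s L] sat_idem .

lemma sat_lower:
  assumes "good q L" "l \<in> sat s L" and "\<And>t. expo_at g t < expo_at l t \<Longrightarrow> s \<le> t"
  shows "g \<in> sat s L"
  using assms(2,3)
proof (induction "total_deg (l - g)" arbitrary: l rule: less_induct)
  case less
  show ?case
  proof (cases "divides l g")
    case True
    then show ?thesis using upsetD[OF upset_sat[OF goodD(1)[OF assms(1)]]] less.prems(1) by blast
  next
    case False
    then obtain t where t: "expo_at g t < expo_at l t" by (auto simp: divides_iff not_le)
    have "l - pow t 1 + pow t 1 = l" using t by (intro minus_pow_add) simp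
    then have "l - pow t 1 + pow t 1 \<in> sat s L" using less.prems(1) by (simp only:)
    then have "l - pow t 1 \<in> sat t (sat s L)" unfolding sat_def[of t] by blast
    then have l: "l - pow t 1 \<in> sat s L" using sat_sat_absorb[OF assms(1)] less.prems(2)[OF t] by blast
    have "l - g = (l - pow t 1 - g) + pow t 1"
      using t by (intro poly_mapping_eqI) (auto simp: lookup_add lookup_minus lookup_pow)
    then have "total_deg (l - pow t 1 - g) < total_deg (l - g)"
      using total_deg_add[of "l - pow t 1 - g" "pow t 1"] by (simp add: total_deg_pow)
    moreover have "s \<le> u" if "expo_at g u < expo_at (l - pow t 1) u" for u
      using that less.prems(2)[of u] by (simp add: lookup_minus)
    ultimately show ?thesis using less.hyps l by blast
  qed
qed

section \<open>Products with Frobenius powers of Borel ideals\<close>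

text \<open>With \<open>m = 0\<close> there is no smallest variable, and no saturation takes
  place.\<close>

definition msat :: "('v::{finite,linorder}) expo \<Rightarrow> 'v expo set \<Rightarrow> 'v expo set" where
  "msat m L = (if m = 0 then L else sat (Min (Poly_Mapping.keys m)) L)"

text \<open>\<open>prodU q M L\<close> corresponds to the ideal \<open>M\<^bsup>[q]\<^esup> L\<close>. Splitting off the multiples of a
  variable produces intersections of the form \<open>prodW q X M L\<close>, in which \<open>m\<^sup>q L\<close> is
  replaced by \<open>m\<^sup>q (L : x\<^sub>s\<^sup>\<infinity>)\<close> for the smallest variable \<open>x\<^sub>s\<close> of \<open>m\<close>.\<close>

definition prodU :: "nat \<Rightarrow> ('v::finite) expo set \<Rightarrow> 'v expo set \<Rightarrow> 'v expo set" where
  "prodU q M L = {comb q m l | m l. m \<in> M \<and> l \<in> L}"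

definition prodW :: "nat \<Rightarrow> 'v set \<Rightarrow> ('v::{finite,linorder}) expo set \<Rightarrow> 'v expo set \<Rightarrow> 'v expo set" where
  "prodW q X M L = {comb q m l | m l. m \<in> M \<and> Poly_Mapping.keys m \<subseteq> X \<and> l \<in> msat m L}"

text \<open>A Borel ideal extended from the variables \<open>X\<close>. The degree bound
  \<open>D\<close> on its generators forms, together with the size of \<open>X\<close>, the measure
  of the induction.\<close>

definition borel_on :: "'v set \<Rightarrow> nat \<Rightarrow> ('v::{finite,linorder}) expo set \<Rightarrow> bool" where
  "borel_on X D M \<longleftrightarrow> upset M \<and>
    (\<forall>i\<in>X. \<forall>j\<in>X. i < j \<longrightarrow> (\<forall>y\<in>M. expo_at y j > 0 \<longrightarrow> y - pow j 1 + pow i 1 \<in> M)) \<and>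
    (\<forall>y\<in>M. \<exists>m\<in>M. Poly_Mapping.keys m \<subseteq> X \<and> divides m y \<and> total_deg m \<le> D)"

lemma borel_onD:
  assumes "borel_on X D M"
  shows "upset M"
    and "i \<in> X \<Longrightarrow> j \<in> X \<Longrightarrow> i < j \<Longrightarrow> y \<in> M \<Longrightarrow> expo_at y j > 0 \<Longrightarrow> y - pow j 1 + pow i 1 \<in> M"
    and "y \<in> M \<Longrightarrow> \<exists>m\<in>M. Poly_Mapping.keys m \<subseteq> X \<and> divides m y \<and> total_deg m \<le> D"
  using assms unfolding borel_on_def by blast+

lemma keys_iff: "v \<in> Poly_Mapping.keys m \<longleftrightarrow> expo_at m v > 0"
  by (simp add: in_keys_iff)

lemma keys_minus_pow: "Poly_Mapping.keys (m - pow s 1) \<subseteq> Poly_Mapping.keys m"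
  by (auto simp: in_keys_iff lookup_minus)

lemma neq_0_ex: "m \<noteq> 0 \<longleftrightarrow> (\<exists>v. expo_at m v > 0)"
  by (simp add: poly_mapping_eq_iff fun_eq_iff)

lemma total_deg_minus_pow: "expo_at m s > 0 \<Longrightarrow> total_deg m = Suc (total_deg (m - pow s 1))"
  using total_deg_add[of "m - pow s 1" "pow s 1"] minus_pow_add[of m s] by (simp add: total_deg_pow)

text \<open>Dividing by the smallest variable \<open>v\<close> lowers the degree bound even for
  generators free of \<open>v\<close>: exchanging one of their variables for \<open>v\<close> shows
  that the generator without that variable is already in the colon.\<close>

lemma borel_on_colon:
  assumes M: "borel_on X D M" and "0 \<notin> M" and v: "v \<in> X" "\<And>x. x \<in> X \<Longrightarrow> v \<le> x" and D: "D > 0"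
  shows "borel_on X (D - 1) {y. y + pow v 1 \<in> M}"
  unfolding borel_on_def
proof (intro conjI ballI impI)
  show "upset {y. y + pow v 1 \<in> M}"
    unfolding upset_def
  proof (intro allI impI)
    fix s t assume "s \<in> {y. y + pow v 1 \<in> M}" "divides s t"
    moreover have "divides (s + pow v 1) (t + pow v 1)"
      using \<open>divides s t\<close> by (simp add: divides_iff lookup_add)
    ultimately show "t \<in> {y. y + pow v 1 \<in> M}" using upsetD[OF borel_onD(1)[OF M]] by blast
  qed
  fix i j y assume ij: "i \<in> X" "j \<in> X" "i < j" and y: "y \<in> {y. y + pow v 1 \<in> M}" "expo_at y j > 0"
  have "expo_at (y + pow v 1) j > 0" using y(2) by (simp add: lookup_add)
  then have "y + pow v 1 - pow j 1 + pow i 1 \<in> M" using borel_onD(2)[OF M ij] y(1) by blast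
  moreover have "y + pow v 1 - pow j 1 + pow i 1 = y - pow j 1 + pow i 1 + pow v 1"
    using y(2) by (intro poly_mapping_eqI) (auto simp: lookup_add lookup_minus lookup_pow)
  ultimately show "y - pow j 1 + pow i 1 \<in> {y. y + pow v 1 \<in> M}" by simp
next
  fix y assume "y \<in> {y. y + pow v 1 \<in> M}"
  then obtain m where m: "m \<in> M" "Poly_Mapping.keys m \<subseteq> X" "divides m (y + pow v 1)" "total_deg m \<le> D"
    using borel_onD(3)[OF M] by blast
  have "\<exists>s. expo_at m s > 0 \<and> m - pow s 1 + pow v 1 \<in> M \<and> divides (m - pow s 1) y"
  proof (cases "expo_at m v = 0")
    case False
    have "divides (m - pow v 1) y"
      unfolding divides_iff
    proof
      fix u show "expo_at (m - pow v 1) u \<le> expo_at y u"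
        using m(3)[unfolded divides_iff, rule_format, of u] by (auto simp: lookup_add lookup_minus lookup_pow)
    qed
    moreover have "expo_at m v > 0" using False by simp
    moreover from this have "m - pow v 1 + pow v 1 \<in> M" using m(1) minus_pow_add[of m v] by (simp only:)
    ultimately show ?thesis by (intro exI[of _ v] conjI)
  next
    case True
    obtain s where s: "expo_at m s > 0" using m(1) \<open>0 \<notin> M\<close> neq_0_ex[of m] by blast
    then have "s \<in> X" using m(2) by (auto simp: keys_iff)
    moreover have "s \<noteq> v" using s True by auto
    ultimately have "v < s" using v(2)[of s] by auto
    then have "m - pow s 1 + pow v 1 \<in> M" using borel_onD(2)[OF M v(1) \<open>s \<in> X\<close> _ m(1) s] by blast
    moreover have "divides (m - pow s 1) y"
      unfolding divides_iff
    proof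
      fix u show "expo_at (m - pow s 1) u \<le> expo_at y u"
        using m(3)[unfolded divides_iff, rule_format, of u] True
        by (cases "u = v") (auto simp: lookup_add lookup_minus lookup_pow)
    qed
    ultimately show ?thesis using s by blast
  qed
  then obtain s where s: "expo_at m s > 0" "m - pow s 1 + pow v 1 \<in> M" "divides (m - pow s 1) y" by blast
  have "Poly_Mapping.keys (m - pow s 1) \<subseteq> X" using subset_trans[OF keys_minus_pow m(2)] .
  moreover have "total_deg (m - pow s 1) \<le> D - 1" using total_deg_minus_pow[OF s(1)] m(4) by simp
  moreover have "m - pow s 1 \<in> {y. y + pow v 1 \<in> M}" using s(2) by (rule CollectI)
  ultimately show "\<exists>m\<in>{y. y + pow v 1 \<in> M}. Poly_Mapping.keys m \<subseteq> X \<and> divides m y \<and> total_deg m \<le> D - 1"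
    using s(3) by (intro bexI[of _ "m - pow s 1"] conjI)
qed

text \<open>Exchanges between variables of \<open>Y\<close> do not leave \<open>Y\<close>, and a
  divisor of a monomial in \<open>Y\<close> is again a monomial in \<open>Y\<close>, so exchange and
  degree bound are inherited.\<close>

lemma borel_on_restrict:
  assumes M: "borel_on X D M" and Y: "Y \<subseteq> X"
  shows "borel_on Y D {y. \<exists>m\<in>M. Poly_Mapping.keys m \<subseteq> Y \<and> divides m y}" (is "borel_on Y D ?M")
  unfolding borel_on_def
proof (intro conjI ballI impI)
  show "upset ?M"
    unfolding upset_def
  proof (intro allI impI)
    fix s t assume "s \<in> ?M" "divides s t"
    then obtain m where "m \<in> M" "Poly_Mapping.keys m \<subseteq> Y" "divides m s" by blast
    moreover have "divides m t" using \<open>divides m s\<close> \<open>divides s t\<close> by (rule divides_trans)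
    ultimately show "t \<in> ?M" by blast
  qed
  fix i j y assume ij: "i \<in> Y" "j \<in> Y" "i < j" and y: "y \<in> ?M" "expo_at y j > 0"
  then obtain m where m: "m \<in> M" "Poly_Mapping.keys m \<subseteq> Y" "divides m y" by blast
  show "y - pow j 1 + pow i 1 \<in> ?M"
  proof (cases "expo_at m j > 0")
    case True
    have "m - pow j 1 + pow i 1 \<in> M" using borel_onD(2)[OF M _ _ ij(3) m(1) True] ij Y by blast
    moreover have "Poly_Mapping.keys (m - pow j 1 + pow i 1) \<subseteq> Y"
    proof
      fix u assume "u \<in> Poly_Mapping.keys (m - pow j 1 + pow i 1)"
      then have "u = i \<or> u \<in> Poly_Mapping.keys m"
        by (auto simp: in_keys_iff lookup_add lookup_minus lookup_pow split: if_splits)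
      then show "u \<in> Y" using m(2) ij(1) by blast
    qed
    moreover have "divides (m - pow j 1 + pow i 1) (y - pow j 1 + pow i 1)"
      unfolding divides_iff
    proof
      fix u show "expo_at (m - pow j 1 + pow i 1) u \<le> expo_at (y - pow j 1 + pow i 1) u"
        using m(3)[unfolded divides_iff, rule_format, of u] by (simp add: lookup_add lookup_minus)
    qed
    ultimately show ?thesis by blast
  next
    case False
    have "divides m (y - pow j 1 + pow i 1)"
      unfolding divides_iff
    proof
      fix u show "expo_at m u \<le> expo_at (y - pow j 1 + pow i 1) u"
        using m(3)[unfolded divides_iff, rule_format, of u] False
        by (cases "u = j") (auto simp: lookup_add lookup_minus lookup_pow)
    qed
    then show ?thesis using m by blast
  qed
next
  fix y assume "y \<in> ?M"
  then obtain m where m: "m \<in> M" "Poly_Mapping.keys m \<subseteq> Y" "divides m y" by blast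
  obtain m0 where m0: "m0 \<in> M" "divides m0 m" "total_deg m0 \<le> D" using borel_onD(3)[OF M m(1)] by blast
  have "Poly_Mapping.keys m0 \<subseteq> Poly_Mapping.keys m"
  proof
    fix u assume "u \<in> Poly_Mapping.keys m0"
    then show "u \<in> Poly_Mapping.keys m"
      using m0(2)[unfolded divides_iff, rule_format, of u] by (simp add: keys_iff)
  qed
  then have "Poly_Mapping.keys m0 \<subseteq> Y" using m(2) by blast
  moreover have "divides m0 y" using m0(2) m(3) by (rule divides_trans)
  ultimately show "\<exists>m\<in>?M. Poly_Mapping.keys m \<subseteq> Y \<and> divides m y \<and> total_deg m \<le> D"
    using m0(1,3) divides_refl by blast
qed

lemma subset_msat: "L \<subseteq> msat m L"
  unfolding msat_def by (cases "m = 0") (simp_all add: subset_sat)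

text \<open>One splitting step at the smallest variable \<open>v\<close>. \<open>M\<close> is the
  sum of \<open>v\<close> times the colon \<open>M'\<close> and of the part \<open>M''\<close>
  generated without \<open>v\<close>; the first has a smaller degree bound, the second fewer
  variables.\<close>

locale frobenius_split =
  fixes q :: nat and L M :: "('v::{finite,linorder}) expo set" and X :: "'v set" and D :: nat and v :: 'v
  assumes q: "q > 0" and L: "good q L" and M: "borel_on X D M" and zero: "0 \<notin> M" and D: "D > 0"
    and v: "v \<in> X" "\<And>x. x \<in> X \<Longrightarrow> v \<le> x"
begin

definition "M' = {y. y + pow v 1 \<in> M}"
definition "X'' = X - {v}"
definition "M'' = {y. \<exists>m\<in>M. Poly_Mapping.keys m \<subseteq> X'' \<and> divides m y}"

lemma borel_M': "borel_on X (D - 1) M'"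
  unfolding M'_def by (rule borel_on_colon[OF M zero v D])

lemma borel_M'': "borel_on X'' D M''"
  unfolding M''_def by (rule borel_on_restrict[OF M]) (simp add: X''_def)

lemma M''_M: "M'' \<subseteq> M"
proof
  fix y assume "y \<in> M''"
  then obtain m where "m \<in> M" "divides m y" unfolding M''_def by blast
  then show "y \<in> M" by (rule upsetD[OF borel_onD(1)[OF M]])
qed

lemma M_M': "M \<subseteq> M'"
proof
  fix y assume "y \<in> M"
  then have "y + pow v 1 \<in> M" by (rule upsetD[OF borel_onD(1)[OF M] _ divides_add(1)])
  then show "y \<in> M'" unfolding M'_def by (rule CollectI)
qed

lemma M''_gen: "m \<in> M'' \<Longrightarrow> \<exists>m0\<in>M''. Poly_Mapping.keys m0 \<subseteq> X'' \<and> divides m0 m \<and> m0 \<noteq> 0"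
proof -
  assume "m \<in> M''"
  then obtain m0 where m0: "m0 \<in> M" "Poly_Mapping.keys m0 \<subseteq> X''" "divides m0 m" unfolding M''_def by blast
  moreover from this have "m0 \<in> M''" unfolding M''_def using divides_refl[of m0] by blast
  moreover have "m0 \<noteq> 0" using zero m0(1) by blast
  ultimately show ?thesis by blast
qed

lemma upL: "upset L" and upLs: "upset (sat s L)"
  by (rule goodD(1)[OF L], rule upset_sat[OF goodD(1)[OF L]])

text \<open>Exchange \<open>s\<close> for the smaller \<open>v\<close>: this is how the Borel
  property provides elements of the colon.\<close>

lemma M'_I: "m \<in> M \<Longrightarrow> s \<in> X'' \<Longrightarrow> expo_at m s > 0 \<Longrightarrow> m - pow s 1 \<in> M'"
proof -
  assume m: "m \<in> M" and s: "s \<in> X''" and pos: "expo_at m s > 0"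
  have "s \<in> X" "v < s" using s v(2)[of s] unfolding X''_def by auto
  then have "m - pow s 1 + pow v 1 \<in> M" using borel_onD(2)[OF M v(1) _ _ m pos] by blast
  then show ?thesis unfolding M'_def by (rule CollectI)
qed

lemma Min_keys:
  assumes "m \<noteq> 0" "Poly_Mapping.keys m \<subseteq> X''"
  shows "msat m L = sat (Min (Poly_Mapping.keys m)) L" "Min (Poly_Mapping.keys m) \<in> X''"
    "expo_at m (Min (Poly_Mapping.keys m)) > 0" "v \<le> Min (Poly_Mapping.keys m)"
    "expo_at m t > 0 \<Longrightarrow> Min (Poly_Mapping.keys m) \<le> t"
proof -
  have ne: "Poly_Mapping.keys m \<noteq> {}" using assms(1) by simp
  show "msat m L = sat (Min (Poly_Mapping.keys m)) L" using assms(1) by (simp add: msat_def)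
  have mem: "Min (Poly_Mapping.keys m) \<in> Poly_Mapping.keys m" using ne by (intro Min_in) simp_all
  show "expo_at m (Min (Poly_Mapping.keys m)) > 0" using mem by (simp only: keys_iff)
  show X: "Min (Poly_Mapping.keys m) \<in> X''" by (rule subsetD[OF assms(2) mem])
  show "v \<le> Min (Poly_Mapping.keys m)" by (rule v(2)) (use X in \<open>simp add: X''_def\<close>)
  show "Min (Poly_Mapping.keys m) \<le> t" if "expo_at m t > 0"
    by (rule Min_le) (use that in \<open>simp_all only: keys_iff finite_keys\<close>)
qed

lemma Min_keys_v:
  assumes "Poly_Mapping.keys m \<subseteq> X" "expo_at m v > 0"
  shows "Min (Poly_Mapping.keys m) = v"
proof (rule Min_eqI)
  show "v \<in> Poly_Mapping.keys m" using assms(2) by (simp only: keys_iff)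
  show "v \<le> y" if "y \<in> Poly_Mapping.keys m" for y using v(2)[OF subsetD[OF assms(1) that]] .
qed simp

lemma X''_v: "Poly_Mapping.keys m \<subseteq> X'' \<Longrightarrow> expo_at m v = 0"
  unfolding X''_def by (auto simp: in_keys_iff)

lemma msat_sat: "m \<noteq> 0 \<Longrightarrow> Poly_Mapping.keys m \<subseteq> X'' \<Longrightarrow> msat m L \<subseteq> sat v L"
  unfolding Min_keys(1) by (rule goodD(3)[OF L Min_keys(4)])

lemma M''_not0: "m \<in> M'' \<Longrightarrow> m \<noteq> 0"
  using subsetD[OF M''_M] zero by metis

lemma sat_pow:
  assumes "l \<in> sat s L"
  shows "l + pow s q \<in> L" "l + pow s (q - 1) \<in> L"
  by (rule sat_add_pow[OF L assms], simp)+

lemma prodUI: "m \<in> N \<Longrightarrow> l \<in> K \<Longrightarrow> comb q m l \<in> prodU q N K"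
  unfolding prodU_def by blast

lemma prodWI: "m \<in> N \<Longrightarrow> Poly_Mapping.keys m \<subseteq> Y \<Longrightarrow> l \<in> msat m K \<Longrightarrow> comb q m l \<in> prodW q Y N K"
  unfolding prodW_def by blast

lemma shiftI: "y \<in> S \<Longrightarrow> y + pow v k \<in> (+) (pow v k) ` S"
  by (subst add.commute) (rule imageI)

lemma shiftE:
  assumes "z \<in> (+) (pow v k) ` S"
  obtains y where "y \<in> S" "z = y + pow v k"
proof -
  obtain y where y: "y \<in> S" "z = pow v k + y" using assms by (rule imageE)
  then have "z = y + pow v k" by (simp only: add.commute)
  with y(1) show ?thesis by (rule that)
qed

lemma expo_ge: "divides (comb q m l + pow v q) \<alpha> \<Longrightarrow> expo_at m t > 0 \<Longrightarrow> q \<le> expo_at \<alpha> t"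
proof -
  assume "divides (comb q m l + pow v q) \<alpha>" "expo_at m t > 0"
  then have "q * expo_at m t + expo_at l t \<le> expo_at \<alpha> t" "q * 1 \<le> q * expo_at m t"
    by (auto simp: divides_iff lookup_add lookup_comb dest: spec[of _ t])
  then show ?thesis by linarith
qed

lemma split_U: "prodU q M L = (+) (pow v q) ` prodU q M' L \<union> prodU q M'' L"
proof (intro equalityI subsetI)
  fix z assume "z \<in> prodU q M L"
  then obtain m l where z: "z = comb q m l" "m \<in> M" "l \<in> L" unfolding prodU_def by blast
  show "z \<in> (+) (pow v q) ` prodU q M' L \<union> prodU q M'' L"
  proof (cases "expo_at m v > 0")
    case True
    have "m - pow v 1 \<in> M'" using z(2) minus_pow_add[OF True] by (simp add: M'_def)
    moreover have "z = comb q (m - pow v 1) l + pow v q"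
      using comb_minus_pow[OF True, of q l] z(1) by (simp add: comb_add)
    ultimately show ?thesis using shiftI[OF prodUI] z(3) by blast
  next
    case False
    obtain m0 where m0: "m0 \<in> M" "Poly_Mapping.keys m0 \<subseteq> X" "divides m0 m" using borel_onD(3)[OF M z(2)] by blast
    have "expo_at m0 v = 0" using m0(3)[unfolded divides_iff, rule_format, of v] False by simp
    then have "Poly_Mapping.keys m0 \<subseteq> X''" using m0(2) keys_iff[of v m0] unfolding X''_def by auto
    then have "m \<in> M''" using m0 unfolding M''_def by blast
    then show ?thesis using z prodUI by blast
  qed
next
  fix z assume "z \<in> (+) (pow v q) ` prodU q M' L \<union> prodU q M'' L"
  then consider "z \<in> (+) (pow v q) ` prodU q M' L" | "z \<in> prodU q M'' L" by blast
  then show "z \<in> prodU q M L"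
  proof cases
    case 1
    then obtain m l where "z = comb q m l + pow v q" "m + pow v 1 \<in> M" "l \<in> L"
      by (elim shiftE) (auto simp: prodU_def M'_def)
    then show ?thesis using prodUI[of "m + pow v 1" M l L] by (simp only: comb_add_pow comb_add)
  next
    case 2
    then show ?thesis using M''_M unfolding prodU_def by blast
  qed
qed

text \<open>A common element is \<open>v\<close> to the power \<open>q\<close> times some
  \<open>?w\<close> divisible by the \<open>q\<close>-th power of a monomial \<open>m0\<close> of
  \<open>M''\<close>. The quotient \<open>g\<close> falls below an element of \<open>L\<close> only
  in variables of \<open>m0\<close>, hence lies in the saturation by the smallest of them.
  Conversely, a saturated factor is brought back into \<open>L\<close> either by the
  \<open>q\<close> copies of \<open>v\<close> or by \<open>q\<close> copies of that smallest
  variable taken out of the Frobenius part.\<close>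

lemma int_U: "(+) (pow v q) ` prodU q M' L \<inter> prodU q M'' L = (+) (pow v q) ` prodW q X'' M'' L"
proof (intro equalityI subsetI)
  fix z assume "z \<in> (+) (pow v q) ` prodW q X'' M'' L"
  then obtain m l where z: "z = comb q m l + pow v q" "m \<in> M''" "Poly_Mapping.keys m \<subseteq> X''" "l \<in> msat m L"
    by (elim shiftE) (auto simp: prodW_def)
  note m0 = M''_not0[OF z(2)]
  let ?s = "Min (Poly_Mapping.keys m)"
  note Min = Min_keys[OF m0 z(3)]
  have "l + pow v q \<in> L" using sat_pow(1) msat_sat[OF m0 z(3)] z(4) by blast
  then have "comb q m (l + pow v q) \<in> prodU q M'' L" by (rule prodUI[OF z(2)])
  then have "z \<in> prodU q M'' L" by (simp only: z(1) comb_add)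
  moreover have "m - pow ?s 1 \<in> M'" using M'_I Min(2,3) z(2) M''_M by blast
  moreover have "l + pow ?s q \<in> L" using sat_pow(1) Min(1) z(4) by simp
  ultimately show "z \<in> (+) (pow v q) ` prodU q M' L \<inter> prodU q M'' L"
    using shiftI[OF prodUI] z(1) comb_minus_pow[OF Min(3), of q l] by auto
next
  fix z assume "z \<in> (+) (pow v q) ` prodU q M' L \<inter> prodU q M'' L"
  then obtain m' l' m l where z: "z = comb q m' l' + pow v q" "m' \<in> M'" "l' \<in> L"
    and z': "z = comb q m l" "m \<in> M''" "l \<in> L"
    by (elim IntE shiftE) (auto simp: prodU_def)
  obtain m0 where m0: "m0 \<in> M''" "Poly_Mapping.keys m0 \<subseteq> X''" "divides m0 m" "m0 \<noteq> 0"
    using M''_gen[OF z'(2)] by blast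
  note Min = Min_keys[OF m0(4,2)]
  let ?w = "comb q m' l'"
  have le: "q * expo_at m0 u \<le> expo_at ?w u" for u
  proof -
    have "expo_at m0 u \<le> expo_at m u" using m0(3) by (simp add: divides_iff)
    then have "q * expo_at m0 u \<le> q * expo_at m u" by simp
    also have "\<dots> \<le> expo_at z u" using z'(1) by (simp add: lookup_comb)
    finally show ?thesis using X''_v[OF m0(2)] z(1) by (cases "u = v") (auto simp: lookup_add lookup_pow)
  qed
  define g where "g = mk (\<lambda>u. expo_at ?w u - q * expo_at m0 u)"
  have w: "?w = comb q m0 g"
    using le by (intro poly_mapping_eqI) (simp add: lookup_comb g_def)
  have "g \<in> sat (Min (Poly_Mapping.keys m0)) L"
  proof (rule sat_lower[OF L])
    show "l' \<in> sat (Min (Poly_Mapping.keys m0)) L" using z(3) by (rule subsetD[OF subset_sat])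
    fix t assume "expo_at g t < expo_at l' t"
    then have "expo_at m0 t > 0" by (auto simp: g_def lookup_comb intro: gr0I)
    then show "Min (Poly_Mapping.keys m0) \<le> t" by (rule Min(5))
  qed
  then have "?w \<in> prodW q X'' M'' L" unfolding w using prodWI[OF m0(1,2)] Min(1) by simp
  then show "z \<in> (+) (pow v q) ` prodW q X'' M'' L" using z(1) shiftI by simp
qed

text \<open>One of the \<open>q\<close> copies of \<open>v\<close> can be given up, since
  \<open>q - 1\<close> copies already bring the saturated factor into \<open>L\<close>.\<close>

lemma vanish_U_K:
  assumes "\<alpha> \<in> (+) (pow v q) ` prodW q X'' M'' L"
  shows "vanish ((+) (pow v q) ` prodW q X'' M'' L) (prodU q M'' L) \<alpha>"
  unfolding vanish_def
proof (intro exI conjI ballI impI)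
  show "expo_at \<alpha> v > 0" using assms q by (auto simp: lookup_add lookup_pow)
  fix y assume "y \<in> (+) (pow v q) ` prodW q X'' M'' L"
  then obtain m l where y: "y = comb q m l + pow v q" "m \<in> M''" "Poly_Mapping.keys m \<subseteq> X''" "l \<in> msat m L"
    by (elim shiftE) (auto simp: prodW_def)
  have "l + pow v (q - 1) \<in> L" using sat_pow(2) msat_sat[OF M''_not0[OF y(2)] y(3)] y(4) by blast
  then have "comb q m (l + pow v (q - 1)) \<in> prodU q M'' L" by (rule prodUI[OF y(2)])
  then show "y - pow v 1 \<in> prodU q M'' L" by (simp only: y(1) comb_add add_pow_minus_pow[OF q])
qed

text \<open>The variable to lower is the smallest \<open>s\<close> of \<open>X''\<close> with
  exponent at least \<open>q\<close> in \<alpha>. If \<open>s\<close> divides \<open>m\<close>, it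
  is the smallest variable of \<open>m\<close>; trading one \<open>s\<close> out of the Frobenius
  part and dropping one copy leaves \<open>q - 1\<close> copies, enough to bring \<open>l\<close>
  into \<open>L\<close>. Otherwise the whole exponent of \<open>s\<close> sits in \<open>l\<close>,
  is at least \<open>q\<close>, and can be lowered inside the saturation.\<close>

lemma vanish_U_J:
  assumes \<alpha>: "\<alpha> \<in> (+) (pow v q) ` prodW q X'' M'' L"
  shows "vanish ((+) (pow v q) ` prodW q X'' M'' L) ((+) (pow v q) ` prodU q M' L) \<alpha>"
proof -
  let ?A = "(+) (pow v q) ` prodW q X'' M'' L"
  let ?T = "{t \<in> X''. q \<le> expo_at \<alpha> t}"
  obtain m0 l0 where m0: "\<alpha> = comb q m0 l0 + pow v q" "m0 \<in> M''" "Poly_Mapping.keys m0 \<subseteq> X''"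
    using \<alpha> by (elim shiftE) (auto simp: prodW_def)
  note Min0 = Min_keys[OF M''_not0[OF m0(2)] m0(3)]
  have "q \<le> expo_at \<alpha> (Min (Poly_Mapping.keys m0))"
    by (rule expo_ge[of m0 l0 \<alpha>, OF _ Min0(3)]) (simp add: m0(1))
  then have ne: "?T \<noteq> {}" using Min0(2) by blast
  define s where "s = Min ?T"
  have "s \<in> ?T" unfolding s_def by (rule Min_in[OF _ ne]) simp
  then have s: "s \<in> X''" "q \<le> expo_at \<alpha> s" by simp_all
  have AJ: "?A \<subseteq> (+) (pow v q) ` prodU q M' L" unfolding int_U[symmetric] by (rule Int_lower1)
  have "y - pow s 1 \<in> (+) (pow v q) ` prodU q M' L"
    if y: "y \<in> ?A" "divides y \<alpha>" "expo_at y s = expo_at \<alpha> s" for y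
  proof -
    obtain m l where m: "y = comb q m l + pow v q" "m \<in> M''" "Poly_Mapping.keys m \<subseteq> X''" "l \<in> msat m L"
      using y(1) by (elim shiftE) (auto simp: prodW_def)
    note Min = Min_keys[OF M''_not0[OF m(2)] m(3)]
    let ?r = "Min (Poly_Mapping.keys m)"
    have "q \<le> expo_at \<alpha> ?r" by (rule expo_ge[of m l \<alpha>, OF _ Min(3)]) (use y(2) m(1) in simp)
    then have "s \<le> ?r" unfolding s_def using Min(2) by (intro Min_le) simp_all
    show ?thesis
    proof (cases "expo_at m s > 0")
      case True
      then have "?r = s" using Min(5)[of s] \<open>s \<le> ?r\<close> by simp
      then have "l + pow s (q - 1) \<in> L" using sat_pow(2) Min(1) m(4) by simp
      moreover have "m - pow s 1 \<in> M'" using M'_I[OF _ s(1) True] m(2) M''_M by blast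
      moreover have "y - pow s 1 = comb q (m - pow s 1) (l + pow s (q - 1)) + pow v q"
      proof -
        have "y = (comb q (m - pow s 1) l + pow v q) + pow s q"
          using m(1) comb_minus_pow[OF True, of q l] by (simp add: comb_add add_ac)
        then have "y - pow s 1 = (comb q (m - pow s 1) l + pow v q) + pow s (q - 1)"
          using add_pow_minus_pow[OF q] by simp
        then show ?thesis by (simp add: comb_add add_ac)
      qed
      ultimately show ?thesis by (simp only: shiftI prodUI)
    next
      case False
      have "s \<noteq> v" using s(1) unfolding X''_def by blast
      then have l: "q \<le> expo_at l s" using y(3) s(2) m(1) False by (simp add: lookup_add lookup_comb lookup_pow)
      have "capd q (sat ?r L)" by (rule capd_sat[OF goodD(2)[OF L]])
      then have "l - pow s 1 \<in> msat m L" using l m(4) unfolding capd_def Min(1) by (simp only:)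
      then have "comb q m (l - pow s 1) \<in> prodW q X'' M'' L" using prodWI m(2,3) by blast
      moreover have "y - pow s 1 = comb q m (l - pow s 1) + pow v q"
      proof -
        have "0 < expo_at (comb q m l) s" "0 < expo_at l s" using l q by (simp_all add: lookup_comb)
        then show ?thesis
          using m(1) add_minus_pow[of "comb q m l" s "pow v q"] comb_minus[of l s q m] by (simp add: add.commute)
      qed
      ultimately have "y - pow s 1 \<in> ?A" by (simp only: shiftI)
      then show ?thesis by (rule subsetD[OF AJ])
    qed
  qed
  moreover have "expo_at \<alpha> s > 0" using s(2) q by simp
  ultimately show ?thesis unfolding vanish_def by (intro exI[of _ s] conjI ballI impI)
qed

text \<open>A monomial in the variables \<open>X\<close> that is divisible by \<open>v\<close> has
  \<open>v\<close> as its smallest variable, so its factor is saturated by \<open>v\<close>; the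
  monomials free of \<open>v\<close> remain in a product of the second kind.\<close>

lemma split_W: "prodW q X M L = (+) (pow v q) ` prodU q M' (sat v L) \<union> prodW q X'' M'' L"
proof (intro equalityI subsetI)
  fix z assume "z \<in> prodW q X M L"
  then obtain m l where z: "z = comb q m l" "m \<in> M" "Poly_Mapping.keys m \<subseteq> X" "l \<in> msat m L"
    unfolding prodW_def by blast
  show "z \<in> (+) (pow v q) ` prodU q M' (sat v L) \<union> prodW q X'' M'' L"
  proof (cases "expo_at m v > 0")
    case True
    have "Min (Poly_Mapping.keys m) = v" by (rule Min_keys_v[OF z(3) True])
    moreover have "m \<noteq> 0" using True by auto
    ultimately have "l \<in> sat v L" using z(4) by (simp add: msat_def)
    moreover have "m - pow v 1 \<in> M'" using z(2) minus_pow_add[OF True] by (simp add: M'_def)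
    moreover have "z = comb q (m - pow v 1) l + pow v q"
      using comb_minus_pow[OF True, of q l] z(1) by (simp add: comb_add)
    ultimately show ?thesis using shiftI[OF prodUI] by blast
  next
    case False
    then have k: "Poly_Mapping.keys m \<subseteq> X''" using z(3) keys_iff[of v m] unfolding X''_def by auto
    then have "m \<in> M''" using z(2) divides_refl unfolding M''_def by blast
    then show ?thesis using z(1,4) k prodWI by blast
  qed
next
  fix z assume "z \<in> (+) (pow v q) ` prodU q M' (sat v L) \<union> prodW q X'' M'' L"
  then consider "z \<in> (+) (pow v q) ` prodU q M' (sat v L)" | "z \<in> prodW q X'' M'' L" by blast
  then show "z \<in> prodW q X M L"
  proof cases
    case 1
    then obtain m l where z: "z = comb q m l + pow v q" "m \<in> M'" "l \<in> sat v L"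
      by (elim shiftE) (auto simp: prodU_def)
    \<comment> \<open>Monomials in \<open>prodW\<close> have to be supported on \<open>X\<close>. So
      \<open>m\<close> is replaced by a generator \<open>m0\<close>, and the surplus is moved to the
      other factor.\<close>
    obtain m0 where m0: "m0 \<in> M'" "Poly_Mapping.keys m0 \<subseteq> X" "divides m0 m" using borel_onD(3)[OF borel_M' z(2)] by blast
    let ?m = "m0 + pow v 1"
    have keys: "Poly_Mapping.keys ?m \<subseteq> X" using keys_add[of m0 "pow v 1"] m0(2) v(1) by auto
    have "expo_at ?m v > 0" by (simp add: lookup_add)
    then have "Min (Poly_Mapping.keys ?m) = v" by (rule Min_keys_v[OF keys])
    moreover have "?m \<noteq> 0" using \<open>expo_at ?m v > 0\<close> by auto
    moreover have "l + comb q (m - m0) 0 \<in> sat v L" using upsetD[OF upLs z(3)] divides_add(1) by blast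
    ultimately have "l + comb q (m - m0) 0 \<in> msat ?m L" by (simp add: msat_def)
    moreover have "?m \<in> M" using m0(1) by (simp add: M'_def)
    moreover have "z = comb q ?m (l + comb q (m - m0) 0)"
      using z(1) comb_divides[OF m0(3), of q l] by (simp only: comb_add_pow comb_add add_ac)
    ultimately show ?thesis using prodWI keys by blast
  next
    case 2
    then show ?thesis using M''_M unfolding prodW_def X''_def by blast
  qed
qed

lemma prodU_subset_W: "m \<in> M'' \<Longrightarrow> l \<in> L \<Longrightarrow> comb q m l \<in> prodW q X'' M'' L"
proof -
  assume m: "m \<in> M''" and l: "l \<in> L"
  obtain m0 where m0: "m0 \<in> M''" "Poly_Mapping.keys m0 \<subseteq> X''" "divides m0 m" using M''_gen[OF m] by blast
  have "l + comb q (m - m0) 0 \<in> L" using upsetD[OF upL l] divides_add(1) by blast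
  then have "l + comb q (m - m0) 0 \<in> msat m0 L" by (rule subsetD[OF subset_msat])
  then show ?thesis unfolding comb_divides[OF m0(3)] by (rule prodWI[OF m0(1,2)])
qed

text \<open>A monomial of \<open>M''\<close> in the variables \<open>X''\<close> is free of
  \<open>v\<close>, so the \<open>q\<close> copies of \<open>v\<close> come from \<open>l\<close>.
  Removing them keeps \<open>l\<close> in the saturation by \<open>v\<close>, which contains the
  saturations by later variables.\<close>

lemma int_W: "(+) (pow v q) ` prodU q M' (sat v L) \<inter> prodW q X'' M'' L = (+) (pow v q) ` prodU q M'' (sat v L)"
proof (intro equalityI subsetI)
  fix z assume "z \<in> (+) (pow v q) ` prodU q M'' (sat v L)"
  then obtain m l where z: "z = comb q m l + pow v q" "m \<in> M''" "l \<in> sat v L"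
    by (elim shiftE) (auto simp: prodU_def)
  have "m \<in> M'" using z(2) M''_M M_M' by blast
  then have "z \<in> (+) (pow v q) ` prodU q M' (sat v L)" using z shiftI[OF prodUI] by blast
  moreover have "z \<in> prodW q X'' M'' L" using prodU_subset_W[OF z(2) sat_pow(1)[OF z(3)]] z(1) by (simp add: comb_add)
  ultimately show "z \<in> (+) (pow v q) ` prodU q M' (sat v L) \<inter> prodW q X'' M'' L" by blast
next
  fix z assume "z \<in> (+) (pow v q) ` prodU q M' (sat v L) \<inter> prodW q X'' M'' L"
  then obtain y m l where y: "z = y + pow v q"
    and z: "z = comb q m l" "m \<in> M''" "Poly_Mapping.keys m \<subseteq> X''" "l \<in> msat m L"
    by (elim IntE shiftE) (auto simp: prodW_def)
  have "expo_at l v = expo_at z v" using z(1) X''_v[OF z(3)] by (simp add: lookup_comb)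
  then have q_le: "q \<le> expo_at l v" using y by (simp add: lookup_add lookup_pow)
  have l: "l \<in> sat v L" using msat_sat[OF M''_not0[OF z(2)] z(3)] z(4) by blast
  have "l - pow v q \<in> sat v L"
    by (rule sat_lower[OF L l]) (auto simp: lookup_minus lookup_pow split: if_splits)
  moreover have "z = comb q m (l - pow v q) + pow v q"
    using z(1) q_le by (intro poly_mapping_eqI) (auto simp: lookup_comb lookup_add lookup_minus lookup_pow)
  ultimately show "z \<in> (+) (pow v q) ` prodU q M'' (sat v L)" using shiftI[OF prodUI] z(2) by blast
qed

lemma vanish_W_K:
  assumes "\<alpha> \<in> (+) (pow v q) ` prodU q M'' (sat v L)"
  shows "vanish ((+) (pow v q) ` prodU q M'' (sat v L)) (prodW q X'' M'' L) \<alpha>"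
  unfolding vanish_def
proof (intro exI conjI ballI impI)
  show "expo_at \<alpha> v > 0" using assms q by (auto simp: lookup_add lookup_pow)
  fix y assume "y \<in> (+) (pow v q) ` prodU q M'' (sat v L)"
  then obtain m l where y: "y = comb q m l + pow v q" "m \<in> M''" "l \<in> sat v L"
    by (elim shiftE) (auto simp: prodU_def)
  show "y - pow v 1 \<in> prodW q X'' M'' L"
    using prodU_subset_W[OF y(2) sat_pow(2)[OF y(3)]] y(1) add_pow_minus_pow[OF q, of "comb q m l" v]
    by (simp add: comb_add)
qed

text \<open>A variable of \<open>X''\<close> in a generator dividing the Frobenius part of \<alpha>
  serves here. Both sides use the same saturation of \<open>L\<close>, so, unlike in
  \<open>vanish_U_J\<close>, nothing has to be brought back into \<open>L\<close>.\<close>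

lemma vanish_W_J:
  assumes \<alpha>: "\<alpha> \<in> (+) (pow v q) ` prodU q M'' (sat v L)"
  shows "vanish ((+) (pow v q) ` prodU q M'' (sat v L)) ((+) (pow v q) ` prodU q M' (sat v L)) \<alpha>"
proof -
  let ?A = "(+) (pow v q) ` prodU q M'' (sat v L)"
  obtain m1 l1 where m1: "\<alpha> = comb q m1 l1 + pow v q" "m1 \<in> M''"
    using \<alpha> by (elim shiftE) (auto simp: prodU_def)
  obtain m0 where m0: "m0 \<in> M''" "Poly_Mapping.keys m0 \<subseteq> X''" "divides m0 m1" "m0 \<noteq> 0"
    using M''_gen[OF m1(2)] by blast
  obtain s where s: "s \<in> X''" "expo_at m0 s > 0" using Min_keys(2,3)[OF m0(4,2)] by blast
  have "expo_at m1 s > 0" using s(2) m0(3)[unfolded divides_iff, rule_format, of s] by simp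
  then have s\<alpha>: "q \<le> expo_at \<alpha> s" using expo_ge[of m1 l1 \<alpha> s] m1(1) divides_refl by blast
  have "y - pow s 1 \<in> (+) (pow v q) ` prodU q M' (sat v L)"
    if y: "y \<in> ?A" "expo_at y s = expo_at \<alpha> s" for y
  proof -
    obtain m l where m: "y = comb q m l + pow v q" "m \<in> M''" "l \<in> sat v L"
      using y(1) by (elim shiftE) (auto simp: prodU_def)
    show ?thesis
    proof (cases "expo_at m s > 0")
      case True
      have "l + pow s (q - 1) \<in> sat v L" using upsetD[OF upLs m(3)] divides_add(1) by blast
      moreover have "m - pow s 1 \<in> M'" using M'_I[OF _ s(1) True] m(2) M''_M by blast
      moreover have "y - pow s 1 = comb q (m - pow s 1) (l + pow s (q - 1)) + pow v q"
      proof -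
        have "y = (comb q (m - pow s 1) l + pow v q) + pow s q"
          using m(1) comb_minus_pow[OF True, of q l] by (simp add: comb_add add_ac)
        then have "y - pow s 1 = (comb q (m - pow s 1) l + pow v q) + pow s (q - 1)"
          using add_pow_minus_pow[OF q] by simp
        then show ?thesis by (simp add: comb_add add_ac)
      qed
      ultimately show ?thesis by (simp only: shiftI prodUI)
    next
      case False
      have "s \<noteq> v" using s(1) unfolding X''_def by blast
      then have l: "q \<le> expo_at l s" using y(2) s\<alpha> m(1) False by (simp add: lookup_add lookup_comb lookup_pow)
      have "l - pow s 1 \<in> sat v L" using capd_sat[OF goodD(2)[OF L], of v] l m(3) unfolding capd_def by blast
      moreover have "y - pow s 1 = comb q m (l - pow s 1) + pow v q"
      proof -
        have "0 < expo_at (comb q m l) s" "0 < expo_at l s" using l q by (simp_all add: lookup_comb)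
        then show ?thesis
          using m(1) add_minus_pow[of "comb q m l" s "pow v q"] comb_minus[of l s q m] by (simp add: add.commute)
      qed
      moreover have "m \<in> M'" using m(2) M''_M M_M' by blast
      ultimately show ?thesis by (simp only: shiftI prodUI)
    qed
  qed
  moreover have "expo_at \<alpha> s > 0" using s\<alpha> q by simp
  ultimately show ?thesis unfolding vanish_def by (intro exI[of _ s] conjI ballI impI)
qed

end

text \<open>One induction treats both kinds of products, because splitting either one also produces
  the other. The family of factors is closed under saturation, since splitting the second kind
  replaces \<open>L\<close> by its saturation.\<close>

lemma spl_prod:
  fixes M :: "('v::{finite,linorder}) expo set"
  assumes q: "q > 0" and good: "\<And>L. L \<in> \<L> \<Longrightarrow> good q L" and spl: "\<And>L. L \<in> \<L> \<Longrightarrow> \<exists>b. spl L b"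
    and sat: "\<And>L s. L \<in> \<L> \<Longrightarrow> sat s L \<in> \<L>"
  shows "borel_on X D M \<Longrightarrow> L \<in> \<L> \<Longrightarrow> (\<exists>b. spl (prodU q M L) b) \<and> (\<exists>b. spl (prodW q X M L) b)"
proof (induction "card X + D" arbitrary: X D M L rule: less_induct)
  case less
  note M = less.prems(1) and L = less.prems(2)
  have up: "upset L" using goodD(1) good[OF L] by blast
  consider "M = {}" | "0 \<in> M" | "M \<noteq> {}" "0 \<notin> M" by blast
  then show ?case
  proof cases
    case 1
    then have "prodU q M L = {}" "prodW q X M L = {}" by (simp_all add: prodU_def prodW_def)
    then show ?thesis using spl.empty by auto
  next
    case 2
    have "prodU q M L = L"
    proof (intro equalityI subsetI)
      fix y assume "y \<in> prodU q M L"
      then obtain m l where "y = comb q m l" "l \<in> L" unfolding prodU_def by blast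
      then show "y \<in> L" using upsetD[OF up, of l y] by (simp add: divides_iff lookup_comb)
    next
      fix y assume "y \<in> L"
      then have "comb q 0 y \<in> prodU q M L" using 2 unfolding prodU_def by blast
      then show "y \<in> prodU q M L" by (simp add: comb_zero)
    qed
    moreover have "prodW q X M L = L"
    proof (intro equalityI subsetI)
      fix y assume "y \<in> prodW q X M L"
      then obtain m l where y: "y = comb q m l" "l \<in> msat m L" unfolding prodW_def by blast
      show "y \<in> L"
      proof (cases "m = 0")
        case True
        then show ?thesis using y by (simp add: comb_zero msat_def)
      next
        case False
        let ?s = "Min (Poly_Mapping.keys m)"
        have s: "expo_at m ?s > 0" using False Min_in[of "Poly_Mapping.keys m"] by (simp add: in_keys_iff)
        \<comment> \<open>The \<open>q\<close> copies of the smallest variable contained in the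
          Frobenius part undo the saturation.\<close>
        have "l + pow ?s q \<in> L" using y(2) False by (intro sat_add_pow[OF good[OF L]]) (simp_all add: msat_def)
        moreover have "divides (l + pow ?s q) y"
          using y(1) comb_minus_pow[OF s, of q l] by (simp add: divides_iff lookup_comb)
        ultimately show ?thesis using upsetD[OF up] by blast
      qed
    next
      fix y assume "y \<in> L"
      then have "comb q 0 y \<in> prodW q X M L" using 2 unfolding prodW_def msat_def by force
      then show "y \<in> prodW q X M L" by (simp add: comb_zero)
    qed
    ultimately show ?thesis using spl[OF L] by simp
  next
    case 3
    obtain m where m: "m \<in> M" "Poly_Mapping.keys m \<subseteq> X" "total_deg m \<le> D" using borel_onD(3)[OF M] 3(1) by blast
    have "m \<noteq> 0" using m(1) 3(2) by blast
    then have X: "X \<noteq> {}" and D: "D > 0" using m(2,3) total_deg_eq_0[of m] by auto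
    have v: "Min X \<in> X" "\<And>x. x \<in> X \<Longrightarrow> Min X \<le> x" using X by (simp_all add: Min_in)
    interpret frobenius_split q L M X D "Min X"
      by unfold_locales (use q good[OF L] M 3(2) D v in simp_all)
    let ?sh = "(+) (pow (Min X) q)"
    have card: "card X'' < card X" unfolding X''_def using v(1) by (intro psubset_card_mono) auto
    have IH': "(\<exists>b. spl (prodU q M' L') b)" if "L' \<in> \<L>" for L'
      using less.hyps[OF _ borel_M' that] D by simp
    have IH'': "(\<exists>b. spl (prodU q M'' L') b) \<and> (\<exists>b. spl (prodW q X'' M'' L') b)" if "L' \<in> \<L>" for L'
      using less.hyps[OF _ borel_M'' that] card by simp
    have shift: "\<exists>b. spl (?sh ` S) b" if "\<exists>b. spl S b" for S using that spl_shift by blast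
    have "\<exists>b. spl (prodU q M L) b"
    proof -
      obtain b1 b2 b3 where b: "spl (?sh ` prodU q M' L) b1" "spl (prodU q M'' L) b2" "spl (?sh ` prodW q X'' M'' L) b3"
        using shift IH'[OF less.prems(2)] IH''[OF less.prems(2)] by metis
      show ?thesis unfolding split_U
        by (rule spl_split_vanish[OF b int_U]) (use vanish_U_J vanish_U_K in blast)
    qed
    moreover have "\<exists>b. spl (prodW q X M L) b"
    proof -
      obtain b1 b2 b3 where b: "spl (?sh ` prodU q M' (sat (Min X) L)) b1" "spl (prodW q X'' M'' L) b2"
        "spl (?sh ` prodU q M'' (sat (Min X) L)) b3"
        using shift IH'[OF sat[OF less.prems(2)]] IH''[OF less.prems(2)] IH''[OF sat[OF less.prems(2)]] by metis
      show ?thesis unfolding split_W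
        by (rule spl_split_vanish[OF b int_W]) (use vanish_W_J vanish_W_K in blast)
    qed
    ultimately show ?thesis ..
  qed
qed

section \<open>Finiteness of minimal generating sets, by Dickson's lemma\<close>

lemma dickson_subseq:
  fixes f :: "nat \<Rightarrow> 'v \<Rightarrow> nat"
  assumes "finite V"
  shows "\<exists>r. strict_mono (r :: nat \<Rightarrow> nat) \<and> (\<forall>v\<in>V. incseq (\<lambda>n. f (r n) v))"
  using assms
proof (induction V rule: finite_induct)
  case empty
  show ?case by (intro exI[of _ "\<lambda>n. n"]) (simp add: strict_mono_def)
next
  case (insert v V)
  obtain r where r: "strict_mono r" "\<And>u. u \<in> V \<Longrightarrow> incseq (\<lambda>n. f (r n) u)" using insert.IH by blast
  have sub: "\<exists>s. strict_mono (s :: nat \<Rightarrow> nat) \<and> incseq (\<lambda>n. g (s n))" for g :: "nat \<Rightarrow> nat"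
  proof -
    obtain s :: "nat \<Rightarrow> nat" where s: "strict_mono s" "monoseq (\<lambda>n. g (s n))" using seq_monosub[of g] by blast
    show ?thesis
    proof (cases "incseq (\<lambda>n. g (s n))")
      case False
      \<comment> \<open>A decreasing sequence of natural numbers is constant from a minimum on,
        hence increasing there.\<close>
      then have dec: "decseq (\<lambda>n. g (s n))" using s(2) by (simp add: monoseq_iff)
      obtain N where N: "\<And>n. g (s N) \<le> g (s n)" using ex_has_least_nat[of "\<lambda>_. True" 0 "\<lambda>n. g (s n)"] by blast
      have "g (s (N + n)) = g (s N)" for n using N decseqD[OF dec, of N "N + n"] by (simp add: order_antisym)
      moreover have "strict_mono (\<lambda>n. s (N + n))" using s(1) by (auto simp: strict_mono_def)
      ultimately show ?thesis by (intro exI[of _ "\<lambda>n. s (N + n)"]) (simp add: incseq_def)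
    qed (use s in blast)
  qed
  obtain s :: "nat \<Rightarrow> nat" where s: "strict_mono s" "incseq (\<lambda>n. f (r (s n)) v)"
    using sub[of "\<lambda>n. f (r n) v"] by blast
  have "incseq (\<lambda>n. f (r (s n)) u)" if "u \<in> V" for u
    using r(2)[OF that] strict_mono_mono[OF s(1)] by (simp add: incseq_def mono_def)
  moreover have "strict_mono (\<lambda>n. r (s n))" using r(1) s(1) by (auto simp: strict_mono_def)
  ultimately show ?case using s(2) by (intro exI[of _ "\<lambda>n. r (s n)"]) auto
qed

lemma finite_minel: "finite (minel (S :: ('v::finite) expo set))"
proof (rule ccontr)
  assume "infinite (minel S)"
  then obtain f :: "nat \<Rightarrow> 'v expo" where f: "inj f" "range f \<subseteq> minel S"
    using infinite_countable_subset by blast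
  obtain r :: "nat \<Rightarrow> nat" where r: "strict_mono r" "\<And>v. incseq (\<lambda>n. expo_at (f (r n)) v)"
    using dickson_subseq[of UNIV "\<lambda>n. expo_at (f n)"] by auto
  have "divides (f (r 0)) (f (r 1))" unfolding divides_iff using r(2) by (simp add: incseq_def)
  moreover have "f (r 0) \<in> S" "f (r 1) \<in> minel S" using f(2) by (auto simp: minel_def)
  ultimately have "f (r 0) = f (r 1)" by (simp add: minel_def)
  then have "r 0 = r 1" using f(1) by (simp add: inj_eq)
  then show False using r(1) by (simp add: strict_mono_eq)
qed

text \<open>Supplies the bound \<open>D\<close> of \<open>borel_on\<close> from the finiteness of
  the set of minimal generators.\<close>

lemma bounded_generators: "\<exists>D. \<forall>y\<in>(S :: ('v::finite) expo set). \<exists>m\<in>S. divides m y \<and> total_deg m \<le> D"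
proof -
  have "\<forall>y\<in>S. \<exists>m\<in>S. divides m y \<and> total_deg m \<le> Max (total_deg ` minel S)"
  proof
    fix y assume "y \<in> S"
    then obtain m where m: "m \<in> minel S" "divides m y" using ex_minel by blast
    then have "total_deg m \<le> Max (total_deg ` minel S)" using finite_minel by (intro Max_ge) auto
    moreover have "m \<in> S" using m(1) by (simp add: minel_def)
    ultimately show "\<exists>m\<in>S. divides m y \<and> total_deg m \<le> Max (total_deg ` minel S)" using m(2) by blast
  qed
  then show ?thesis by blast
qed

section \<open>Borel exchange, saturation and Frobenius products\<close>

definition borel_set :: "('v::linorder) expo set \<Rightarrow> bool" where
  "borel_set S \<longleftrightarrow> (\<forall>i j. i < j \<longrightarrow> (\<forall>y\<in>S. expo_at y j > 0 \<longrightarrow> y - pow j 1 + pow i 1 \<in> S))"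

lemma borel_setD: "borel_set S \<Longrightarrow> i < j \<Longrightarrow> y \<in> S \<Longrightarrow> expo_at y j > 0 \<Longrightarrow> y - pow j 1 + pow i 1 \<in> S"
  unfolding borel_set_def by blast

lemma borel_on_UNIV: "upset S \<Longrightarrow> borel_set S \<Longrightarrow> \<exists>D. borel_on UNIV D (S :: ('v::{finite,linorder}) expo set)"
  using bounded_generators[of S] unfolding borel_on_def borel_set_def by simp

lemma borel_set_sat:
  assumes S: "borel_set S"
  shows "borel_set (sat s S)"
  unfolding borel_set_def
proof (intro allI impI ballI)
  fix i j y assume ij: "i < j" and y: "y \<in> sat s S" "expo_at y j > 0"
  obtain k where k: "y + pow s k \<in> S" using y(1) unfolding sat_def by blast
  have "expo_at (y + pow s k) j > 0" using y(2) by (simp add: lookup_add)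
  then have "y + pow s k - pow j 1 + pow i 1 \<in> S" using borel_setD[OF S ij k] by blast
  moreover have "y + pow s k - pow j 1 + pow i 1 = y - pow j 1 + pow i 1 + pow s k"
    using y(2) by (intro poly_mapping_eqI) (auto simp: lookup_add lookup_minus lookup_pow)
  ultimately show "y - pow j 1 + pow i 1 \<in> sat s S" unfolding sat_def by auto
qed

text \<open>A power of \<open>s\<close> is exchanged for the same power of the smaller
  \<open>t\<close>, one factor at a time.\<close>

lemma borel_set_sat_antimono:
  assumes S: "borel_set S"
  shows "sat_antimono S"
  unfolding sat_antimono_def
proof (intro allI impI subsetI)
  fix s t y assume st: "t < s" and "y \<in> sat s S"
  then obtain k where k: "y + pow s k \<in> S" unfolding sat_def by blast
  have "y + pow s (k - j) + pow t j \<in> S" if "j \<le> k" for j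
    using that
  proof (induction j)
    case 0
    then show ?case using k by simp
  next
    case (Suc j)
    let ?y = "y + pow s (k - j) + pow t j"
    have "?y - pow s 1 + pow t 1 \<in> S"
      using Suc by (intro borel_setD[OF S st]) (simp_all add: lookup_add lookup_pow)
    moreover have "?y - pow s 1 + pow t 1 = y + pow s (k - Suc j) + pow t (Suc j)"
      using Suc.prems st by (intro poly_mapping_eqI) (auto simp: lookup_add lookup_minus lookup_pow)
    ultimately show ?case by simp
  qed
  from this[of k] have "y + pow t k \<in> S" by simp
  then show "y \<in> sat t S" unfolding sat_def by blast
qed

lemma upset_prodU:
  assumes "upset L"
  shows "upset (prodU q M L)"
  unfolding upset_def
proof (intro allI impI)
  fix y t assume "y \<in> prodU q M L" "divides y t"
  then obtain m l u where "m \<in> M" "l \<in> L" "t = comb q m l + u" unfolding prodU_def divides_def by blast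
  moreover from this have "l + u \<in> L" using upsetD[OF assms] divides_add(1) by blast
  ultimately show "t \<in> prodU q M L" unfolding prodU_def by (auto simp flip: comb_add)
qed

text \<open>Saturating by a variable amounts to setting it equal to 1, which is
  multiplicative.\<close>

lemma sat_prodU:
  assumes L: "upset L"
  shows "sat s (prodU q M L) = prodU q (sat s M) (sat s L)"
proof (intro equalityI subsetI)
  fix y assume "y \<in> sat s (prodU q M L)"
  then obtain k m l where y: "y + pow s k = comb q m l" "m \<in> M" "l \<in> L" unfolding sat_def prodU_def by blast
  \<comment> \<open>\<open>m\<close> loses its whole power of \<open>s\<close>, and the exponent of
    \<open>s\<close> in \<open>y\<close> is moved entirely to \<open>l'\<close>.\<close>
  define m' where "m' = m - pow s (expo_at m s)"
  define l' where "l' = mk (\<lambda>v. if v = s then expo_at y s else expo_at l v)"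
  have yv: "expo_at y v + (if v = s then k else 0) = q * expo_at m v + expo_at l v" for v
    using arg_cong[OF y(1), of "\<lambda>t. expo_at t v"] by (simp add: lookup_add lookup_comb lookup_pow)
  have "y = comb q m' l'"
  proof (rule poly_mapping_eqI)
    fix v show "expo_at y v = expo_at (comb q m' l') v"
      using yv[of v] by (cases "v = s") (simp_all add: lookup_comb m'_def l'_def lookup_minus lookup_pow)
  qed
  moreover have "m' + pow s (expo_at m s) = m"
    unfolding m'_def by (intro poly_mapping_eqI) (simp add: lookup_add lookup_minus lookup_pow)
  then have "m' \<in> sat s M" using y(2) unfolding sat_def by (metis (mono_tags) mem_Collect_eq)
  moreover have "divides l (l' + pow s (expo_at l s))"
    by (simp add: divides_iff l'_def lookup_add lookup_pow)
  then have "l' + pow s (expo_at l s) \<in> L" using upsetD[OF L y(3)] by blast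
  then have "l' \<in> sat s L" unfolding sat_def by blast
  ultimately show "y \<in> prodU q (sat s M) (sat s L)" unfolding prodU_def by blast
next
  fix y assume "y \<in> prodU q (sat s M) (sat s L)"
  then obtain m l a b where y: "y = comb q m l" "m + pow s a \<in> M" "l + pow s b \<in> L"
    unfolding prodU_def sat_def by blast
  have "y + pow s (q * a + b) = comb q (m + pow s a) (l + pow s b)"
    unfolding y(1) by (intro poly_mapping_eqI) (simp add: lookup_comb lookup_add lookup_pow distrib_left)
  then have "y + pow s (q * a + b) \<in> prodU q M L" using y(2,3) unfolding prodU_def by blast
  then show "y \<in> sat s (prodU q M L)" unfolding sat_def by blast
qed

text \<open>Antimonotonicity passes to the product because saturation is multiplicative. An exponent
  of at least \<open>q * q'\<close> forces exponent \<open>q\<close> in \<open>l\<close> or exponent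
  \<open>q'\<close> in \<open>m\<close>; in the second case one factor of \<open>m\<close> is traded
  for \<open>q\<close> factors in \<open>l\<close>, one of which is dropped.\<close>

lemma good_prodU:
  assumes L: "good q L" and M: "borel_set M" "capd q' M" and pos: "q > 0" "q' > 0"
  shows "good (q * q') (prodU q M L)"
  unfolding good_def
proof (intro conjI)
  show "upset (prodU q M L)" by (rule upset_prodU[OF goodD(1)[OF L]])
  show "sat_antimono (prodU q M L)"
    unfolding sat_antimono_def sat_prodU[OF goodD(1)[OF L]]
  proof (intro allI impI)
    fix s t :: 'a assume "t < s"
    then have "sat s M \<subseteq> sat t M" "sat s L \<subseteq> sat t L"
      using borel_set_sat_antimono[OF M(1)] goodD(3)[OF L] by (simp_all add: sat_antimono_def)
    then show "prodU q (sat s M) (sat s L) \<subseteq> prodU q (sat t M) (sat t L)" unfolding prodU_def by blast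
  qed
  show "capd (q * q') (prodU q M L)"
    unfolding capd_def
  proof (intro ballI allI impI)
    fix y s assume "y \<in> prodU q M L" and ge: "q * q' \<le> expo_at y s"
    then obtain m l where y: "y = comb q m l" "m \<in> M" "l \<in> L" unfolding prodU_def by blast
    show "y - pow s 1 \<in> prodU q M L"
    proof (cases "q \<le> expo_at l s")
      case True
      then have "l - pow s 1 \<in> L" using goodD(2)[OF L] y(3) unfolding capd_def by blast
      moreover have "y - pow s 1 = comb q m (l - pow s 1)" using comb_minus[of l s q m] True pos(1) y(1) by simp
      ultimately show ?thesis using y(2) unfolding prodU_def by blast
    next
      case False
      have "q' \<le> expo_at m s"
      proof (rule ccontr)
        assume "\<not> ?thesis"
        then have "q * Suc (expo_at m s) \<le> q * q'" by (intro mult_le_mono2) simp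
        then show False using ge False y(1) by (simp add: lookup_comb)
      qed
      then have m: "m - pow s 1 \<in> M" "expo_at m s > 0" using M(2) y(2) pos(2) unfolding capd_def by auto
      have "l + pow s (q - 1) \<in> L" using upsetD[OF goodD(1)[OF L] y(3)] divides_add(1) by blast
      moreover have "y - pow s 1 = comb q (m - pow s 1) (l + pow s (q - 1))"
        using y(1) comb_minus_pow[OF m(2), of q l] add_pow_minus_pow[OF pos(1), of "comb q (m - pow s 1) l" s]
        by (simp add: comb_add)
      ultimately show ?thesis using m(1) unfolding prodU_def by blast
    qed
  qed
qed

text \<open>All iterated saturations are included because \<open>spl_prod\<close> asks for a family
  closed under saturation, and the next factor of the product will ask for it again.\<close>

lemma spl_prodU_sat:
  fixes L M :: "('v::{finite,linorder}) expo set"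
  assumes "q > 0" and L: "good q L" and spl: "\<And>ss. \<exists>b. spl (foldr sat ss L) b"
    and M: "upset M" "borel_set M"
  shows "\<exists>b. spl (foldr sat ss (prodU q M L)) b"
proof -
  let ?C = "range (\<lambda>ss. foldr sat ss L)"
  have good: "good q (foldr sat ss L)" for ss by (induction ss) (simp_all add: L good_sat)
  have "foldr sat ss (prodU q M L) = prodU q (foldr sat ss M) (foldr sat ss L)"
    by (induction ss) (simp_all add: sat_prodU goodD(1)[OF good])
  moreover have "upset (foldr sat ss M)" by (induction ss) (simp_all add: M upset_sat)
  moreover have "borel_set (foldr sat ss M)" by (induction ss) (simp_all add: M borel_set_sat)
  ultimately obtain D where D: "borel_on UNIV D (foldr sat ss M)"
    and eq: "foldr sat ss (prodU q M L) = prodU q (foldr sat ss M) (foldr sat ss L)"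
    using borel_on_UNIV by blast
  have "(\<exists>b. spl (prodU q (foldr sat ss M) (foldr sat ss L)) b) \<and>
      (\<exists>b. spl (prodW q UNIV (foldr sat ss M) (foldr sat ss L)) b)"
  proof (rule spl_prod[where \<L> = ?C, OF \<open>q > 0\<close> _ _ _ D])
    show "sat s L' \<in> ?C" if "L' \<in> ?C" for L' s
    proof -
      obtain ss where "L' = foldr sat ss L" using \<open>L' \<in> ?C\<close> by blast
      then have "sat s L' = foldr sat (s # ss) L" by simp
      then show ?thesis by (rule range_eqI)
    qed
    show "good q L'" if "L' \<in> ?C" for L' using that good by auto
    show "\<exists>b. spl L' b" if "L' \<in> ?C" for L' using that spl by auto
  qed simp
  then show ?thesis unfolding eq by (rule conjunct1)
qed

section \<open>Products of Frobenius powers as sets of exponents\<close>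

primrec prod_set :: "(nat \<Rightarrow> nat) \<Rightarrow> (nat \<Rightarrow> ('v::finite) expo set) \<Rightarrow> nat \<Rightarrow> 'v expo set" where
  "prod_set q S 0 = UNIV"
| "prod_set q S (Suc k) = prodU (q (Suc k)) (S (Suc k)) (prod_set q S k)"

lemma upset_prod_set: "upset (prod_set q S k)"
  by (induction k) (simp_all add: upset_UNIV upset_prodU)

lemma monom_add: "monom (s + t) = monom s * (monom t :: ('v, 'k::field) mpoly)"
  by (simp add: monom_def mult_single)

lemma monom_power: "(monom s :: ('v::finite, 'k::field) mpoly) ^ q = monom (comb q s 0)"
proof (induction q)
  case 0
  have "comb 0 s 0 = 0" by (intro poly_mapping_eqI) (simp add: lookup_comb)
  then show ?case by (simp add: monom_def single_one)
next
  case (Suc q)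
  have "comb (Suc q) s 0 = s + comb q s 0" by (intro poly_mapping_eqI) (simp add: lookup_comb lookup_add)
  then show ?case using Suc by (simp add: monom_add)
qed

lemma monom_sum: "finite I \<Longrightarrow> monom (\<Sum>i\<in>I. f i) = (\<Prod>i\<in>I. monom (f i) :: ('v, 'k::field) mpoly)"
  by (induction I rule: finite_induct) (simp_all add: monom_add, simp add: monom_def single_one)

text \<open>Frobenius powers are given by minimal generators. Taking all elements of
  \<open>S\<close> instead yields the same ideal, since divisibility is preserved by the
  \<open>q\<close>-th power.\<close>

lemma frob_power_Mon:
  assumes S: "upset (S :: ('v::finite) expo set)"
  shows "frob_power q (Mon S :: ('v, 'k::field) mpoly set) = Mon (prodU q S UNIV)"
proof -
  have "(\<lambda>s. (monom s :: ('v, 'k) mpoly) ^ q) ` minel S = monom ` (\<lambda>s. comb q s 0) ` minel S"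
    by (simp add: monom_power image_image)
  then have "frob_power q (Mon S :: ('v, 'k) mpoly set) = Mon (upc ((\<lambda>s. comb q s 0) ` minel S))"
    by (simp only: frob_power_def mingens_Mon ideal_gen_monom)
  also have "upc ((\<lambda>s. comb q s 0) ` minel S) = prodU q S UNIV"
  proof (intro equalityI subsetI)
    fix y assume "y \<in> upc ((\<lambda>s. comb q s 0) ` minel S)"
    then obtain s u where "s \<in> minel S" "y = comb q s 0 + u" unfolding upc_def divides_def by blast
    moreover from this have "y = comb q s u" by (simp flip: comb_add)
    ultimately show "y \<in> prodU q S UNIV" unfolding prodU_def minel_def by blast
  next
    fix y assume "y \<in> prodU q S UNIV"
    then obtain m l where y: "y = comb q m l" "m \<in> S" unfolding prodU_def by blast
    obtain s where s: "s \<in> minel S" "divides s m" using ex_minel y(2) by blast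
    have "divides (comb q s 0) y" using s(2) y(1)
      by (auto simp: divides_iff lookup_comb intro: trans_le_add1)
    then show "y \<in> upc ((\<lambda>s. comb q s 0) ` minel S)" using s(1) unfolding upc_def by blast
  qed
  finally show ?thesis .
qed

text \<open>The surplus \<open>u\<close> absorbs the unit ideal with which the product starts, and
  covers the empty product.\<close>

lemma prod_set_decomp: "t \<in> prod_set q S k \<Longrightarrow>
    \<exists>f u. (\<forall>i\<in>{1..k}. f i \<in> prodU (q i) (S i) UNIV) \<and> t = u + (\<Sum>i\<in>{1..k}. f i)"
proof (induction k arbitrary: t)
  case 0
  then show ?case by simp
next
  case (Suc k)
  then obtain m l where t: "t = comb (q (Suc k)) m l" "m \<in> S (Suc k)" "l \<in> prod_set q S k"
    unfolding prod_set.simps prodU_def by blast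
  obtain f u where f: "\<forall>i\<in>{1..k}. f i \<in> prodU (q i) (S i) UNIV" "l = u + (\<Sum>i\<in>{1..k}. f i)"
    using Suc.IH[OF t(3)] by blast
  let ?g = "f(Suc k := comb (q (Suc k)) m 0)"
  have "?g i \<in> prodU (q i) (S i) UNIV" if "i \<in> {1..Suc k}" for i
    using f(1) t(2) that by (cases "i = Suc k") (auto simp: prodU_def)
  moreover have "t = u + (\<Sum>i\<in>{1..Suc k}. ?g i)"
  proof -
    have "(\<Sum>i\<in>{1..k}. ?g i) = (\<Sum>i\<in>{1..k}. f i)" by (intro sum.cong) auto
    then show ?thesis using t(1) f(2) comb_add[of "q (Suc k)" m 0 l] by (simp add: add_ac)
  qed
  ultimately show ?case by blast
qed

lemma ideal_prod_Mon:
  "ideal_prod {1..k} (\<lambda>i. Mon (prodU (q i) (S i) UNIV)) = (Mon (prod_set q S k) :: ('v::finite, 'k::field) mpoly set)"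
proof (intro equalityI)
  interpret R: Modules.module "(*) :: ('v, 'k) mpoly \<Rightarrow> _" by (rule mult_module)
  let ?A = "\<lambda>i. Mon (prodU (q i) (S i) UNIV) :: ('v, 'k) mpoly set"
  let ?X = "{\<Prod>i\<in>{1..k}. f i | f. \<forall>i\<in>{1..k}. f i \<in> ?A i}"
  have prod: "(\<Prod>i\<in>{1..k}. f i) \<in> Mon (prod_set q S k)" if "\<forall>i\<in>{1..k}. f i \<in> ?A i" for f k
    using that
  proof (induction k)
    case 0
    then show ?case by (simp add: Mon_UNIV)
  next
    case (Suc k)
    have g: "(\<Prod>i\<in>{1..k}. f i) \<in> Mon (prod_set q S k)" (is "?g \<in> _") using Suc by auto
    have f: "f (Suc k) \<in> ?A (Suc k)" using Suc.prems by auto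
    have "Poly_Mapping.keys (?g * f (Suc k)) \<subseteq> prod_set q S (Suc k)"
    proof
      fix t assume "t \<in> Poly_Mapping.keys (?g * f (Suc k))"
      then obtain a b where ab: "a \<in> Poly_Mapping.keys ?g" "b \<in> Poly_Mapping.keys (f (Suc k))" "t = a + b"
        using keys_mult[of ?g "f (Suc k)"] by blast
      have a: "a \<in> prod_set q S k" using g ab(1) by (auto simp: Mon_def)
      obtain m l where b: "b = comb (q (Suc k)) m l" "m \<in> S (Suc k)" using f ab(2) unfolding Mon_def prodU_def by blast
      have "l + a \<in> prod_set q S k" using upsetD[OF upset_prod_set a] divides_add(2) by blast
      moreover have "t = comb (q (Suc k)) m (l + a)" unfolding ab(3) b(1) comb_add by (rule add.commute)
      ultimately show "t \<in> prod_set q S (Suc k)" using b(2) unfolding prod_set.simps prodU_def by blast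
    qed
    then show ?case by (simp add: Mon_def)
  qed
  have "R.subspace (Mon (prod_set q S k))"
  proof (rule R.subspaceI)
    show "c * x \<in> Mon (prod_set q S k)" if "x \<in> Mon (prod_set q S k)" for c x :: "('v, 'k) mpoly"
      using smult_in_Mon[OF that upset_prod_set, of c] by (simp add: mult.commute)
  qed (simp_all add: Mon_zero Mon_add)
  moreover have "?X \<subseteq> Mon (prod_set q S k)"
  proof
    fix x assume "x \<in> ?X"
    then obtain f where "x = (\<Prod>i\<in>{1..k}. f i)" "\<forall>i\<in>{1..k}. f i \<in> ?A i" by (elim CollectE exE conjE)
    then show "x \<in> Mon (prod_set q S k)" using prod by simp
  qed
  ultimately have "R.span ?X \<subseteq> Mon (prod_set q S k)" by (intro R.span_minimal)
  then show "ideal_prod {1..k} ?A \<subseteq> Mon (prod_set q S k)"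
    by (simp only: ideal_prod_def ideal_gen_def)
  have "monom ` prod_set q S k \<subseteq> R.span ?X"
  proof
    fix x :: "('v, 'k) mpoly" assume "x \<in> monom ` prod_set q S k"
    then obtain t where t: "t \<in> prod_set q S k" "x = monom t" by blast
    obtain f u where f: "\<forall>i\<in>{1..k}. f i \<in> prodU (q i) (S i) UNIV" "t = u + (\<Sum>i\<in>{1..k}. f i)"
      using prod_set_decomp[OF t(1)] by blast
    have "(\<Prod>i\<in>{1..k}. monom (f i)) \<in> ?X"
      using f(1) by (intro CollectI exI[of _ "\<lambda>i. monom (f i)"]) (simp add: monom_in_Mon)
    then have "monom u * (\<Prod>i\<in>{1..k}. monom (f i)) \<in> R.span ?X" by (intro R.span_scale R.span_base)
    then show "x \<in> R.span ?X" unfolding t(2) f(2) by (simp add: monom_add monom_sum)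
  qed
  then have "R.span (monom ` prod_set q S k) \<subseteq> R.span ?X" by (intro R.span_minimal R.subspace_span)
  moreover have "R.span (monom ` prod_set q S k) = Mon (prod_set q S k)"
    using ideal_gen_monom[where 'k = 'k, of "prod_set q S k"]
    unfolding ideal_gen_def upc_upset[OF upset_prod_set] .
  ultimately show "Mon (prod_set q S k) \<subseteq> ideal_prod {1..k} ?A"
    by (simp only: ideal_prod_def ideal_gen_def)
qed

text \<open>The exchange with \<open>a = 1\<close> on minimal generators extends to all elements:
  either the generator dividing \<open>y\<close> involves \<open>j\<close> and is exchanged along
  with \<open>y\<close>, or it divides the exchanged monomial anyway.\<close>

lemma borel_ideal_set:
  assumes "borel_ideal (J :: ('v::{finite,linorder}, 'k::field) mpoly set)"
  shows "\<exists>S. upset S \<and> J = Mon S \<and> borel_set S"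
proof -
  obtain S where S: "upset S" "J = Mon S" using assms unfolding borel_ideal_def monomial_ideal_iff by blast
  have B: "m - pow j 1 + pow i 1 \<in> S" if "i < j" "m \<in> minel S" "1 \<le> expo_at m j" for i j m
  proof -
    have "(monom (m - pow j 1 + pow i 1) :: ('v, 'k) mpoly) \<in> J"
      using assms that unfolding borel_ideal_def S(2) mingens_Mon by blast
    then show ?thesis unfolding S(2) by (simp only: monom_in_Mon)
  qed
  have "borel_set S"
    unfolding borel_set_def
  proof (intro allI impI ballI)
    fix i j y assume ij: "i < j" and y: "y \<in> S" "expo_at y j > 0"
    obtain m where m: "m \<in> minel S" "divides m y" using ex_minel y(1) by blast
    have le: "expo_at m u \<le> expo_at y u" for u using m(2) by (simp add: divides_iff)
    show "y - pow j 1 + pow i 1 \<in> S"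
    proof (cases "1 \<le> expo_at m j")
      case True
      have "divides (m - pow j 1 + pow i 1) (y - pow j 1 + pow i 1)"
        unfolding divides_iff lookup_add lookup_minus using le by (simp add: diff_le_mono)
      then show ?thesis using upsetD[OF S(1) B[OF ij m(1) True]] by blast
    next
      case False
      have "expo_at m u \<le> expo_at (y - pow j 1 + pow i 1) u" for u
        using le[of u] False by (cases "u = j") (auto simp: lookup_add lookup_minus lookup_pow)
      then have "divides m (y - pow j 1 + pow i 1)" by (simp add: divides_iff)
      moreover have "m \<in> S" using m(1) by (simp add: minel_def)
      ultimately show ?thesis using upsetD[OF S(1)] by blast
    qed
  qed
  then show ?thesis using S by blast
qed

text \<open>Turns the degree hypothesis into the exponent bound, each exponent being at most the
  total degree.\<close>

lemma capd_of_degree: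
  assumes "upset (S :: ('v::finite) expo set)" and "\<And>m. m \<in> minel S \<Longrightarrow> total_deg m < q"
  shows "capd q S"
  unfolding capd_def
proof (intro ballI allI impI)
  fix y s assume y: "y \<in> S" "q \<le> expo_at y s"
  obtain m where m: "m \<in> minel S" "divides m y" using ex_minel y(1) by blast
  have "expo_at m s \<le> total_deg m" unfolding total_deg_def by (intro member_le_sum) simp_all
  then have "expo_at m s < expo_at y s" using assms(2)[OF m(1)] y(2) by simp
  then have "expo_at m u \<le> expo_at (y - pow s 1) u" for u
    using m(2)[unfolded divides_iff, rule_format, of u] by (auto simp: lookup_minus lookup_pow)
  then have "divides m (y - pow s 1)" by (simp add: divides_iff)
  moreover have "m \<in> S" using m(1) by (simp add: minel_def)
  ultimately show "y - pow s 1 \<in> S" using upsetD[OF assms(1)] by blast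
qed

lemma foldr_sat_UNIV: "foldr sat ss UNIV = UNIV"
  by (induction ss) (simp_all add: sat_def)

text \<open>After \<open>j < k\<close> factors the partial product has exponents bounded by the next
  Frobenius exponent \<open>q (Suc j)\<close>, as splitting with the next factor requires;
  \<open>c\<close> is the ratio of consecutive exponents. The last factor is added afterwards, with
  the empty list of saturations.\<close>

lemma spl_prod_set:
  fixes S :: "nat \<Rightarrow> ('v::{finite,linorder}) expo set"
  assumes q: "\<And>i. q i > 0" and k: "1 \<le> k"
    and S: "\<And>i. i \<in> {1..k} \<Longrightarrow> upset (S i) \<and> borel_set (S i)"
    and cap: "\<And>i. i \<in> {1..<k} \<Longrightarrow> \<exists>c. c > 0 \<and> q (i + 1) = q i * c \<and> capd c (S i)"
  shows "\<exists>b. spl (prod_set q S k) b"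
proof -
  have "good (q (Suc j)) (prod_set q S j) \<and> (\<forall>ss. \<exists>b. spl (foldr sat ss (prod_set q S j)) b)" if "j < k" for j
    using that
  proof (induction j)
    case 0
    have "{t :: 'v expo. divides 0 t} = UNIV" by simp
    then have "\<exists>b. spl (UNIV :: 'v expo set) b" using spl.principal[of "0 :: 'v expo"] by metis
    moreover have "good (q (Suc 0)) (UNIV :: 'v expo set)"
      by (simp add: good_def capd_def sat_antimono_def upset_UNIV sat_def)
    ultimately show ?case by (simp add: foldr_sat_UNIV)
  next
    case (Suc j)
    then have IH: "good (q (Suc j)) (prod_set q S j)" "\<And>ss. \<exists>b. spl (foldr sat ss (prod_set q S j)) b" by auto
    have Sj: "upset (S (Suc j))" "borel_set (S (Suc j))" using S[of "Suc j"] Suc.prems by auto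
    obtain c where c: "c > 0" "q (Suc (Suc j)) = q (Suc j) * c" "capd c (S (Suc j))"
      using cap[of "Suc j"] Suc.prems by auto
    show ?case
      using good_prodU[OF IH(1) Sj(2) c(3) q c(1)] spl_prodU_sat[OF q IH Sj] by (simp add: c(2))
  qed
  from this[of "k - 1"] k have L: "good (q k) (prod_set q S (k - 1))"
    "\<And>ss. \<exists>b. spl (foldr sat ss (prod_set q S (k - 1))) b" by auto
  have Sk: "upset (S k)" "borel_set (S k)" using S[of k] k by auto
  have "prod_set q S k = prodU (q k) (S k) (prod_set q S (k - 1))" using k by (cases k) simp_all
  then show ?thesis using spl_prodU_sat[OF q L Sk, of "[]"] by simp
qed

lemma spl_imp_admits: "\<exists>S b. I = Mon S \<and> spl S b \<Longrightarrow>
    admits_minimal_pruned (I :: ('v::finite, 'k::field) mpoly set)"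
  using spl_admits[where 'k = 'k] by blast

lemma borel_product_admits:
  fixes J :: "nat \<Rightarrow> ('v::{finite,linorder}, 'k::field) mpoly set"
  assumes p: "prime p" and k: "1 \<le> k" and r: "\<forall>i\<in>{1..<k}. r i < r (i + 1)"
    and J: "\<forall>i\<in>{1..k}. borel_ideal (J i)"
    and deg: "\<forall>i\<in>{1..<k}. \<forall>m\<in>mingens (J i). total_deg m < p ^ (r (i + 1) - r i)"
  shows "admits_minimal_pruned (ideal_prod {1..k} (\<lambda>i. frob_power (p ^ r i) (J i)))"
proof -
  have "\<forall>i\<in>{1..k}. \<exists>S. upset S \<and> J i = Mon S \<and> borel_set S" using J borel_ideal_set by blast
  then have "\<exists>S. \<forall>i\<in>{1..k}. upset (S i) \<and> J i = Mon (S i) \<and> borel_set (S i)" by (rule bchoice)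
  then obtain S where S: "\<And>i. i \<in> {1..k} \<Longrightarrow> upset (S i) \<and> J i = Mon (S i) \<and> borel_set (S i)" by blast
  let ?q = "\<lambda>i. p ^ r i"
  have p0: "p > 0" using p by (simp add: prime_gt_0_nat)
  have "\<exists>c. c > 0 \<and> ?q (i + 1) = ?q i * c \<and> capd c (S i)" if i: "i \<in> {1..<k}" for i
  proof (intro exI[of _ "p ^ (r (i + 1) - r i)"] conjI)
    show "0 < p ^ (r (i + 1) - r i)" using p0 by simp
    show "p ^ r (i + 1) = p ^ r i * p ^ (r (i + 1) - r i)"
      using r i by (simp add: power_add[symmetric] less_imp_le)
    have "upset (S i)" "J i = Mon (S i)" using S[of i] i by auto
    then show "capd (p ^ (r (i + 1) - r i)) (S i)"
      using deg i by (intro capd_of_degree) (simp_all add: mingens_Mon)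
  qed
  then have "\<exists>b. spl (prod_set ?q S k) b"
    using S k p0 by (intro spl_prod_set) simp_all
  moreover have "ideal_prod {1..k} (\<lambda>i. frob_power (?q i) (J i)) =
      ideal_prod {1..k} (\<lambda>i. Mon (prodU (?q i) (S i) UNIV) :: ('v, 'k) mpoly set)"
  proof -
    have eq: "frob_power (?q i) (J i) = Mon (prodU (?q i) (S i) UNIV)" if "i \<in> {1..k}" for i
      using S[OF that] frob_power_Mon[of "S i" "?q i", where 'k = 'k] by simp
    have "(\<forall>i\<in>{1..k}. f i \<in> frob_power (?q i) (J i)) =
        (\<forall>i\<in>{1..k}. f i \<in> (Mon (prodU (?q i) (S i) UNIV) :: ('v, 'k) mpoly set))" for f
      using eq by (intro ball_cong refl) simp
    then show ?thesis by (simp only: ideal_prod_def)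
  qed
  ultimately show ?thesis
    using ideal_prod_Mon[of k ?q S, where 'k = 'k] by (intro spl_imp_admits) auto
qed

theorem theorem2:
  shows "(\<forall>I :: ('v::{finite,linorder}, 'k::field) mpoly set.
            vertex_splittable UNIV I \<longrightarrow> admits_minimal_pruned I) \<and>
         (\<forall>I :: ('v, 'k) mpoly set.
            linear_quotients I \<longrightarrow> admits_minimal_pruned I) \<and>
         (\<forall>(p::nat) (k::nat) (r :: nat \<Rightarrow> nat) (J :: nat \<Rightarrow> ('v, 'k) mpoly set).
            prime p \<and> 1 \<le> k \<and> (\<forall>i\<in>{1..<k}. r i < r (i + 1)) \<and>
            (\<forall>i\<in>{1..k}. borel_ideal (J i)) \<and>
            (\<forall>i\<in>{1..<k}. \<forall>m\<in>mingens (J i). total_deg m < p ^ (r (i + 1) - r i))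
            \<longrightarrow> admits_minimal_pruned (ideal_prod {1..k} (\<lambda>i. frob_power (p ^ r i) (J i))))"
proof (intro conjI allI impI)
  fix I :: "('v, 'k) mpoly set"
  show "admits_minimal_pruned I" if "vertex_splittable UNIV I"
    using vertex_splittable_spl[OF that] by (rule spl_imp_admits)
  show "admits_minimal_pruned I" if "linear_quotients I"
    using linear_quotients_spl[OF that] by (rule spl_imp_admits)
qed (elim conjE, rule borel_product_admits)

end
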